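(* Let $\{\rho^\varepsilon\}_{\varepsilon>0}\subset\mathcal{P}(\mathbb{T})$ with $\rho^\varepsilon\in C^1(\mathbb{T})\cap C^4_{loc}(\{\rho^\varepsilon>0\})$, $\rho^\varepsilon\to\rho_0$ in $\mathcal{W}^2(\mathbb{T})$ as $\varepsilon\to0^+$, and $\sup_\varepsilon E^\varepsilon[\rho^\varepsilon]<\infty$. Then $$\liminf_{\varepsilon\to0^+}\mathcal{G}^\varepsilon(\rho^\varepsilon)\ge|\nabla E^{**}|(\rho_0).$$
   Context: $\mathbb{T}=\mathbb{R}/\mathbb{Z}$. Elements of $\mathcal{P}(\mathbb{T})$ are taken absolutely continuous and identified with their densities. $\mathcal{W}^2(\mathbb{T})$ denotes $\mathcal{P}(\mathbb{T})$ with the $L^2$-Wasserstein distance $d_2$. Standing assumptions on $W$: $W\in C^2([0,\infty),[0,\infty))$, normalized with $W(0)=0$, $W'(0)=0$; $W^{**}$ is its convex envelope; $Q'(y):=yW'(y)-W(y)$. (H1) there is $C>0$ with $|Q'(y)|\le C(1+W(y))$ and $|W'(y)|\le C(1+W(y))$ for all $y\ge0$. (H2) $Q'(y)\to+\infty$ as $y\to+\infty$. (H3) the unstable set $\Sigma:=\overline{\{W>W^{**}\}\cup\{0\}}$ equals $\bigcup_{i=1}^p[a_i,b_i]$ with $p\in\mathbb{N}$ and $a_{i+1}>b_i$ (possibly $a_1=b_1=0$). (H4) $W''>0$ on $[0,\infty)\setminus\Sigma$, and $\inf_K W''>0$ for every compact $K\subset[0,\infty)\setminus\Sigma$. Functionals: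 $E^\varepsilon[\nu]=\int_{\mathbb T}\frac{\varepsilon^2}{2}|\nu_x|^2+W(\nu)\,dx$ if $\nu\in H^1(\mathbb{T})$, $+\infty$ otherwise. With $Q^{**\prime}(z):=zW^{**\prime}(z)-W^{**}(z)$, $|\nabla E^{**}|(\mu):=\big(\int_{\mathbb T}\mu|(W^{**\prime}(\mu))_x|^2dx\big)^{1/2}$ if $Q^{**\prime}(\mu)\in W^{1,1}(\mathbb{T})$, $+\infty$ otherwise. For $\mu\in H^1(\mathbb{T})$, $G^\varepsilon(\mu):=\mu W'(\mu)-W(\mu)+\frac{3\varepsilon^2}{2}|\mu_x|^2-\varepsilon^2(\mu\mu_x)_x$ (a distribution), $\mathcal{T}^\varepsilon(\mu):=\{g\in L^2(\mathbb{T}):G^\varepsilon(\mu)_x=\sqrt{\mu}\,g\text{ in }\mathcal{D}'(\mathbb{T})\}$, and $\mathcal{G}^\varepsilon(\mu):=\inf_{g\in\mathcal{T}^\varepsilon(\mu)}\|g\|_{L^2}$ if $\mathcal{T}^\varepsilon(\mu)\neq\emptyset$, $+\infty$ otherwise. *)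

theory Defs
  imports "HOL-Probability.Probability"
begin

text \<open>The torus T = R/Z is represented by 1-periodic functions on the real line;
  integrals over T are integrals over the fundamental domain [0,1].\<close>

definition periodic1 :: "(real \<Rightarrow> real) \<Rightarrow> bool" where
  "periodic1 f \<longleftrightarrow> (\<forall>x. f (x + 1) = f x)"

definition test_fun :: "(real \<Rightarrow> real) \<Rightarrow> bool" where
  "test_fun \<phi> \<longleftrightarrow> periodic1 \<phi> \<and> (\<forall>k x. ((deriv ^^ k) \<phi>) differentiable (at x))"

definition Ck_on :: "nat \<Rightarrow> real set \<Rightarrow> (real \<Rightarrow> real) \<Rightarrow> bool" where
  "Ck_on k U f \<longleftrightarrow> (\<forall>j<k. \<forall>x\<in>U. ((deriv ^^ j) f) differentiable (at x))
                    \<and> continuous_on U ((deriv ^^ k) f)"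

text \<open>Absolutely continuous probability measures on T, identified with densities.\<close>
definition prob_density :: "(real \<Rightarrow> real) \<Rightarrow> bool" where
  "prob_density \<nu> \<longleftrightarrow> periodic1 \<nu> \<and> \<nu> \<in> borel_measurable borel \<and> (\<forall>x. 0 \<le> \<nu> x)
     \<and> set_integrable lborel {0..1} \<nu> \<and> (LINT x:{0..1}|lborel. \<nu> x) = 1"

definition weak_deriv :: "(real \<Rightarrow> real) \<Rightarrow> (real \<Rightarrow> real) \<Rightarrow> bool" where
  "weak_deriv f g \<longleftrightarrow> set_integrable lborel {0..1} f \<and> set_integrable lborel {0..1} g
     \<and> (\<forall>\<phi>. test_fun \<phi> \<longrightarrow>
          (LINT x:{0..1}|lborel. f x * deriv \<phi> x) = - (LINT x:{0..1}|lborel. g x * \<phi> x))"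

definition wd :: "(real \<Rightarrow> real) \<Rightarrow> (real \<Rightarrow> real)" where
  "wd f = (SOME g. weak_deriv f g)"

definition H1 :: "(real \<Rightarrow> real) \<Rightarrow> bool" where
  "H1 f \<longleftrightarrow> periodic1 f \<and> f \<in> borel_measurable borel
     \<and> set_integrable lborel {0..1} (\<lambda>x. (f x)\<^sup>2)
     \<and> (\<exists>g. weak_deriv f g \<and> g \<in> borel_measurable borel
            \<and> set_integrable lborel {0..1} (\<lambda>x. (g x)\<^sup>2))"

definition W11 :: "(real \<Rightarrow> real) \<Rightarrow> bool" where
  "W11 f \<longleftrightarrow> periodic1 f \<and> (\<exists>g. weak_deriv f g)"

definition Tspace :: "real measure" where
  "Tspace = restrict_space lborel {0..<1}"

definition Tmeas :: "(real \<Rightarrow> real) \<Rightarrow> real measure" where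
  "Tmeas \<nu> = density Tspace (\<lambda>x. ennreal (\<nu> x))"

definition dist_T :: "real \<Rightarrow> real \<Rightarrow> real" where
  "dist_T x y = \<bar>(x - y) - of_int (round (x - y))\<bar>"

definition coupling :: "(real \<times> real) measure \<Rightarrow> (real \<Rightarrow> real) \<Rightarrow> (real \<Rightarrow> real) \<Rightarrow> bool" where
  "coupling \<gamma> \<mu> \<nu> \<longleftrightarrow> sets \<gamma> = sets (Tspace \<Otimes>\<^sub>M Tspace) \<and> prob_space \<gamma>
     \<and> distr \<gamma> Tspace fst = Tmeas \<mu> \<and> distr \<gamma> Tspace snd = Tmeas \<nu>"

definition d2 :: "(real \<Rightarrow> real) \<Rightarrow> (real \<Rightarrow> real) \<Rightarrow> real" where
  "d2 \<mu> \<nu> = sqrt (enn2real (INF \<gamma> \<in> {\<gamma>. coupling \<gamma> \<mu> \<nu>}.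
                 \<integral>\<^sup>+ z. ennreal ((dist_T (fst z) (snd z))\<^sup>2) \<partial>\<gamma>))"

definition Eeps :: "(real \<Rightarrow> real) \<Rightarrow> real \<Rightarrow> (real \<Rightarrow> real) \<Rightarrow> ennreal" where
  "Eeps W \<epsilon> \<nu> = (if H1 \<nu> then
      (\<integral>\<^sup>+ x\<in>{0..1}. ennreal (\<epsilon>\<^sup>2 / 2 * (wd \<nu> x)\<^sup>2 + W (\<nu> x)) \<partial>lborel) else \<top>)"

definition convex_env :: "(real \<Rightarrow> real) \<Rightarrow> real \<Rightarrow> real" where
  "convex_env W y = Sup {f y | f. convex_on {0..} f \<and> (\<forall>z\<ge>0. f z \<le> W z)}"

definition Qss :: "(real \<Rightarrow> real) \<Rightarrow> real \<Rightarrow> real" where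
  "Qss W z = z * deriv (convex_env W) z - convex_env W z"

text \<open>Metric slope |grad E**|(mu).  Reading: mu |(W**'(mu))_x|^2 = |(Q**'(mu))_x|^2 / mu
  on {mu > 0} (chain rule), and 0 on {mu = 0}.\<close>
definition slope_Ess :: "(real \<Rightarrow> real) \<Rightarrow> (real \<Rightarrow> real) \<Rightarrow> ennreal" where
  "slope_Ess W \<mu> = (if W11 (\<lambda>x. Qss W (\<mu> x)) then
      (let I = \<integral>\<^sup>+ x\<in>{0..1}. ennreal (if \<mu> x > 0 then (wd (\<lambda>y. Qss W (\<mu> y)) x)\<^sup>2 / \<mu> x else 0) \<partial>lborel
       in if I = \<top> then \<top> else ennreal (sqrt (enn2real I)))
     else \<top>)"

definition Tset :: "(real \<Rightarrow> real) \<Rightarrow> (real \<Rightarrow> real) \<Rightarrow> real \<Rightarrow> (real \<Rightarrow> real) \<Rightarrow> (real \<Rightarrow> real) set" where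
  "Tset W W' \<epsilon> \<mu> = {g. g \<in> borel_measurable borel \<and> set_integrable lborel {0..1} (\<lambda>x. (g x)\<^sup>2) \<and>
      (\<forall>\<phi>. test_fun \<phi> \<longrightarrow>
         - (LINT x:{0..1}|lborel. (\<mu> x * W' (\<mu> x) - W (\<mu> x) + 3 * \<epsilon>\<^sup>2 / 2 * (wd \<mu> x)\<^sup>2) * deriv \<phi> x)
         - \<epsilon>\<^sup>2 * (LINT x:{0..1}|lborel. \<mu> x * wd \<mu> x * deriv (deriv \<phi>) x)
         = (LINT x:{0..1}|lborel. sqrt (\<mu> x) * g x * \<phi> x))}"

definition Gcal :: "(real \<Rightarrow> real) \<Rightarrow> (real \<Rightarrow> real) \<Rightarrow> real \<Rightarrow> (real \<Rightarrow> real) \<Rightarrow> ennreal" where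
  "Gcal W W' \<epsilon> \<mu> = (if H1 \<mu> \<and> Tset W W' \<epsilon> \<mu> \<noteq> {} then
      (INF g \<in> Tset W W' \<epsilon> \<mu>. ennreal (sqrt (LINT x:{0..1}|lborel. (g x)\<^sup>2)))
     else \<top>)"

end

theory Submission
  imports Defs "HOL-Complex_Analysis.Great_Picard"
begin

text \<open>
  A bound on the slope bounds the momentum flux \<open>G = G\<^sup>\<epsilon>(\<rho>)\<close> in a Hoelder space and, at a
  maximum of \<open>\<rho>\<close>, bounds \<open>\<rho>\<close> itself. At scale \<open>\<epsilon>\<close> the density follows the motion of a particle with
  energy \<open>\<epsilon>\<^sup>2 \<rho>'\<^sup>2 / 2 = W(\<rho>) - \<mu> \<rho> + G\<close>, where \<open>\<mu>\<close> and \<open>G\<close> are almost constant. A bounded motion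
  sweeps an interval between two zeros of the right-hand side, that is, a chord of \<open>W\<close> lying below \<open>W\<close>.
  Along such a chord \<open>Q(z) = z W**'(z) - W**(z)\<close> is constant, and its value is either \<open>G\<close> or one of
  the countably many values taken on the open set \<open>W > W**\<close>, where \<open>W**\<close> is locally affine. Hence the functions
  \<open>Q(\<rho>)\<close> are asymptotically equicontinuous: otherwise they would take every value of some interval near a
  point. They converge uniformly to a continuous \<open>F\<close>, which equals \<open>Q(\<rho>0)\<close> by monotonicity of \<open>Q\<close>, and which
  is constant wherever it differs from the limit of \<open>G\<close>. So the variation of \<open>F\<close> is controlled by that of
  \<open>G\<close>, which yields \<open>\<bar>\<integral> F \<phi>'\<bar> \<le> L (\<integral> \<rho>0 \<phi>\<^sup>2)\<^sup>1\<^sup>/\<^sup>2\<close>. The Riesz representation in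
  \<open>L\<^sup>2(\<rho>0)\<close> turns this into the claimed bound for the slope at \<open>\<rho>0\<close>.
\<close>

subsection \<open>Test functions on the torus\<close>

text \<open>The number \<open>- Q z\<close> is the intercept of the tangent to \<open>W**\<close> at
  \<open>z\<close>. This is why the flux \<open>G\<close>, the negative intercept of the chord
  followed by the density, appears as a value of \<open>Q\<close>. Two obstacles shape the local
  analysis: \<open>\<rho>\<close> may vanish, and the equations for \<open>\<rho>''\<close> and
  \<open>\<mu>\<close> divide by it, while \<open>G\<close> is only Hoelder continuous with exponent
  1/2. Windows of length \<open>\<epsilon>\<close> to the power 1/2 are therefore cut where
  \<open>\<rho>\<close> falls to \<open>\<delta>\<close>, which is \<open>\<epsilon>\<close> to the
  power 1/8. On such a window \<open>G\<close> varies by a multiple of \<open>\<delta>\<close>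
  squared, so division by \<open>\<delta>\<close> still leaves an error tending to 0. A chord that
  ends at the cut-off has lower end 0 in the limit, and the limit of \<open>G\<close> must then be
  shown to vanish. The densities may oscillate at scale \<open>\<epsilon>\<close> and need not
  converge pointwise; only \<open>Q(\<rho>)\<close> is compact. Since \<open>Q\<close> is not
  injective, \<open>Q(\<rho>0)\<close> is identified by comparing \<open>\<rho>\<close> with
  rational levels, and such comparisons survive weak convergence. The limit \<open>F\<close> has no
  derivative to start from. Its increments are estimated on a partition and summed by parts, and the
  weight \<open>\<rho>\<close> enters through the Cauchy-Schwarz inequality.\<close>

inductive_set trig_poly :: "(real \<Rightarrow> real) set" where
  const: "(\<lambda>x. c) \<in> trig_poly"
| cos: "(\<lambda>x. cos (2 * pi * x)) \<in> trig_poly"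
| sin: "(\<lambda>x. sin (2 * pi * x)) \<in> trig_poly"
| add: "f \<in> trig_poly \<Longrightarrow> g \<in> trig_poly \<Longrightarrow> (\<lambda>x. f x + g x) \<in> trig_poly"
| mult: "f \<in> trig_poly \<Longrightarrow> g \<in> trig_poly \<Longrightarrow> (\<lambda>x. f x * g x) \<in> trig_poly"

lemma trig_poly_periodic: "f \<in> trig_poly \<Longrightarrow> periodic1 f"
  by (induction rule: trig_poly.induct)
    (auto simp: periodic1_def distrib_left sin.plus_of_nat[of _ 1, simplified] cos.plus_of_nat[of _ 1, simplified])

text \<open>Closure under differentiation is what this class is for: by induction all iterated
  derivatives exist, so every member is a test function.\<close>

lemma trig_poly_deriv:
  "f \<in> trig_poly \<Longrightarrow> \<exists>f' \<in> trig_poly. \<forall>x. (f has_real_derivative f' x) (at x)"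
proof (induction rule: trig_poly.induct)
  case (const c)
  show ?case by (intro bexI[of _ "\<lambda>x. 0"] trig_poly.const) auto
next
  case cos
  show ?case
    by (intro bexI[of _ "\<lambda>x. (- (2 * pi)) * sin (2 * pi * x)"] trig_poly.intros)
      (auto intro!: derivative_eq_intros)
next
  case sin
  show ?case
    by (intro bexI[of _ "\<lambda>x. (2 * pi) * cos (2 * pi * x)"] trig_poly.intros)
      (auto intro!: derivative_eq_intros)
next
  case (add f g)
  then obtain f' g' where "f' \<in> trig_poly" "g' \<in> trig_poly"
    "\<forall>x. (f has_real_derivative f' x) (at x)" "\<forall>x. (g has_real_derivative g' x) (at x)" by blast
  then show ?case
    by (intro bexI[of _ "\<lambda>x. f' x + g' x"] trig_poly.add) (auto intro!: derivative_eq_intros)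
next
  case (mult f g)
  then obtain f' g' where "f' \<in> trig_poly" "g' \<in> trig_poly"
    "\<forall>x. (f has_real_derivative f' x) (at x)" "\<forall>x. (g has_real_derivative g' x) (at x)" by blast
  with mult show ?case
    by (intro bexI[of _ "\<lambda>x. f' x * g x + f x * g' x"] trig_poly.add trig_poly.mult)
      (auto intro!: derivative_eq_intros)
qed

lemma deriv_eqI: "(\<And>x. (f has_real_derivative f' x) (at x)) \<Longrightarrow> deriv f = f'"
  by (rule ext) (simp add: DERIV_imp_deriv)

lemma trig_poly_test_fun:
  assumes "f \<in> trig_poly" shows "test_fun f"
proof -
  have "(deriv ^^ k) f \<in> trig_poly" for k
  proof (induction k)
    case (Suc k)
    then show ?case using trig_poly_deriv[OF Suc] deriv_eqI by fastforce
  qed (use assms in auto)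
  then show ?thesis
    unfolding test_fun_def using trig_poly_deriv trig_poly_periodic[OF assms]
    by (meson real_differentiable_def)
qed

lemma test_fun_const: "test_fun (\<lambda>x. c)"
  by (intro trig_poly_test_fun trig_poly.const)

lemma test_fun_differentiable: "test_fun f \<Longrightarrow> (f has_real_derivative deriv f x) (at x)"
  unfolding test_fun_def by (metis DERIV_deriv_iff_real_differentiable funpow_0)

lemma test_fun_continuous: "test_fun f \<Longrightarrow> continuous_on S f"
  by (meson DERIV_continuous continuous_at_imp_continuous_on test_fun_differentiable)

lemma test_fun_periodic: "test_fun f \<Longrightarrow> periodic1 f"
  by (simp add: test_fun_def)

lemma test_fun_deriv: assumes "test_fun f" shows "test_fun (deriv f)"
proof -
  have "((\<lambda>y. f (y + 1)) has_real_derivative deriv f (x + 1)) (at x)" for x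
    using DERIV_shift test_fun_differentiable[OF assms] by blast
  then have "periodic1 (deriv f)"
    using assms unfolding periodic1_def test_fun_def by (metis (no_types, lifting) DERIV_imp_deriv ext)
  moreover have "(deriv ^^ k) (deriv f) = (deriv ^^ Suc k) f" for k
    by (simp add: funpow_swap1)
  ultimately show ?thesis using assms unfolding test_fun_def by metis
qed

text \<open>Lets the periodic primitive of a mean-free test function serve as a test
  function.\<close>

lemma test_fun_of_deriv:
  assumes "periodic1 f" "\<And>x. (f has_real_derivative f' x) (at x)" "test_fun f'"
  shows "test_fun f"
  unfolding test_fun_def
proof (intro conjI allI)
  fix k x
  show "((deriv ^^ k) f) differentiable (at x)"
  proof (cases k)
    case 0
    then show ?thesis using assms(2) by (auto simp: real_differentiable_def)
  next
    case (Suc j)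
    then have "(deriv ^^ k) f = (deriv ^^ j) f'"
      using deriv_eqI[OF assms(2)] by (simp add: funpow_swap1)
    then show ?thesis using assms(3) by (simp add: test_fun_def)
  qed
qed (use assms in auto)

lemma test_fun_lincomb:
  assumes "test_fun f" "test_fun g" shows "test_fun (\<lambda>x. c * f x + d * g x)"
  unfolding test_fun_def
proof (intro conjI allI)
  show "periodic1 (\<lambda>x. c * f x + d * g x)"
    using assms by (auto simp: test_fun_def periodic1_def)
  fix k x
  have "(deriv ^^ k) (\<lambda>x. c * f x + d * g x) = (\<lambda>x. c * (deriv ^^ k) f x + d * (deriv ^^ k) g x)"
  proof (induction k)
    case (Suc k)
    have "((deriv ^^ k) f has_real_derivative (deriv ^^ Suc k) f x) (at x)"
      "((deriv ^^ k) g has_real_derivative (deriv ^^ Suc k) g x) (at x)" for x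
      using assms unfolding test_fun_def by (auto simp: DERIV_deriv_iff_real_differentiable)
    then show ?case
      by (subst funpow.simps, subst o_apply, subst Suc) (rule deriv_eqI, auto intro!: derivative_eq_intros)
  qed auto
  then show "((deriv ^^ k) (\<lambda>x. c * f x + d * g x)) differentiable (at x)"
    using assms unfolding test_fun_def by (auto intro!: differentiable_add differentiable_mult)
qed

lemma periodic1_int: assumes "periodic1 f" shows "f (x + of_int k) = f x"
proof -
  have nat: "f (x + of_nat n) = f x" for n x
  proof (induction n)
    case (Suc n)
    have "f (x + of_nat (Suc n)) = f ((x + of_nat n) + 1)" by (simp add: algebra_simps)
    then show ?case using assms Suc by (simp only: periodic1_def)
  qed auto
  show ?thesis
  proof (cases "k \<ge> 0")
    case True
    then show ?thesis using nat[of x "nat k"] by simp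
  next
    case False
    then show ?thesis using nat[of "x + of_int k" "nat (-k)"] by simp
  qed
qed

lemma periodic1_frac: "periodic1 f \<Longrightarrow> f (frac x) = f x"
  using periodic1_int[of f x "- \<lfloor>x\<rfloor>"] by (simp add: frac_def)

text \<open>Wrapped around the unit circle, \<open>f\<close> becomes a continuous function on a
  compact set. By Stone-Weierstrass it is approximated there by real polynomials, and these pull
  back to trigonometric polynomials.\<close>

lemma periodic_approx_test_fun:
  assumes f: "continuous_on UNIV f" "periodic1 f" and "0 < e"
  obtains \<phi> where "test_fun \<phi>" "\<And>x. \<bar>f x - \<phi> x\<bar> < e"
proof -
  define F where "F z = f (Arg2pi z / (2 * pi))" for z
  have F_cis: "F (cis (2 * pi * x)) = f x" for x
  proof -
    have "Arg2pi (cis (2 * pi * frac x)) = 2 * pi * frac x"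
      using frac_lt_1[of x] by (intro Arg2pi_unique[of 1]) (auto simp: cis_conv_exp)
    moreover have "cis (2 * pi * frac x) = cis (2 * pi * x)"
    proof -
      have "2 * pi * x = 2 * pi * frac x + of_int \<lfloor>x\<rfloor> * (2 * pi)"
        by (simp add: frac_def algebra_simps)
      then have "cis (2 * pi * x) = cis (2 * pi * frac x) * cis (of_int \<lfloor>x\<rfloor> * (2 * pi))"
        by (metis cis_mult)
      moreover have "cis (of_int \<lfloor>x\<rfloor> * (2 * pi)) = 1"
        by (metis Ints_of_int cis_multiple_2pi mult.commute)
      ultimately show ?thesis by simp
    qed
    ultimately show ?thesis using periodic1_frac[OF f(2)] by (simp add: F_def)
  qed
  have F_Arg: "F z = f (Arg z / (2 * pi))" if "cmod z = 1" for z
  proof -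
    have "z = cis (2 * pi * (Arg z / (2 * pi)))"
      using cis_Arg[of z] that by (cases "z = 0") (auto simp: sgn_div_norm)
    then show ?thesis using F_cis by metis
  qed
  have "continuous_on (sphere 0 1) F"
    unfolding continuous_on_eq_continuous_within
  proof
    fix z :: complex assume z: "z \<in> sphere 0 1"
    have fc: "isCont f y" for y using f(1) by (simp add: continuous_on_eq_continuous_at)
    \<comment> \<open>\<open>Arg2pi\<close> jumps across the nonnegative real axis and
      \<open>Arg\<close> across the nonpositive one. By periodicity of \<open>f\<close> both
      describe \<open>F\<close> on the circle, so each point is treated with a branch that is
      continuous there.\<close>
    show "continuous (at z within sphere 0 1) F"
    proof (cases "z \<in> \<real>\<^sub>\<ge>\<^sub>0")
      case True
      then have "z \<notin> \<real>\<^sub>\<le>\<^sub>0" using z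
        by (auto simp: complex_nonneg_Reals_iff complex_nonpos_Reals_iff cmod_def)
      then have "isCont (\<lambda>z. f (Arg z / (2 * pi))) z"
        by (intro isCont_o2[OF _ fc] continuous_intros continuous_at_Arg) auto
      then have "continuous (at z within sphere 0 1) (\<lambda>z. f (Arg z / (2 * pi)))"
        using continuous_at_imp_continuous_at_within by blast
      then show ?thesis
        by (rule continuous_transform_within[OF _ zero_less_one z]) (simp add: F_Arg)
    next
      case False
      then have "isCont (\<lambda>z. f (Arg2pi z / (2 * pi))) z"
        by (intro isCont_o2[OF _ fc] continuous_intros continuous_at_Arg2pi) auto
      then show ?thesis unfolding F_def[abs_def]
        using continuous_at_imp_continuous_at_within by blast
    qed
  qed
  then obtain p where p: "real_polynomial_function p" "\<And>z. z \<in> sphere 0 1 \<Longrightarrow> \<bar>F z - p z\<bar> < e"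
    using Stone_Weierstrass_real_polynomial_function[OF _ _ \<open>0 < e\<close>, of "sphere (0::complex) 1" F] by auto
  have "(\<lambda>x. p (cis (2 * pi * x))) \<in> trig_poly"
    using p(1)
  proof (induction rule: real_polynomial_function.induct)
    case (linear h)
    interpret h: bounded_linear h by fact
    have "h (cis (2 * pi * x)) = h 1 * cos (2 * pi * x) + h \<i> * sin (2 * pi * x)" for x
    proof -
      have "cis (2 * pi * x) = cos (2 * pi * x) *\<^sub>R 1 + sin (2 * pi * x) *\<^sub>R \<i>"
        by (simp add: complex_eq_iff)
      then show ?thesis by (simp only: h.add h.scaleR) simp
    qed
    then show ?case by (simp only:) (intro trig_poly.intros)
  qed (auto intro: trig_poly.intros)
  then show ?thesis
    using p(2)[of "cis (2 * pi * x)" for x]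
    by (intro that[OF trig_poly_test_fun]) (auto simp: F_cis)
qed

subsection \<open>Weak derivatives\<close>

lemma set_integrable_bdd_mult:
  fixes f g :: "real \<Rightarrow> real"
  assumes "set_integrable lborel S f" "S \<in> sets borel" "set_borel_measurable lborel S g" "\<And>x. x \<in> S \<Longrightarrow> \<bar>g x\<bar> \<le> B"
  shows "set_integrable lborel S (\<lambda>x. f x * g x)"
proof -
  have "integrable lborel (\<lambda>x. (indicator S x *\<^sub>R f x) * (indicator S x *\<^sub>R g x))"
  proof (rule Bochner_Integration.integrable_bound)
    show "integrable lborel (\<lambda>x. B * (indicator S x *\<^sub>R f x))"
      using assms(1) by (simp add: set_integrable_def)
    show "(\<lambda>x. (indicator S x *\<^sub>R f x) * (indicator S x *\<^sub>R g x)) \<in> borel_measurable lborel"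
      using assms(1,3) unfolding set_integrable_def set_borel_measurable_def by measurable
    show "AE x in lborel. norm (indicator S x *\<^sub>R f x * indicator S x *\<^sub>R g x) \<le> norm (B * indicator S x *\<^sub>R f x)"
    proof (rule AE_I2)
      fix x
      have "x \<in> S \<Longrightarrow> \<bar>f x\<bar> * \<bar>g x\<bar> \<le> \<bar>f x\<bar> * \<bar>B\<bar>"
        using assms(4)[of x] by (intro mult_left_mono) auto
      then show "norm (indicator S x *\<^sub>R f x * indicator S x *\<^sub>R g x) \<le> norm (B * indicator S x *\<^sub>R f x)"
        by (auto simp: indicator_def abs_mult mult.commute)
    qed
  qed
  then show ?thesis
    unfolding set_integrable_def by (rule back_subst[of "integrable lborel"]) (auto simp: indicator_def)
qed

lemma set_integrable_cont_mult:
  fixes f g :: "real \<Rightarrow> real"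
  assumes "set_integrable lborel {a..b} f" "continuous_on {a..b} g"
  shows "set_integrable lborel {a..b} (\<lambda>x. f x * g x)"
proof -
  have "bounded (g ` {a..b})"
    using assms(2) compact_continuous_image compact_imp_bounded by blast
  then obtain B where "\<forall>y \<in> g ` {a..b}. norm y \<le> B" unfolding bounded_iff by blast
  then have B: "\<And>x. x \<in> {a..b} \<Longrightarrow> \<bar>g x\<bar> \<le> B" by auto
  have "set_borel_measurable lborel {a..b} g"
    using borel_measurable_continuous_on_indicator[OF _ assms(2)]
    by (auto simp: set_borel_measurable_def)
  then show ?thesis
    using assms(1) B by (intro set_integrable_bdd_mult) auto
qed

lemma set_integrable_continuous:
  fixes f :: "real \<Rightarrow> real" shows "continuous_on {a..b} f \<Longrightarrow> set_integrable lborel {a..b} f"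
  by (rule borel_integrable_atLeastAtMost')

lemma LINT_abs_bound:
  fixes f :: "real \<Rightarrow> real"
  assumes "set_integrable M S f" "set_integrable M S g" "\<And>x. x \<in> S \<Longrightarrow> \<bar>f x\<bar> \<le> g x"
  shows "\<bar>LINT x:S|M. f x\<bar> \<le> (LINT x:S|M. g x)"
proof -
  have "\<bar>LINT x:S|M. f x\<bar> \<le> (LINT x:S|M. \<bar>f x\<bar>)"
    using assms(1) set_integral_norm_bound by fastforce
  also have "\<dots> \<le> (LINT x:S|M. g x)"
    using assms set_integrable_abs by (intro set_integral_mono) auto
  finally show ?thesis .
qed

text \<open>Test functions are uniformly dense in the continuous periodic functions, and a uniform
  error is harmless against an integrable \<open>k\<close>.\<close>

lemma orthogonal_continuous:
  assumes k: "set_integrable lborel {0..1} k"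
    and orth: "\<And>\<phi>. test_fun \<phi> \<Longrightarrow> (LINT x:{0..1}|lborel. k x * \<phi> x) = 0"
    and f: "continuous_on UNIV f" "periodic1 f"
  shows "(LINT x:{0..1}|lborel. k x * f x) = 0"
proof -
  let ?N = "LINT x:{0..1}|lborel. \<bar>k x\<bar>"
  have "\<bar>LINT x:{0..1}|lborel. k x * f x\<bar> \<le> e * ?N" if e: "e > 0" for e
  proof -
    obtain \<phi> where \<phi>: "test_fun \<phi>" "\<And>x. \<bar>f x - \<phi> x\<bar> < e"
      using periodic_approx_test_fun[OF f e] by blast
    have i: "set_integrable lborel {0..1} (\<lambda>x. k x * f x)" "set_integrable lborel {0..1} (\<lambda>x. k x * \<phi> x)"
      using k continuous_on_subset[OF f(1)] test_fun_continuous[OF \<phi>(1)]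
      by (auto intro!: set_integrable_cont_mult)
    have "(LINT x:{0..1}|lborel. k x * f x) = (LINT x:{0..1}|lborel. k x * f x - k x * \<phi> x)"
      using orth[OF \<phi>(1)] i by (subst set_integral_diff) auto
    also have "\<bar>\<dots>\<bar> \<le> (LINT x:{0..1}|lborel. e * \<bar>k x\<bar>)"
    proof (rule LINT_abs_bound)
      show "set_integrable lborel {0..1} (\<lambda>x. k x * f x - k x * \<phi> x)"
        using i by (rule set_integral_diff)
      show "set_integrable lborel {0..1} (\<lambda>x. e * \<bar>k x\<bar>)"
        using k by (intro set_integrable_mult_right set_integrable_abs)
      fix x
      have "\<bar>k x\<bar> * \<bar>f x - \<phi> x\<bar> \<le> \<bar>k x\<bar> * e"
        using \<phi>(2)[of x] by (intro mult_left_mono) auto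
      then show "\<bar>k x * f x - k x * \<phi> x\<bar> \<le> e * \<bar>k x\<bar>"
        by (simp only: right_diff_distrib[symmetric] abs_mult) (simp add: mult.commute)
    qed
    finally show ?thesis by simp
  qed
  note bound = this
  have N: "?N \<ge> 0" by (simp add: set_lebesgue_integral_def integral_nonneg_AE)
  have "\<bar>LINT x:{0..1}|lborel. k x * f x\<bar> \<le> 0 + d" if d: "d > 0" for d
  proof -
    have "\<bar>LINT x:{0..1}|lborel. k x * f x\<bar> \<le> d / (?N + 1) * ?N" using d N by (intro bound) auto
    also have "\<dots> \<le> d" using d N by (simp add: field_simps)
    finally show ?thesis by simp
  qed
  then show ?thesis by (metis abs_le_zero_iff field_le_epsilon)
qed

text \<open>Indicators of compact sets are limits of tents around them. The tents are built from the
  distance to all integer translates of \<open>C\<close>, which makes them periodic; being bounded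
  by 1, they allow dominated convergence.\<close>

lemma integral_compact_limit:
  assumes k: "set_integrable lborel {0..1} k" and C: "compact C" "C \<subseteq> {0..1}"
  obtains f :: "nat \<Rightarrow> real \<Rightarrow> real" where "\<And>n. continuous_on UNIV (f n)" "\<And>n. periodic1 (f n)"
    "\<And>n x. 0 \<le> f n x" "(\<lambda>n. LINT x:{0..1}|lborel. k x * f n x) \<longlonglongrightarrow> (LINT x:C|lborel. k x)"
proof (cases "C = {}")
  case True
  then show ?thesis
    by (intro that[of "\<lambda>_ _. 0"]) (auto simp: periodic1_def set_lebesgue_integral_def)
next
  case False
  then obtain c where c: "c \<in> C" by blast
  define S :: "real set" where "S = (\<Union>x\<in>\<int>. \<Union>y\<in>C. {x + y})"
  have S_iff: "x \<in> S \<longleftrightarrow> (\<exists>i::int. \<exists>y\<in>C. x = of_int i + y)" for x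
    unfolding S_def by (auto elim!: Ints_cases)
  have "closed S" unfolding S_def
    by (intro closed_compact_sums closed_Ints C)
  have "c \<in> S" using c unfolding S_iff by (intro exI[of _ 0] bexI[of _ c]) auto
  have S_per: "x + 1 \<in> S \<longleftrightarrow> x \<in> S" for x
  proof
    assume "x + 1 \<in> S"
    then obtain i::int and y where "y\<in>C" "x + 1 = of_int i + y" unfolding S_iff by blast
    then show "x \<in> S" unfolding S_iff by (intro exI[of _ "i-1"] bexI[of _ y]) auto
  next
    assume "x \<in> S"
    then obtain i::int and y where "y\<in>C" "x = of_int i + y" unfolding S_iff by blast
    then show "x + 1 \<in> S" unfolding S_iff by (intro exI[of _ "i+1"] bexI[of _ y]) auto
  qed
  have S_img: "(\<lambda>y. y + 1) ` S = S"
  proof (intro equalityI subsetI)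
    fix x assume "x \<in> S"
    then have "x - 1 \<in> S" using S_per[of "x - 1"] by simp
    then show "x \<in> (\<lambda>y. y + 1) ` S" by (intro image_eqI[of _ _ "x - 1"]) auto
  qed (use S_per in auto)
  have inf_per: "infdist (x + 1) S = infdist x S" for x
  proof -
    have "infdist (x + 1) S = infdist (x + 1) ((\<lambda>y. y + 1) ` S)" by (simp add: S_img)
    also have "\<dots> = infdist x S"
      using \<open>c \<in> S\<close> by (auto simp: infdist_def image_image dist_real_def)
    finally show ?thesis .
  qed
  define f where "f n x = max 0 (1 - real n * infdist x S)" for n x
  have f_cont: "continuous_on UNIV (f n)" for n
    unfolding f_def by (intro continuous_intros)
  have f_per: "periodic1 (f n)" for n by (simp add: periodic1_def f_def inf_per)
  have f_bd: "\<bar>f n x\<bar> \<le> 1" "0 \<le> f n x" for n x by (auto simp: f_def infdist_nonneg)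
  have f_lim: "(\<lambda>n. f n x) \<longlonglongrightarrow> indicator S x" for x
  proof (cases "x \<in> S")
    case False
    then have pos: "infdist x S > 0"
      using \<open>closed S\<close> \<open>c \<in> S\<close> by (metis in_closed_iff_infdist_zero infdist_nonneg less_eq_real_def empty_iff)
    then obtain N where N: "1 < real N * infdist x S" using ex_less_of_nat_mult by blast
    have "f n x = 0" if "n \<ge> N" for n
    proof -
      have "real N * infdist x S \<le> real n * infdist x S" using that pos by simp
      then show ?thesis using N by (simp add: f_def)
    qed
    then have "\<forall>\<^sub>F n in sequentially. f n x = indicator S x"
      using False by (auto simp: eventually_sequentially)
    then show ?thesis by (rule tendsto_eventually)
  qed (simp add: f_def)
  have km: "(\<lambda>x. indicator {0..1} x *\<^sub>R k x) \<in> borel_measurable lborel"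
    using k by (simp add: set_integrable_def)
  have Sm: "S \<in> sets borel" using \<open>closed S\<close> by simp
  have m1: "(\<lambda>x. indicator {0..1} x *\<^sub>R (k x * indicator S x)) \<in> borel_measurable lborel"
  proof -
    have "(\<lambda>x. (indicator {0..1} x *\<^sub>R k x) * indicator S x) \<in> borel_measurable lborel"
      using km Sm by measurable
    then show ?thesis by (simp add: mult_ac)
  qed
  have lim: "(\<lambda>n. LINT x:{0..1}|lborel. k x * f n x) \<longlonglongrightarrow> (LINT x:{0..1}|lborel. k x * indicator S x)"
    unfolding set_lebesgue_integral_def
  proof (rule integral_dominated_convergence[OF m1])
    show "integrable lborel (\<lambda>x. \<bar>indicator {0..1} x *\<^sub>R k x\<bar>)"
      using k unfolding set_integrable_def by (rule integrable_abs)
    have "(\<lambda>x. (indicator {0..1} x *\<^sub>R k x) * f n x) \<in> borel_measurable lborel" for n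
      using km borel_measurable_continuous_onI[OF f_cont[of n]] by measurable
    then show "(\<lambda>x. indicator {0..1} x *\<^sub>R (k x * f n x)) \<in> borel_measurable lborel" for n
      by (simp add: mult_ac)
    show "AE x in lborel. (\<lambda>n. indicator {0..1} x *\<^sub>R (k x * f n x))
        \<longlonglongrightarrow> indicator {0..1} x *\<^sub>R (k x * indicator S x)"
      by (intro AE_I2 tendsto_intros f_lim)
    show "AE x in lborel. norm (indicator {0..1} x *\<^sub>R (k x * f n x)) \<le> \<bar>indicator {0..1} x *\<^sub>R k x\<bar>" for n
      using f_bd(1)[of n] by (intro AE_I2) (auto simp: abs_mult indicator_def mult_left_le)
  qed
  \<comment> \<open>The periodised set can differ from \<open>C\<close> inside the unit interval
    only at the endpoints: if one of them lies in \<open>C\<close>, the other lies in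
    \<open>S\<close>. This is a null set.\<close>
  have eq: "indicator {0..1} x * (k x * indicator S x) = indicator C x * k x" if "x \<noteq> 0" "x \<noteq> 1" for x
  proof (cases "0 < x \<and> x < 1")
    case True
    have "x \<in> S \<longleftrightarrow> x \<in> C"
    proof
      assume "x \<in> S"
      then obtain i::int and y where iy: "y \<in> C" "x = of_int i + y" unfolding S_iff by blast
      then have y: "0 \<le> y" "y \<le> 1" using C by auto
      then have "of_int i < (1::real)" "of_int i > (-1::real)" using True iy by linarith+
      then have "i = 0" by linarith
      then show "x \<in> C" using iy by simp
    next
      assume "x \<in> C"
      then show "x \<in> S" unfolding S_iff by (intro exI[of _ 0] bexI[of _ x]) auto
    qed
    then show ?thesis using True by (auto simp: indicator_def)
  next
    case False
    then have "x \<notin> {0..1}" using that by auto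
    then show ?thesis using C(2) by (auto simp: indicator_def)
  qed
  have m2: "(\<lambda>x. indicator C x *\<^sub>R k x) \<in> borel_measurable lborel"
    using set_integrable_subset[OF k _ C(2)] C(1) by (simp add: set_integrable_def borel_compact)
  have "AE x in lborel. indicator {0..1} x *\<^sub>R (k x * indicator S x) = indicator C x *\<^sub>R k x"
    using AE_lborel_singleton[of "0::real"] AE_lborel_singleton[of "1::real"]
    unfolding real_scaleR_def by eventually_elim (rule eq)
  then have "(LINT x:{0..1}|lborel. k x * indicator S x) = (LINT x:C|lborel. k x)"
    unfolding set_lebesgue_integral_def by (intro integral_cong_AE m1 m2)
  with lim show ?thesis by (intro that[of f] f_cont f_per f_bd(2)) simp
qed

text \<open>If the negative set of \<open>k\<close> had positive measure, it would contain a compact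
  set of positive measure, and tents around that set would give negative integrals.\<close>

lemma fundamental_lemma_nonneg:
  assumes k: "set_integrable lborel {0..1} k"
    and pos: "\<And>f. continuous_on UNIV f \<Longrightarrow> periodic1 f \<Longrightarrow> (\<And>x. 0 \<le> f x) \<Longrightarrow> 0 \<le> (LINT x:{0..1}|lborel. k x * f x)"
  shows "AE x in lborel. x \<in> {0..1} \<longrightarrow> 0 \<le> k x"
proof -
  define K where "K x = indicator {0..1} x *\<^sub>R k x" for x
  have K: "integrable lborel K" using k unfolding set_integrable_def K_def[abs_def] .
  define A where "A = {x. K x < 0}"
  have Am: "A \<in> sets borel" using K unfolding A_def by measurable
  have A01: "A \<subseteq> {0..1}" by (auto simp: A_def K_def indicator_def)
  have null: "emeasure lborel C = 0" if C: "compact C" "C \<subseteq> A" for C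
  proof -
    have C01: "C \<subseteq> {0..1}" using C A01 by auto
    obtain f :: "nat \<Rightarrow> real \<Rightarrow> real" where f: "\<And>n. continuous_on UNIV (f n)" "\<And>n. periodic1 (f n)" "\<And>n x. 0 \<le> f n x"
      "(\<lambda>n. LINT x:{0..1}|lborel. k x * f n x) \<longlonglongrightarrow> (LINT x:C|lborel. k x)"
      by (rule integral_compact_limit[OF k C(1) C01]) (rule that)
    have ge: "0 \<le> (LINT x:C|lborel. k x)"
      by (rule LIMSEQ_le_const[OF f(4)]) (use pos[OF f(1-3)] in auto)
    have Cm: "C \<in> sets lborel" using C(1) by (simp add: borel_compact)
    have ki: "set_integrable lborel C k" by (rule set_integrable_subset[OF k Cm C01])
    have neg: "k x < 0" if "x \<in> C" for x
      using subsetD[OF C(2) that] subsetD[OF C01 that] by (simp add: A_def K_def)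
    define h where "h x = - (indicator C x *\<^sub>R k x)" for x
    have hi: "integrable lborel h" using ki by (simp add: set_integrable_def h_def[abs_def])
    have h0: "0 \<le> h x" for x using neg[of x] by (auto simp: h_def indicator_def less_imp_le)
    have "(LINT x|lborel. h x) \<le> 0" using ge by (simp add: h_def set_lebesgue_integral_def)
    then have "(LINT x|lborel. h x) = 0" using h0 by (simp add: integral_nonneg_AE antisym)
    then have "AE x in lborel. h x = 0" using integral_nonneg_eq_0_iff_AE[OF hi] h0 by simp
    then have "AE x in lborel. x \<notin> C" by eventually_elim (use neg in \<open>force simp: h_def indicator_def\<close>)
    then show ?thesis using Cm AE_iff_measurable[of C lborel "\<lambda>x. x \<notin> C"] by simp
  qed
  \<comment> \<open>Inner regularity is applied to a finite measure, hence the restriction of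
    Lebesgue measure to the unit interval.\<close>
  define M where "M = density lborel (indicator {0..1::real})"
  have Ms: "sets M = sets borel" by (simp add: M_def)
  have Me: "emeasure M B = emeasure lborel (B \<inter> {0..1})" if "B \<in> sets borel" for B
    using that unfolding M_def
    by (subst emeasure_density) (auto simp: nn_integral_indicator[symmetric] indicator_inter_arith[symmetric] mult.commute simp del: nn_integral_indicator intro!: nn_integral_cong split: split_indicator)
  have "emeasure M A = (SUP C\<in>{C. C \<subseteq> A \<and> compact C}. emeasure M C)"
  proof (rule inner_regular[OF Ms _ Am])
    show "emeasure M (space M) \<noteq> \<infinity>"
      using Me[of UNIV] by (simp add: M_def)
  qed
  also have "\<dots> = 0"
  proof -
    have "emeasure M C = 0" if "C \<in> {C. C \<subseteq> A \<and> compact C}" for C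
    proof -
      have "C \<inter> {0..1} = C" using that A01 by auto
      then show ?thesis using Me[of C] null[of C] that by (simp add: borel_compact)
    qed
    then show ?thesis by (intro antisym SUP_least) auto
  qed
  finally have "emeasure lborel A = 0" using Me[OF Am] A01 by (simp add: Int_absorb2)
  then have "AE x in lborel. x \<notin> A" using Am AE_iff_measurable[of A lborel "\<lambda>x. x \<notin> A"] by simp
  then show ?thesis by eventually_elim (auto simp: A_def K_def)
qed

text \<open>Approximation by tents makes the integral of \<open>k\<close> over every
  \<open>{0..a}\<close> vanish. Half-lines form a generator stable under intersection, so the
  integral over every Borel set vanishes.\<close>

lemma fundamental_lemma:
  assumes k: "set_integrable lborel {0..1} k"
    and orth: "\<And>\<phi>. test_fun \<phi> \<Longrightarrow> (LINT x:{0..1}|lborel. k x * \<phi> x) = 0"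
  shows "AE x in lborel. x \<in> {0..1} \<longrightarrow> k x = 0"
proof -
  define K where "K x = indicator {0..1} x *\<^sub>R k x" for x
  have K: "integrable lborel K" using k unfolding set_integrable_def K_def .
  have seg: "(LINT x:{0..a}|lborel. k x) = 0" if "0 \<le> a" "a \<le> 1" for a
  proof -
    have C: "compact {0..a}" "{0..a} \<subseteq> {0..1}" using that by auto
    obtain f :: "nat \<Rightarrow> real \<Rightarrow> real" where f: "\<And>n. continuous_on UNIV (f n)" "\<And>n. periodic1 (f n)"
      "(\<lambda>n. LINT x:{0..1}|lborel. k x * f n x) \<longlonglongrightarrow> (LINT x:{0..a}|lborel. k x)"
      by (rule integral_compact_limit[OF k C]) (rule that)
    then show ?thesis using orthogonal_continuous[OF k orth f(1,2)] by (simp add: LIMSEQ_const_iff)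
  qed
  have K_seg: "(LINT x:{..a}|lborel. K x) = 0" for a
  proof -
    have "(LINT x:{..a}|lborel. K x) = (LINT x:{0..min a 1}|lborel. k x)"
      unfolding set_lebesgue_integral_def K_def
      by (intro Bochner_Integration.integral_cong) (auto simp: indicator_def)
    also have "\<dots> = 0" using seg[of "min a 1"] by (cases "a \<ge> 0") (auto simp: set_lebesgue_integral_def)
    finally show ?thesis .
  qed
  have KUN: "(LINT x:UNIV|lborel. K x) = 0"
    using seg[of 1] by (simp add: set_lebesgue_integral_def K_def)
  have KI: "set_integrable lborel A K" if "A \<in> sets lborel" for A
    using integrable_mult_indicator[OF that K] by (simp add: set_integrable_def)
  have zero: "(LINT x:A|lborel. K x) = 0" if "A \<in> sets lborel" for A
  proof -
    have "Int_stable (range (\<lambda>a::real. {..a}))"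
      by (auto simp: Int_stable_def)
    moreover have "range (\<lambda>a::real. {..a}) \<subseteq> Pow UNIV" by simp
    moreover have "A \<in> sigma_sets UNIV (range (\<lambda>a::real. {..a}))"
      using that by (simp add: borel_eq_atMost)
    ultimately show ?thesis
    proof (induct rule: sigma_sets_induct_disjoint)
      case (basic A)
      then show ?case using K_seg by auto
    next
      case empty
      show ?case by (simp add: set_lebesgue_integral_def)
    next
      case (compl A)
      then have A: "A \<in> sets lborel" by (simp add: borel_eq_atMost)
      have "(LINT x:A \<union> (UNIV - A)|lborel. K x) = (LINT x:A|lborel. K x) + (LINT x:UNIV - A|lborel. K x)"
        using A by (intro set_integral_Un KI) auto
      then show ?case using compl KUN by simp
    next
      case (union A)
      then have A: "\<And>i. A i \<in> sets lborel" by (auto simp: borel_eq_atMost)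
      have "(LINT x:(\<Union>i. A i)|lborel. K x) = (\<Sum>i. (LINT x:A i|lborel. K x))"
        using union A by (intro lebesgue_integral_countable_add KI) (auto simp: disjoint_family_on_def)
      then show ?case using union by simp
    qed
  qed
  have "AE x in lborel. K x = 0"
    using K zero by (intro density_unique_real) auto
  then show ?thesis by eventually_elim (auto simp: K_def indicator_def)
qed

section \<open>Uniqueness of weak derivatives and the choice made by \<open>wd\<close>\<close>

lemma weak_deriv_unique:
  assumes "weak_deriv f g" "weak_deriv f h"
  shows "AE x in lborel. x \<in> {0..1} \<longrightarrow> g x = h x"
proof -
  have i: "set_integrable lborel {0..1} g" "set_integrable lborel {0..1} h"
    using assms by (auto simp: weak_deriv_def)
  have "AE x in lborel. x \<in> {0..1} \<longrightarrow> g x - h x = 0"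
  proof (rule fundamental_lemma)
    show "set_integrable lborel {0..1} (\<lambda>x. g x - h x)" using i by (rule set_integral_diff)
    fix \<phi> assume \<phi>: "test_fun \<phi>"
    then have "(LINT x:{0..1}|lborel. g x * \<phi> x) = (LINT x:{0..1}|lborel. h x * \<phi> x)"
      using assms unfolding weak_deriv_def by (auto dest!: spec[of _ \<phi>])
    then show "(LINT x:{0..1}|lborel. (g x - h x) * \<phi> x) = 0"
      using i test_fun_continuous[OF \<phi>]
      by (simp add: left_diff_distrib set_integrable_cont_mult set_integral_diff)
  qed
  then show ?thesis by eventually_elim auto
qed

lemma weak_deriv_wd: "weak_deriv f g \<Longrightarrow> weak_deriv f (wd f)"
  unfolding wd_def by (rule someI[of "weak_deriv f"])

text \<open>\<open>wd\<close> selects an arbitrary weak derivative; any explicitly known one may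
  replace it under integrals over the unit interval.\<close>

lemma wd_AE: "weak_deriv f g \<Longrightarrow> AE x in lborel. x \<in> {0..1} \<longrightarrow> wd f x = g x"
  using weak_deriv_unique weak_deriv_wd by blast

lemma fundamental_lemma_continuous:
  assumes f: "continuous_on UNIV f" "periodic1 f"
    and orth: "\<And>\<phi>. test_fun \<phi> \<Longrightarrow> (LINT x:{0..1}|lborel. f x * \<phi> x) = 0"
  shows "f x = 0"
proof -
  have fc: "continuous_on {0..1} f" using f(1) continuous_on_subset by blast
  have "(LINT x:{0..1}|lborel. f x * f x) = 0"
    using orthogonal_continuous[OF set_integrable_continuous[OF fc] orth f] .
  moreover have "set_integrable lborel {0..1} (\<lambda>x. f x * f x)"
    by (intro set_integrable_continuous continuous_intros fc)
  ultimately have "integral {0..1} (\<lambda>x. f x * f x) = 0"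
    by (simp add: set_borel_integral_eq_integral)
  moreover have "(\<lambda>x. f x * f x) integrable_on {0..1}"
    by (intro integrable_continuous_real continuous_intros fc)
  ultimately have "((\<lambda>x. f x * f x) has_integral 0) (cbox 0 1)"
    by (metis box_real(2) integrable_integral)
  then have "f y * f y = 0" if "y \<in> {0..1}" for y
    using that by (intro has_integral_0_cbox_imp_0[of 0 1 "\<lambda>x. f x * f x"])
      (auto intro!: continuous_intros fc)
  moreover have "frac x \<in> {0..1}" using frac_lt_1[of x] by auto
  ultimately have "f (frac x) = 0" by auto
  then show ?thesis by (simp add: periodic1_frac[OF f(2)])
qed

text \<open>Integration by parts over one period: the boundary values of \<open>f * g\<close> at 0
  and 1 cancel.\<close>

lemma integral_product_rule_periodic:
  assumes f: "\<And>x. (f has_real_derivative f' x) (at x)" "continuous_on UNIV f'" "periodic1 f"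
    and g: "\<And>x. (g has_real_derivative g' x) (at x)" "continuous_on UNIV g'" "periodic1 g"
  shows "(LINT x:{0..1}|lborel. f x * g' x) = - (LINT x:{0..1}|lborel. f' x * g x)"
proof -
  have c: "continuous_on {0..1} f" "continuous_on {0..1} g" "continuous_on {0..1} f'" "continuous_on {0..1} g'"
    by (meson DERIV_atLeastAtMost_imp_continuous_on f(1) g(1) continuous_on_subset f(2) g(2) subset_UNIV)+
  have i: "set_integrable lborel {0..1} (\<lambda>x. f x * g' x)" "set_integrable lborel {0..1} (\<lambda>x. f' x * g x)"
    by (intro set_integrable_continuous continuous_intros c)+
  have "((\<lambda>x. f x * g' x + f' x * g x) has_integral f 1 * g 1 - f 0 * g 0) {0..1}"
  proof (rule fundamental_theorem_of_calculus)
    fix x :: real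
    have "((\<lambda>x. f x * g x) has_real_derivative f x * g' x + f' x * g x) (at x)"
      using f(1)[of x] g(1)[of x] by (auto intro!: derivative_eq_intros)
    then show "((\<lambda>x. f x * g x) has_vector_derivative f x * g' x + f' x * g x) (at x within {0..1})"
      by (simp add: has_real_derivative_iff_has_vector_derivative has_vector_derivative_at_within)
  qed auto
  moreover have "f 1 * g 1 - f 0 * g 0 = 0"
    using f(3) g(3) unfolding periodic1_def by (metis add_0 diff_self)
  ultimately have "integral {0..1} (\<lambda>x. f x * g' x + f' x * g x) = 0" by auto
  then have "(LINT x:{0..1}|lborel. f x * g' x + f' x * g x) = 0"
    using set_borel_integral_eq_integral(2)[OF set_integral_add(1)[OF i]] by simp
  then show ?thesis using set_integral_add(2)[OF i] by simp
qed

lemma periodic1_deriv: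
  assumes "periodic1 f" "\<And>x. (f has_real_derivative f' x) (at x)" shows "periodic1 f'"
  unfolding periodic1_def
proof
  fix x
  have "((\<lambda>y. f (y + 1)) has_real_derivative f' (x + 1)) (at x)"
    using DERIV_shift assms(2) by blast
  then have "(f has_real_derivative f' (x + 1)) (at x)"
    using assms(1) by (simp add: periodic1_def)
  then show "f' (x + 1) = f' x" using assms(2) DERIV_unique by blast
qed

lemma weak_deriv_C1:
  assumes "periodic1 f" "\<And>x. (f has_real_derivative f' x) (at x)" "continuous_on UNIV f'"
  shows "weak_deriv f f'"
proof -
  have c: "continuous_on {0..1} f" "continuous_on {0..1} f'"
    by (meson DERIV_atLeastAtMost_imp_continuous_on assms(2) continuous_on_subset assms(3) subset_UNIV)+
  show ?thesis
    unfolding weak_deriv_def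
  proof (intro conjI allI impI set_integrable_continuous c)
    fix \<phi> assume \<phi>: "test_fun \<phi>"
    show "(LINT x:{0..1}|lborel. f x * deriv \<phi> x) = - (LINT x:{0..1}|lborel. f' x * \<phi> x)"
      using assms test_fun_differentiable[OF \<phi>] test_fun_continuous[OF test_fun_deriv[OF \<phi>]] test_fun_periodic[OF \<phi>]
      by (intro integral_product_rule_periodic)
  qed
qed

subsection \<open>The convex envelope\<close>

locale potential =
  fixes W W' :: "real \<Rightarrow> real"
  assumes W_deriv: "\<And>y. 0 \<le> y \<Longrightarrow> (W has_real_derivative W' y) (at y within {0..})"
    and W'_cont: "continuous_on {0..} W'"
    and W_nonneg: "\<And>y. 0 \<le> y \<Longrightarrow> 0 \<le> W y"
    and W0: "W 0 = 0"
begin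

abbreviation "V \<equiv> convex_env W"
abbreviation "Q \<equiv> Qss W"

lemma W_deriv_at: "0 < y \<Longrightarrow> (W has_real_derivative W' y) (at y)"
  using W_deriv[of y] at_within_interior[of y "{0..}"] by (simp add: interior_real_atLeast)

lemma W_cont: "continuous_on {0..} W"
  by (metis DERIV_continuous_on W_deriv atLeast_iff)

lemma env_bdd: "0 \<le> y \<Longrightarrow> bdd_above {f y | f. convex_on {0..} f \<and> (\<forall>z\<ge>0. f z \<le> W z)}"
  by (intro bdd_aboveI[of _ "W y"]) auto

lemma env_ge: "convex_on {0..} f \<Longrightarrow> (\<And>z. 0 \<le> z \<Longrightarrow> f z \<le> W z) \<Longrightarrow> 0 \<le> y \<Longrightarrow> f y \<le> V y"
  unfolding convex_env_def by (intro cSup_upper env_bdd) auto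

lemma env_least:
  assumes "\<And>f. convex_on {0..} f \<Longrightarrow> (\<And>z. 0 \<le> z \<Longrightarrow> f z \<le> W z) \<Longrightarrow> f y \<le> c"
  shows "V y \<le> c"
proof -
  \<comment> \<open>As \<open>W\<close> is nonnegative, the zero function is an admissible minorant,
    so the supremum is over a nonempty set.\<close>
  have "convex_on {0..} (\<lambda>_::real. 0::real)" by (simp add: convex_on_const convex_real_interval)
  then show ?thesis
    unfolding convex_env_def using W_nonneg assms by (intro cSup_least) fastforce+
qed

lemma env_le: "0 \<le> y \<Longrightarrow> V y \<le> W y"
  by (rule env_least) auto

lemma env_nonneg: "0 \<le> y \<Longrightarrow> 0 \<le> V y"
  using env_ge[of "\<lambda>_. 0" y] W_nonneg by (simp add: convex_on_const convex_real_interval)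

lemma env_0: "V 0 = 0"
  using env_le[of 0] env_nonneg[of 0] W0 by simp

lemma env_convex: "convex_on {0..} V"
proof (rule convex_onI)
  fix t x y :: real
  assume t: "0 < t" "t < 1" and xy: "x \<in> {0..}" "y \<in> {0..}"
  show "V ((1 - t) *\<^sub>R x + t *\<^sub>R y) \<le> (1 - t) * V x + t * V y"
  proof (rule env_least)
    fix f assume f: "convex_on {0..} f" "\<And>z. 0 \<le> z \<Longrightarrow> f z \<le> W z"
    have "f ((1 - t) *\<^sub>R x + t *\<^sub>R y) \<le> (1 - t) * f x + t * f y"
      using t xy by (intro convex_onD[OF f(1)]) auto
    also have "\<dots> \<le> (1 - t) * V x + t * V y"
      using env_ge[OF f] t xy by (intro add_mono mult_left_mono) auto
    finally show "f ((1 - t) *\<^sub>R x + t *\<^sub>R y) \<le> (1 - t) * V x + t * V y" .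
  qed
qed auto

lemma env_cont: "continuous_on {0<..} V"
  by (intro convex_on_continuous convex_on_subset[OF env_convex]) auto

text \<open>Convexity in a form with arbitrary affine upper bounds at the two ends, so that a line
  can be tilted without recomputing chords.\<close>

lemma env_chord:
  assumes "0 \<le> x" "x \<le> s" "s \<le> y" "V x \<le> m * x + c" "V y \<le> m * y + c"
  shows "V s \<le> m * s + c"
proof (cases "x = y")
  case False
  define t where "t = (s - x) / (y - x)"
  have t: "0 \<le> t" "t \<le> 1"
    using assms False by (auto simp: t_def)
  have "t * (y - x) = s - x" using False by (simp add: t_def)
  then have s: "s = (1 - t) *\<^sub>R x + t *\<^sub>R y" by (simp add: algebra_simps)
  have "V s \<le> (1 - t) * V x + t * V y"
    unfolding s using t assms by (intro convex_onD[OF env_convex]) auto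
  also have "\<dots> \<le> (1 - t) * (m * x + c) + t * (m * y + c)"
    using t assms by (intro add_mono mult_left_mono) auto
  also have "\<dots> = m * s + c" unfolding s by (simp add: algebra_simps)
  finally show ?thesis .
qed (use assms in auto)

text \<open>Otherwise the maximum of the envelope and a short chord of it would be a larger convex
  function below \<open>W\<close>.\<close>
lemma env_affine_near:
  assumes y: "0 < y" "V y < W y"
  obtains d m c where "0 < d" "\<And>s. \<bar>s - y\<bar> < d \<Longrightarrow> 0 < s \<and> V s = m * s + c"
proof -
  \<comment> \<open>A level strictly between \<open>V y\<close> and \<open>W y\<close> separates the
    two functions near \<open>y\<close>. A chord of \<open>V\<close> over a short interval stays
    below \<open>\<kappa>\<close>, hence below \<open>W\<close>.\<close>
  define \<kappa> where "\<kappa> = (V y + W y) / 2"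
  have \<kappa>: "V y < \<kappa>" "\<kappa> < W y" using y by (auto simp: \<kappa>_def)
  have Vy: "isCont V y" using env_cont y continuous_on_eq_continuous_at[of "{0<..}" V] by auto
  have Wy: "isCont W y" using W_deriv_at[OF y(1)] DERIV_isCont by blast
  have "\<forall>\<^sub>F s in at y. V s < \<kappa>" "\<forall>\<^sub>F s in at y. \<kappa> < W s" "\<forall>\<^sub>F s in at y. 0 < s"
    using Vy Wy \<kappa> y order_tendstoD[OF tendsto_ident_at, of _ y UNIV] by (auto simp: isCont_def order_tendstoD)
  then have "\<forall>\<^sub>F s in at y. V s < \<kappa> \<and> \<kappa> < W s \<and> 0 < s" by eventually_elim auto
  then obtain d0 where d0: "d0 > 0" "\<And>s. s \<noteq> y \<Longrightarrow> dist s y < d0 \<Longrightarrow> V s < \<kappa> \<and> \<kappa> < W s \<and> 0 < s"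
    unfolding eventually_at by auto
  define d where "d = d0 / 2"
  have d: "d > 0" "\<And>s. \<bar>s - y\<bar> \<le> d \<Longrightarrow> V s < \<kappa> \<and> \<kappa> < W s \<and> 0 < s"
  proof -
    show "d > 0" using d0(1) by (simp add: d_def)
    fix s assume "\<bar>s - y\<bar> \<le> d"
    then have "dist s y < d0" using d0(1) by (simp add: d_def dist_real_def)
    then show "V s < \<kappa> \<and> \<kappa> < W s \<and> 0 < s" using d0(2)[of s] \<kappa> y by (cases "s = y") auto
  qed
  define p q where "p = y - d" and "q = y + d"
  have pq: "0 < p" "p < q" "V p < \<kappa>" "V q < \<kappa>"
    using d(1) d(2)[of p] d(2)[of q] by (auto simp: p_def q_def)
  define m where "m = (V q - V p) / (q - p)"
  define c where "c = V p - m * p"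
  have lp: "m * p + c = V p" by (simp add: c_def)
  have "m * (q - p) = V q - V p" using pq by (simp add: m_def)
  then have lq: "m * q + c = V q" by (simp add: c_def algebra_simps)
  have above: "V s \<le> m * s + c" if "p \<le> s" "s \<le> q" for s
    using env_chord[of p s q m c] that pq lp lq by auto
  \<comment> \<open>If the chord line were above \<open>V\<close> at some \<open>s\<close> outside
    the interval, the line tilted about the far end of the interval until it meets \<open>V\<close>
    at \<open>s\<close> would bound \<open>V\<close> from above at both of these points but pass
    strictly below it at the near end, against convexity.\<close>
  have below: "m * s + c \<le> V s" if "0 \<le> s" "s < p \<or> q < s" for s
  proof (rule ccontr)
    assume neg: "\<not> m * s + c \<le> V s"
    define e where "e = m * s + c - V s"
    have e: "e > 0" using neg by (simp add: e_def)
    show False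
    proof (cases "s < p")
      case True
      \<comment> \<open>The slope change for which the line tilted about \<open>q\<close> passes
        through the graph of \<open>V\<close> at \<open>s\<close>.\<close>
      define k where "k = e / (q - s)"
      define m2 c2 where "m2 = m + k" and "c2 = c - k * q"
      have "V s \<le> m2 * s + c2"
      proof -
        have "m2 * s + c2 = m * s + c - k * (q - s)" by (simp add: m2_def c2_def algebra_simps)
        also have "\<dots> = V s" using True pq by (simp add: e_def k_def)
        finally show ?thesis by simp
      qed
      moreover have "V q \<le> m2 * q + c2" using lq by (simp add: m2_def c2_def algebra_simps)
      ultimately have "V p \<le> m2 * p + c2" using True pq that by (intro env_chord[of s p q]) auto
      moreover have "m2 * p + c2 = V p - k * (q - p)"
        using lp by (simp add: m2_def c2_def algebra_simps)
      moreover have "k * (q - p) > 0" using e True pq by (simp add: k_def)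
      ultimately show False by simp
    next
      case False
      then have s: "q < s" using that by auto
      define k where "k = e / (s - p)"
      define m2 c2 where "m2 = m - k" and "c2 = c + k * p"
      have "V s \<le> m2 * s + c2"
      proof -
        have "m2 * s + c2 = m * s + c - k * (s - p)" by (simp add: m2_def c2_def algebra_simps)
        also have "\<dots> = V s" using s pq by (simp add: e_def k_def)
        finally show ?thesis by simp
      qed
      moreover have "V p \<le> m2 * p + c2" using lp by (simp add: m2_def c2_def algebra_simps)
      ultimately have "V q \<le> m2 * q + c2" using s pq that by (intro env_chord[of p q s]) auto
      moreover have "m2 * q + c2 = V q - k * (q - p)"
        using lq by (simp add: m2_def c2_def algebra_simps)
      moreover have "k * (q - p) > 0" using e s pq by (simp add: k_def)
      ultimately show False by simp
    qed
  qed
  have mid: "m * s + c \<le> \<kappa>" if "p \<le> s" "s \<le> q" for s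
  proof -
    have "m * s + c \<le> max (m * p + c) (m * q + c)"
      using that mult_left_mono[of s q m] mult_left_mono_neg[of p s m] by (cases "m \<ge> 0") auto
    then show ?thesis using lp lq pq by auto
  qed
  have "convex_on {0..} (\<lambda>s. max (V s) (m * s + c))"
  proof (rule convex_onI)
    fix t x z :: real assume t: "0 < t" "t < 1" and xz: "x \<in> {0..}" "z \<in> {0..}"
    let ?s = "(1 - t) *\<^sub>R x + t *\<^sub>R z"
    have "V ?s \<le> (1 - t) * V x + t * V z"
      using t xz by (intro convex_onD[OF env_convex]) auto
    also have "\<dots> \<le> (1 - t) * max (V x) (m * x + c) + t * max (V z) (m * z + c)"
      using t by (intro add_mono mult_left_mono) auto
    finally have 1: "V ?s \<le> (1 - t) * max (V x) (m * x + c) + t * max (V z) (m * z + c)" .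
    have "m * ?s + c = (1 - t) * (m * x + c) + t * (m * z + c)" by (simp add: algebra_simps)
    also have "\<dots> \<le> (1 - t) * max (V x) (m * x + c) + t * max (V z) (m * z + c)"
      using t by (intro add_mono mult_left_mono) auto
    finally show "max (V ?s) (m * ?s + c) \<le> (1 - t) * max (V x) (m * x + c) + t * max (V z) (m * z + c)"
      using 1 by simp
  qed auto
  moreover have "max (V s) (m * s + c) \<le> W s" if "0 \<le> s" for s
  proof (cases "p \<le> s \<and> s \<le> q")
    case True
    then have "\<kappa> < W s" using d(2)[of s] by (auto simp: p_def q_def)
    then show ?thesis using mid[of s] True env_le[OF that] by auto
  next
    case False
    then show ?thesis using below[of s] that env_le[OF that] by auto
  qed
  ultimately have "max (V s) (m * s + c) \<le> V s" if "0 \<le> s" for s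
    using env_ge that by fastforce
  then have "V s = m * s + c" if "p \<le> s" "s \<le> q" for s
    using above[OF that] that pq by (smt (verit))
  then show ?thesis
    using d by (intro that[of d m c]) (auto simp: p_def q_def abs_if split: if_splits)
qed

text \<open>Points \<open>z\<close> slightly beyond \<open>y\<close>, on the side opposite to
  \<open>s\<close>, make \<open>y\<close> a convex combination of \<open>z\<close> and
  \<open>s\<close>. Convexity bounds the increment of \<open>V\<close> towards \<open>s\<close> from
  below by a difference quotient of \<open>V\<close> at \<open>z\<close>, hence of \<open>W\<close>,
  because \<open>V\<close> is below \<open>W\<close> with equality at \<open>y\<close>. The limit of
  these quotients is given by \<open>W'\<close>.\<close>

lemma env_support_contact:
  assumes y: "0 < y" "V y = W y" and s: "0 \<le> s"
  shows "V y + W' y * (s - y) \<le> V s"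
proof (cases "s = y")
  case False
  define k where "k t = W (y - t * (s - y))" for t
  have "(k has_real_derivative W' y * (- (s - y))) (at 0)"
    unfolding k_def
    by (rule DERIV_chain'[where g = W]) (use y W_deriv_at in \<open>auto intro!: derivative_eq_intros\<close>)
  then have lim: "((\<lambda>t. (k t - k 0) / t) \<longlongrightarrow> W' y * (- (s - y))) (at_right 0)"
    by (auto simp: has_field_derivative_iff filterlim_at_split)
  have ev: "\<forall>\<^sub>F t in at_right 0. t < y / \<bar>s - y\<bar>"
    using y False by (intro eventually_at_rightI[of 0 "y / \<bar>s - y\<bar>"]) auto
  have ev0: "\<forall>\<^sub>F t in at_right (0::real). 0 < t" by (simp add: eventually_at_right_less)
  have "\<forall>\<^sub>F t in at_right 0. - (V s - V y) \<le> (k t - k 0) / t"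
    using ev ev0
  proof eventually_elim
    case (elim t)
    define z where "z = y - t * (s - y)"
    have "t * \<bar>s - y\<bar> < y" using elim False by (simp add: field_simps)
    moreover have "t * (s - y) \<le> t * \<bar>s - y\<bar>" using elim by (intro mult_left_mono) auto
    ultimately have z: "0 \<le> z" by (simp add: z_def)
    \<comment> \<open>The weight that solves \<open>(1 - u) z + u s = y\<close>.\<close>
    define u where "u = t / (1 + t)"
    have u: "0 \<le> u" "u \<le> 1" "1 - u = 1 / (1 + t)" using elim by (auto simp: u_def field_simps)
    have comb: "(1 - u) *\<^sub>R z + u *\<^sub>R s = y"
    proof -
      have "(1 - u) *\<^sub>R z + u *\<^sub>R s = (z + t * s) / (1 + t)"
        unfolding u(3) by (simp add: u_def add_divide_distrib)
      also have "\<dots> = y" using elim by (simp add: z_def field_simps)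
      finally show ?thesis .
    qed
    have "V y \<le> (1 - u) * V z + u * V s"
      using convex_onD[OF env_convex u(1,2), of z s] z s comb by simp
    then have "V y * (1 + t) \<le> ((1 - u) * V z + u * V s) * (1 + t)"
      using elim by (intro mult_right_mono) auto
    also have "\<dots> = V z + t * V s"
    proof -
      have "u * (1 + t) = t" "(1 - u) * (1 + t) = 1" unfolding u(3) using elim by (auto simp: u_def)
      then show ?thesis by (metis (no_types, lifting) distrib_right mult.assoc mult.commute mult_1)
    qed
    finally have "- (V s - V y) * t \<le> V z - V y" by (simp add: algebra_simps)
    also have "\<dots> \<le> k t - k 0" using env_le[OF z] y by (simp add: k_def z_def)
    finally show ?case using elim by (simp add: field_simps)
  qed
  then have "- (V s - V y) \<le> W' y * (- (s - y))"
    by (intro tendsto_lowerbound[OF lim]) auto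
  then show ?thesis by (simp add: algebra_simps)
qed auto

text \<open>Near a contact point \<open>V\<close> is squeezed between the tangent of
  \<open>W\<close> and \<open>W\<close> itself.\<close>

lemma env_deriv_contact:
  assumes y: "0 < y" "V y = W y"
  shows "(V has_real_derivative W' y) (at y)"
proof -
  define R where "R s = W s - W y - W' y * (s - y)" for s
  have "(R has_real_derivative 0) (at y)"
    unfolding R_def using W_deriv_at[OF y(1)] by (auto intro!: derivative_eq_intros)
  then have R: "((\<lambda>s. \<bar>R s / (s - y)\<bar>) \<longlongrightarrow> 0) (at y)"
    unfolding tendsto_rabs_zero_iff by (simp add: has_field_derivative_iff R_def)
  have ev: "\<forall>\<^sub>F s in at y. 0 < s" using y by (intro order_tendstoD[OF tendsto_ident_at])
  have "\<forall>\<^sub>F s in at y. norm ((V s - V y) / (s - y) - W' y) \<le> \<bar>R s / (s - y)\<bar>"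
    using ev eventually_neq_at_within[of y]
  proof eventually_elim
    case (elim s)
    have "(V s - V y) / (s - y) - W' y = (V s - V y - W' y * (s - y)) / (s - y)"
      using elim by (simp add: field_simps)
    moreover have "\<bar>V s - V y - W' y * (s - y)\<bar> \<le> \<bar>R s\<bar>"
      using env_support_contact[OF y, of s] env_le[of s] elim y by (auto simp: R_def)
    ultimately show ?case by (simp add: divide_right_mono)
  qed
  then have "((\<lambda>s. (V s - V y) / (s - y) - W' y) \<longlongrightarrow> 0) (at y)"
    by (rule Lim_null_comparison[OF _ R])
  then show ?thesis by (simp add: has_field_derivative_iff LIM_zero_iff)
qed

text \<open>Every positive point is either a contact point or has a neighbourhood on which the
  envelope is affine. This gives \<open>deriv V\<close>, and with it \<open>Q\<close>, its intended
  meaning.\<close>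

lemma env_deriv:
  assumes y: "0 < y"
  shows "(V has_real_derivative deriv V y) (at y)"
proof (cases "V y = W y")
  case True
  then show ?thesis using env_deriv_contact[OF y] DERIV_imp_deriv by metis
next
  case False
  then have lt: "V y < W y" using env_le[of y] y by simp
  obtain d m c where d: "0 < d" "\<And>s. \<bar>s - y\<bar> < d \<Longrightarrow> 0 < s \<and> V s = m * s + c"
    by (rule env_affine_near[OF y lt]) (rule that)
  have "((\<lambda>s. m * s + c) has_real_derivative m) (at y)" by (auto intro!: derivative_eq_intros)
  then have "(V has_real_derivative m) (at y)"
    by (rule has_field_derivative_transform_within[OF _ d(1)]) (use d(2) in \<open>auto simp: dist_real_def\<close>)
  then show ?thesis using DERIV_imp_deriv by metis
qed

lemma env_support: "0 < y \<Longrightarrow> 0 \<le> s \<Longrightarrow> V y + deriv V y * (s - y) \<le> V s"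
  using convex_on_imp_above_tangent[OF env_convex connected_Ici, of y s "deriv V y"]
    has_field_derivative_at_within[OF env_deriv[of y], of "{0..}"]
  by (simp add: interior_real_atLeast)

section \<open>The negative intercept \<open>Q\<close> of the tangents to the envelope\<close>

lemma Q_0: "Q 0 = 0" by (simp add: Qss_def env_0)

text \<open>The tangent at \<open>y\<close> lies below \<open>V\<close>, in particular at 0, where
  \<open>V\<close> vanishes. At \<open>y = 0\<close> the factor \<open>z\<close> in the definition
  of \<open>Q\<close> removes the two-sided derivative, which has no meaning at the
  boundary.\<close>

lemma Q_nonneg: "0 \<le> y \<Longrightarrow> 0 \<le> Q y"
  using env_support[of y 0] Q_0 by (cases "y = 0") (auto simp: Qss_def env_0 algebra_simps)

lemma Q_mono: assumes "0 \<le> x" "x \<le> y" shows "Q x \<le> Q y"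
proof (cases "x = 0 \<or> x = y")
  case True
  then show ?thesis using Q_nonneg[of y] assms Q_0 by auto
next
  case False
  then have xy: "0 < x" "x < y" using assms by auto
  have 1: "V x + deriv V x * (y - x) \<le> V y" "V y + deriv V y * (x - y) \<le> V x"
    using env_support xy by auto
  then have "deriv V x * (y - x) \<le> deriv V y * (y - x)" by (simp add: algebra_simps)
  then have "deriv V x \<le> deriv V y" using xy by simp
  then have "x * deriv V x \<le> x * deriv V y" using xy by simp
  then show ?thesis using 1 by (simp add: Qss_def algebra_simps)
qed

text \<open>For a fixed point \<open>t\<close> on one side of \<open>y\<close>, convexity bounds
  \<open>deriv V s\<close> by the difference quotient of \<open>V\<close> between \<open>s\<close>
  and \<open>t\<close>. This quotient is continuous in \<open>s\<close>, and at \<open>s = y\<close>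
  it is close to \<open>deriv V y\<close> when \<open>t\<close> is close to
  \<open>y\<close>.\<close>

lemma deriv_env_cont:
  assumes y: "0 < y" shows "isCont (deriv V) y"
  unfolding isCont_def
proof (rule order_tendstoI)
  have Vc: "isCont V y" using env_deriv[OF y] DERIV_isCont by blast
  have lim: "((\<lambda>s. (V s - V y) / (s - y)) \<longlongrightarrow> deriv V y) (at y)"
    using env_deriv[OF y] by (simp add: has_field_derivative_iff)
  have pos: "\<forall>\<^sub>F s in at y. 0 < s" using y by (intro order_tendstoD[OF tendsto_ident_at])
  fix u assume "deriv V y < u"
  then have "\<forall>\<^sub>F s in at_right y. (V s - V y) / (s - y) < u"
    using lim order_tendstoD(2) by (auto simp: filterlim_at_split)
  then have "\<forall>\<^sub>F s in at_right y. (V s - V y) / (s - y) < u \<and> y < s"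
    using eventually_at_right_less by (rule eventually_conj)
  then obtain t where t: "(V t - V y) / (t - y) < u" "y < t"
    using eventually_happens[of _ "at_right y"] by (auto simp: trivial_limit_at_right_real)
  have "((\<lambda>s. (V t - V s) / (t - s)) \<longlongrightarrow> (V t - V y) / (t - y)) (at y)"
    using Vc t by (intro tendsto_intros) (auto simp: isCont_def)
  then have "\<forall>\<^sub>F s in at y. (V t - V s) / (t - s) < u" using t by (intro order_tendstoD)
  moreover have "\<forall>\<^sub>F s in at y. s < t" using t by (intro order_tendstoD[OF tendsto_ident_at])
  ultimately show "\<forall>\<^sub>F s in at y. deriv V s < u" using pos
  proof eventually_elim
    case (elim s)
    then have "deriv V s * (t - s) \<le> V t - V s" using env_support[of s t] y t by auto
    then have "deriv V s \<le> (V t - V s) / (t - s)" using elim by (simp add: field_simps)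
    then show ?case using elim by simp
  qed
next
  have Vc: "isCont V y" using env_deriv[OF y] DERIV_isCont by blast
  have lim: "((\<lambda>s. (V s - V y) / (s - y)) \<longlongrightarrow> deriv V y) (at y)"
    using env_deriv[OF y] by (simp add: has_field_derivative_iff)
  have pos: "\<forall>\<^sub>F s in at y. 0 < s" using y by (intro order_tendstoD[OF tendsto_ident_at])
  fix u assume "u < deriv V y"
  then have "\<forall>\<^sub>F s in at_left y. u < (V s - V y) / (s - y)"
    using lim order_tendstoD(1) by (auto simp: filterlim_at_split)
  moreover have "\<forall>\<^sub>F s in at_left y. 0 < s"
    using pos by (auto simp: eventually_at_split)
  moreover have "\<forall>\<^sub>F s in at_left y. s < y" by (simp add: eventually_at_filter)
  ultimately have "\<forall>\<^sub>F s in at_left y. u < (V s - V y) / (s - y) \<and> 0 < s \<and> s < y"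
    by eventually_elim auto
  then obtain t where t: "u < (V t - V y) / (t - y)" "0 < t" "t < y"
    using eventually_happens[of _ "at_left y"] by (auto simp: trivial_limit_at_left_real)
  have "((\<lambda>s. (V t - V s) / (t - s)) \<longlongrightarrow> (V t - V y) / (t - y)) (at y)"
    using Vc t by (intro tendsto_intros) (auto simp: isCont_def)
  then have "\<forall>\<^sub>F s in at y. u < (V t - V s) / (t - s)" using t by (intro order_tendstoD)
  moreover have "\<forall>\<^sub>F s in at y. t < s" using t by (intro order_tendstoD[OF tendsto_ident_at])
  ultimately show "\<forall>\<^sub>F s in at y. u < deriv V s" using pos
  proof eventually_elim
    case (elim s)
    then have "deriv V s * (t - s) \<le> V t - V s" using env_support[of s t] t by auto
    then have "(V t - V s) / (t - s) \<le> deriv V s" using elim by (simp add: field_simps)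
    then show ?case using elim by simp
  qed
qed

lemma Q_cont: "continuous_on {0..} Q"
  unfolding continuous_on_eq_continuous_within
proof
  fix y :: real assume "y \<in> {0..}"
  then consider "y = 0" | "0 < y" by force
  then show "continuous (at y within {0..}) Q"
  proof cases
    case 1
    \<comment> \<open>The tangent at \<open>s\<close>, evaluated at \<open>2 * s\<close>, gives
      \<open>Q s \<le> V (2 * s) \<le> W (2 * s)\<close>. So continuity of \<open>W\<close> at 0
      suffices, with no control of \<open>deriv V\<close> there.\<close>
    have lim: "((\<lambda>s. W (2 * s)) \<longlongrightarrow> W (2 * 0)) (at 0 within {0..})"
      by (intro continuous_on_tendsto_compose[OF W_cont] tendsto_intros) (auto simp: eventually_at_filter)
    have "\<forall>\<^sub>F s in at 0 within {0..}. norm (Q s) \<le> W (2 * s)"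
      unfolding eventually_at_filter
    proof (intro always_eventually allI impI)
      fix s :: real assume s: "s \<noteq> 0" "s \<in> {0..}"
      then have "V s + deriv V s * (2 * s - s) \<le> V (2 * s)" by (intro env_support) auto
      then show "norm (Q s) \<le> W (2 * s)"
        using s Q_nonneg[of s] env_le[of "2 * s"] env_nonneg[of s] by (auto simp: Qss_def mult.commute)
    qed
    then have "(Q \<longlongrightarrow> 0) (at 0 within {0..})"
      using lim W0 by (intro Lim_null_comparison[of Q "\<lambda>s. W (2 * s)"]) auto
    then show ?thesis using 1 Q_0 by (simp add: continuous_within)
  next
    case 2
    have "isCont (\<lambda>z. z * deriv V z - V z) y"
      using deriv_env_cont[OF 2] DERIV_isCont[OF env_deriv[OF 2]] by (intro continuous_intros)
    then have "isCont Q y" unfolding Qss_def[abs_def] .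
    then show ?thesis using continuous_at_imp_continuous_at_within by blast
  qed
qed

lemma countable_Q_Rats: "countable (Q ` \<rat>)"
  by (intro countable_image countable_rat)

lemma Q_const_near:
  assumes y: "0 < y" "V y < W y"
  obtains d where "0 < d" "\<And>s. \<bar>s - y\<bar> < d \<Longrightarrow> Q s = Q y"
proof -
  obtain d m c where d: "0 < d" "\<And>s. \<bar>s - y\<bar> < d \<Longrightarrow> 0 < s \<and> V s = m * s + c"
    by (rule env_affine_near[OF y]) (rule that)
  have "Q s = - c" if s: "\<bar>s - y\<bar> < d" for s
  proof -
    have "((\<lambda>s. m * s + c) has_real_derivative m) (at s)" by (auto intro!: derivative_eq_intros)
    then have "(V has_real_derivative m) (at s)"
      by (rule has_field_derivative_transform_within[where d = "d - \<bar>s - y\<bar>"])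
        (use d(2) s in \<open>auto simp: dist_real_def\<close>)
    then show ?thesis using d(2)[OF s] by (simp add: Qss_def DERIV_imp_deriv)
  qed
  then show ?thesis using d(1) by (intro that[of d]) auto
qed

lemma Q_unstable:
  assumes "0 < r" "V r < W r" shows "Q r \<in> Q ` \<rat>"
proof -
  obtain d where d: "0 < d" "\<And>s. \<bar>s - r\<bar> < d \<Longrightarrow> Q s = Q r"
    by (rule Q_const_near[OF assms]) (rule that)
  obtain q where "q \<in> \<rat>" "r < q" "q < r + d"
    using Rats_dense_in_real[of r "r + d"] d(1) by auto
  then show ?thesis using d(2)[of q] by (metis abs_of_pos add_diff_cancel_left' diff_gt_0_iff_gt diff_less_eq add.commute image_eqI)
qed

text \<open>On \<open>{m..M}\<close> the line lies between the envelope and \<open>W\<close>. If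
  \<open>W\<close> meets the envelope inside, the line is tangent to \<open>V\<close> at that point,
  so it coincides with \<open>V\<close> on the whole interval, and \<open>Q\<close>, the negative
  intercept, equals \<open>G\<close>. Otherwise all inner points are unstable and \<open>Q\<close>
  is constant along them, with the value at a rational. If the interval is a single contact point,
  the slope condition makes the line the tangent there.\<close>

lemma Q_chord:
  assumes mrM: "0 \<le> m" "m \<le> r" "r \<le> M" "0 < r"
    and ends: "W m = \<mu> * m - G" "W M = \<mu> * M - G"
    and above: "\<And>s. m \<le> s \<Longrightarrow> s \<le> M \<Longrightarrow> \<mu> * s - G \<le> W s"
    and tangent: "m = M \<Longrightarrow> W' r = \<mu>"
  shows "Q r = G \<or> Q r \<in> Q ` \<rat>"
proof (cases "V r < W r")
  case True
  then show ?thesis using Q_unstable mrM by blast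
next
  case False
  then have contact: "V r = W r" using env_le[of r] mrM by simp
  show ?thesis
  proof (cases "m = M")
    case True
    then have "m = r" "M = r" using mrM by auto
    moreover have "deriv V r = W' r" using env_deriv_contact[OF mrM(4) contact] by (rule DERIV_imp_deriv)
    ultimately have "Q r = G" using tangent ends contact by (simp add: Qss_def algebra_simps)
    then show ?thesis ..
  next
    case mM: False
    then have lt: "m < M" using mrM by simp
    have below: "V s \<le> \<mu> * s - G" if "m \<le> s" "s \<le> M" for s
      using env_chord[of m s M \<mu> "-G"] env_le[of m] env_le[of M] ends that mrM by auto
    \<comment> \<open>\<open>r\<close> may be an endpoint, where \<open>Q\<close> is reached by
      continuity.\<close>
    have const_closed: "Q r = c" if "\<And>s. m < s \<Longrightarrow> s < M \<Longrightarrow> Q s = c" for c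
    proof (rule continuous_constant_on_closure[of "{m<..<M}" Q c r])
      show "continuous_on (closure {m<..<M}) Q"
        using lt mrM by (auto intro: continuous_on_subset[OF Q_cont])
    qed (use that lt mrM in auto)
    show ?thesis
    proof (cases "\<exists>s. m < s \<and> s < M \<and> V s = W s")
      case True
      then obtain s where s: "m < s" "s < M" "V s = W s" by blast
      then have Vs: "V s = \<mu> * s - G" using below[of s] above[of s] by auto
      have "V s \<le> W s" using s by simp
      \<comment> \<open>\<open>V\<close> stays below the line and touches it at the interior point
        \<open>s\<close>, so the slopes agree.\<close>
      have der: "deriv V s = \<mu>"
      proof -
        have "((\<lambda>t. \<mu> * t - G - V t) has_real_derivative \<mu> - deriv V s) (at s)"
          using env_deriv[of s] s mrM by (auto intro!: derivative_eq_intros)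
        moreover have "0 < min (s - m) (M - s)" using s by auto
        moreover have "\<forall>t. \<bar>s - t\<bar> < min (s - m) (M - s) \<longrightarrow> \<mu> * s - G - V s \<le> \<mu> * t - G - V t"
          using below Vs by (auto simp: abs_if split: if_splits)
        ultimately have "\<mu> - deriv V s = 0" by (rule DERIV_local_min)
        then show ?thesis by simp
      qed
      have Veq: "V t = \<mu> * t - G" if "m \<le> t" "t \<le> M" for t
        using env_support[of s t] below[OF that] s mrM that Vs der by (simp add: algebra_simps)
      have "Q t = G" if t: "m < t" "t < M" for t
      proof -
        have "((\<lambda>t. \<mu> * t - G) has_real_derivative \<mu>) (at t)" by (auto intro!: derivative_eq_intros)
        then have "(V has_real_derivative \<mu>) (at t)"
          by (rule has_field_derivative_transform_within_open[where S = "{m<..<M}"]) (use t Veq in auto)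
        then show ?thesis using Veq[of t] t by (simp add: Qss_def DERIV_imp_deriv)
      qed
      then show ?thesis using const_closed by blast
    next
      case False
      then have unst: "V s < W s" if "m < s" "s < M" for s
        using env_le[of s] that mrM by force
      have der: "(Q has_real_derivative 0) (at s)" if s: "m < s" "s < M" for s
      proof -
        have s0: "0 < s" using s mrM by simp
        obtain d where d: "0 < d" "\<And>t. \<bar>t - s\<bar> < d \<Longrightarrow> Q t = Q s"
            by (rule Q_const_near[OF s0 unst[OF s]]) (rule that)
        have near: "Q s = Q t" if "dist t s < d" for t
          using d(2)[of t] that unfolding dist_real_def by simp
        have "((\<lambda>_. Q s) has_real_derivative 0) (at s)" by simp
        then show ?thesis
          by (rule has_field_derivative_transform_within[OF _ d(1) UNIV_I near])
      qed
      obtain q where q: "q \<in> \<rat>" "m < q" "q < M"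
        using Rats_dense_in_real[OF lt] by blast
      have step: "Q t = Q s" if st: "m < s" "s < t" "t < M" for s t
      proof (rule DERIV_isconst_end[of s t Q])
        show "continuous_on {s..t} Q"
          by (rule continuous_on_subset[OF Q_cont]) (use st mrM in auto)
        show "(Q has_real_derivative 0) (at x)" if "s < x" "x < t" for x
          using that st by (intro der) auto
      qed (use st in auto)
      have "Q s = Q q" if "m < s" "s < M" for s
        using step[of s q] step[of q s] that q by (cases s q rule: linorder_cases) auto
      then have "Q r = Q q" by (rule const_closed)
      then show ?thesis using q by blast
    qed
  qed
qed

end

subsection \<open>Riesz representation\<close>

definition square_integrable :: "'a measure \<Rightarrow> ('a \<Rightarrow> real) \<Rightarrow> bool" where
  "square_integrable M f \<longleftrightarrow> f \<in> borel_measurable M \<and> integrable M (\<lambda>x. (f x)\<^sup>2)"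

lemma square_integrable_mult:
  assumes "square_integrable M f" "square_integrable M g"
  shows "integrable M (\<lambda>x. f x * g x)"
proof (rule Bochner_Integration.integrable_bound)
  show "integrable M (\<lambda>x. (f x)\<^sup>2 + (g x)\<^sup>2)" using assms by (auto simp: square_integrable_def)
  show "(\<lambda>x. f x * g x) \<in> borel_measurable M" using assms by (auto simp: square_integrable_def)
  show "AE x in M. norm (f x * g x) \<le> norm ((f x)\<^sup>2 + (g x)\<^sup>2)"
  proof (rule AE_I2)
    fix x
    have "0 \<le> (\<bar>f x\<bar> - \<bar>g x\<bar>)\<^sup>2" by simp
    then have "2 * (\<bar>f x\<bar> * \<bar>g x\<bar>) \<le> (f x)\<^sup>2 + (g x)\<^sup>2" by (simp add: power2_diff mult_ac)
    moreover have "0 \<le> \<bar>f x\<bar> * \<bar>g x\<bar>" by simp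
    ultimately have "\<bar>f x\<bar> * \<bar>g x\<bar> \<le> (f x)\<^sup>2 + (g x)\<^sup>2" by linarith
    then show "norm (f x * g x) \<le> norm ((f x)\<^sup>2 + (g x)\<^sup>2)" by (simp add: abs_mult)
  qed
qed

lemma square_integrable_lincomb:
  assumes "square_integrable M f" "square_integrable M g"
  shows "square_integrable M (\<lambda>x. c * f x + d * g x)"
proof -
  have "(\<lambda>x. (c * f x + d * g x)\<^sup>2) = (\<lambda>x. c\<^sup>2 * (f x)\<^sup>2 + d\<^sup>2 * (g x)\<^sup>2 + 2 * c * d * (f x * g x))"
    by (auto simp: power2_eq_square algebra_simps)
  then show ?thesis
    using assms square_integrable_mult[OF assms] by (auto simp: square_integrable_def)
qed

lemma integral_lincomb_square:
  assumes "square_integrable M f" "square_integrable M g"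
  shows "(LINT x|M. (c * f x + d * g x)\<^sup>2) =
    c\<^sup>2 * (LINT x|M. (f x)\<^sup>2) + d\<^sup>2 * (LINT x|M. (g x)\<^sup>2) + 2 * c * d * (LINT x|M. f x * g x)"
proof -
  have "(\<lambda>x. (c * f x + d * g x)\<^sup>2) = (\<lambda>x. c\<^sup>2 * (f x)\<^sup>2 + d\<^sup>2 * (g x)\<^sup>2 + (2 * c * d) * (f x * g x))"
    by (auto simp: power2_eq_square algebra_simps)
  then show ?thesis
    using assms square_integrable_mult[OF assms] by (simp add: square_integrable_def)
qed

lemma quadratic_nonneg_imp:
  fixes a b :: real
  assumes "\<And>t. 0 \<le> a * t\<^sup>2 + 2 * b * t"
  shows "b = 0"
proof (rule ccontr)
  assume b: "b \<noteq> 0"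
  have a: "a > 0"
  proof (rule ccontr)
    assume "\<not> a > 0"
    then have "a * (- b)\<^sup>2 + 2 * b * (- b) < 0"
      using b by (intro add_nonpos_neg mult_nonpos_nonneg) (auto simp: mult_less_0_iff zero_less_mult_iff)
    then show False using assms[of "- b"] by simp
  qed
  have "a * (- b / a)\<^sup>2 + 2 * b * (- b / a) = - (b\<^sup>2 / a)"
    using a by (simp add: power2_eq_square field_simps)
  moreover have "b\<^sup>2 / a > 0" using a b by simp
  ultimately show False using assms[of "- b / a"] by linarith
qed

text \<open>The quadratic form in \<open>c\<close> and \<open>d\<close> given by the square integral
  of \<open>c f + d g\<close> is nonnegative; inserting \<open>c = - C\<close>, \<open>d = A\<close>
  yields the discriminant inequality, except when \<open>A = 0\<close>.\<close>

lemma square_integrable_Cauchy_Schwarz: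
  assumes f: "square_integrable M f" and g: "square_integrable M g"
  shows "\<bar>LINT x|M. f x * g x\<bar> \<le> sqrt (LINT x|M. (f x)\<^sup>2) * sqrt (LINT x|M. (g x)\<^sup>2)"
proof -
  define A B C where "A = (LINT x|M. (f x)\<^sup>2)" and "B = (LINT x|M. (g x)\<^sup>2)" and "C = (LINT x|M. f x * g x)"
  have nonneg: "A \<ge> 0" "B \<ge> 0" by (auto simp: A_def B_def)
  have quad: "0 \<le> c\<^sup>2 * A + d\<^sup>2 * B + 2 * c * d * C" for c d
    using integral_lincomb_square[OF f g, of c d, symmetric] by (simp add: A_def B_def C_def)
  have "C\<^sup>2 \<le> A * B"
  proof (cases "A = 0")
    case True
    have "0 \<le> B * t\<^sup>2 + 2 * C * t" for t
      using quad[of 1 t] quad[of "1" "t"] True by (simp add: algebra_simps)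
    then have "C = 0" by (rule quadratic_nonneg_imp)
    then show ?thesis using nonneg by simp
  next
    case False
    have "0 \<le> A * (A * B - C\<^sup>2)"
      using quad[of "- C" A] by (simp add: power2_eq_square algebra_simps)
    then show ?thesis using False nonneg by (simp add: zero_le_mult_iff)
  qed
  then have "\<bar>C\<bar> \<le> sqrt (A * B)" by (metis real_sqrt_abs real_sqrt_le_iff)
  then show ?thesis by (simp add: A_def B_def C_def real_sqrt_mult)
qed

lemma square_integrable_integrable:
  assumes "finite_measure M" "square_integrable M f" shows "integrable M f"
proof -
  interpret finite_measure M by fact
  have "square_integrable M (\<lambda>_. 1)" by (auto simp: square_integrable_def)
  then show ?thesis using square_integrable_mult[OF assms(2)] by fastforce
qed

text \<open>On a finite measure space a Cauchy sequence in \<open>L^2\<close> is Cauchy in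
  \<open>L^1\<close>, so a subsequence converges almost everywhere. Fatou's lemma turns the Cauchy
  estimate into convergence of the whole sequence to this limit.\<close>

lemma square_integrable_complete:
  assumes M: "finite_measure M"
    and f: "\<And>n::nat. square_integrable M (f n)"
    and Cauchy: "\<And>e. e > 0 \<Longrightarrow> \<exists>N. \<forall>m\<ge>N. \<forall>n\<ge>N. (LINT x|M. (f m x - f n x)\<^sup>2) < e"
  obtains v where "square_integrable M v" "(\<lambda>n. LINT x|M. (f n x - v x)\<^sup>2) \<longlonglongrightarrow> 0"
proof -
  interpret finite_measure M by fact
  have diff: "square_integrable M (\<lambda>x. f m x - f n x)" for m n
    using square_integrable_lincomb[OF f f, of 1 m "-1" n] by simp
  have one: "square_integrable M (\<lambda>_. 1)" by (auto simp: square_integrable_def)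
  \<comment> \<open>The summand 1 keeps the constant positive even if the measure is zero.\<close>
  define c where "c = sqrt (measure M (space M)) + 1"
  have c: "c > 0" by (auto simp: c_def intro: add_nonneg_pos)
  have L1: "(LINT x|M. norm (f m x - f n x)) \<le> sqrt (LINT x|M. (f m x - f n x)\<^sup>2) * c" for m n
  proof -
    have sq: "square_integrable M (\<lambda>x. \<bar>f m x - f n x\<bar>)"
      using diff[of m n] by (auto simp: square_integrable_def)
    have "(LINT x|M. \<bar>f m x - f n x\<bar> * 1) \<le> sqrt (LINT x|M. \<bar>f m x - f n x\<bar>\<^sup>2) * sqrt (LINT x|M. 1\<^sup>2)"
      using square_integrable_Cauchy_Schwarz[OF sq one] by (rule order_trans[OF abs_ge_self])
    also have "\<dots> \<le> sqrt (LINT x|M. (f m x - f n x)\<^sup>2) * c"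
      by (auto simp: c_def intro!: mult_left_mono)
    finally show ?thesis by simp
  qed
  obtain r where r: "strict_mono r" "AE x in M. Cauchy (\<lambda>i. f (r i) x)"
  proof (rule cauchy_L1_AE_cauchy_subseq[of M f])
    show "integrable M (f n)" for n using square_integrable_integrable[OF M f] .
    fix e :: real assume e: "e > 0"
    then obtain N where N: "\<forall>m\<ge>N. \<forall>n\<ge>N. (LINT x|M. (f m x - f n x)\<^sup>2) < (e / c)\<^sup>2"
      using Cauchy[of "(e / c)\<^sup>2"] c by auto
    have "(LINT x|M. norm (f m x - f n x)) < e" if "m \<ge> N" "n \<ge> N" for m n
    proof -
      have "sqrt (LINT x|M. (f m x - f n x)\<^sup>2) < e / c"
        using N that e c by (metis divide_pos_pos less_imp_le real_sqrt_less_iff real_sqrt_unique)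
      then have "sqrt (LINT x|M. (f m x - f n x)\<^sup>2) * c < e" using c by (simp add: pos_less_divide_eq)
      then show ?thesis using L1[of m n] by linarith
    qed
    then show "\<exists>N. \<forall>i\<ge>N. \<forall>j\<ge>N. (LINT x|M. norm (f i x - f j x)) < e" by blast
  qed blast
  define v where "v x = lim (\<lambda>i. f (r i) x)" for x
  have fm: "f n \<in> borel_measurable M" for n using f by (auto simp: square_integrable_def)
  have vm: "v \<in> borel_measurable M" unfolding v_def using fm by measurable
  have conv: "AE x in M. (\<lambda>i. f (r i) x) \<longlonglongrightarrow> v x"
    using r(2) by eventually_elim (auto simp: v_def Cauchy_convergent_iff convergent_LIMSEQ_iff)
  have key: "(\<integral>\<^sup>+x. ennreal ((f n x - v x)\<^sup>2) \<partial>M) \<le> ennreal e"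
    if N: "\<forall>m\<ge>N. \<forall>n\<ge>N. (LINT x|M. (f m x - f n x)\<^sup>2) < e" and "n \<ge> N" "e > 0" for n N e
  proof -
    have "(\<integral>\<^sup>+x. ennreal ((f n x - v x)\<^sup>2) \<partial>M) = (\<integral>\<^sup>+x. liminf (\<lambda>i. ennreal ((f n x - f (r i) x)\<^sup>2)) \<partial>M)"
    proof (rule nn_integral_cong_AE, use conv in eventually_elim)
      fix x assume "(\<lambda>i. f (r i) x) \<longlonglongrightarrow> v x"
      then have "(\<lambda>i. ennreal ((f n x - f (r i) x)\<^sup>2)) \<longlonglongrightarrow> ennreal ((f n x - v x)\<^sup>2)"
        by (intro tendsto_intros)
      then show "ennreal ((f n x - v x)\<^sup>2) = liminf (\<lambda>i. ennreal ((f n x - f (r i) x)\<^sup>2))"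
        by (intro lim_imp_Liminf[symmetric]) auto
    qed
    also have "\<dots> \<le> liminf (\<lambda>i. \<integral>\<^sup>+x. ennreal ((f n x - f (r i) x)\<^sup>2) \<partial>M)"
      using fm by (intro nn_integral_liminf) auto
    also have "\<dots> \<le> ennreal e"
    proof (rule Liminf_le)
      have "(\<integral>\<^sup>+x. ennreal ((f n x - f (r i) x)\<^sup>2) \<partial>M) \<le> ennreal e" if "i \<ge> N" for i
      proof -
        have "r i \<ge> N" using that seq_suble[OF r(1), of i] by simp
        then have "(LINT x|M. (f n x - f (r i) x)\<^sup>2) \<le> e" using N \<open>n \<ge> N\<close> by (auto intro: less_imp_le)
        then show ?thesis
          using diff[of n "r i"] by (subst nn_integral_eq_integral) (auto simp: square_integrable_def ennreal_leI)
      qed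
      then show "\<forall>\<^sub>F i in sequentially. (\<integral>\<^sup>+x. ennreal ((f n x - f (r i) x)\<^sup>2) \<partial>M) \<le> ennreal e"
        by (auto simp: eventually_sequentially)
    qed simp
    finally show ?thesis .
  qed
  have diffm: "(\<lambda>x. (f n x - v x)\<^sup>2) \<in> borel_measurable M" for n using fm vm by measurable
  obtain N1 where N1: "\<forall>m\<ge>N1. \<forall>n\<ge>N1. (LINT x|M. (f m x - f n x)\<^sup>2) < 1" using Cauchy[of 1] by auto
  have "integrable M (\<lambda>x. (f N1 x - v x)\<^sup>2)"
    using key[OF N1, of N1] diffm[of N1] by (auto simp: integrable_iff_bounded intro: le_less_trans)
  then have "square_integrable M (\<lambda>x. f N1 x - v x)"
    using fm vm by (auto simp: square_integrable_def)
  from square_integrable_lincomb[OF f[of N1] this, of 1 "-1"]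
  have v: "square_integrable M v" by simp
  have dv: "integrable M (\<lambda>x. (f n x - v x)\<^sup>2)" for n
    using square_integrable_lincomb[OF f v, of 1 n "-1"] by (simp add: square_integrable_def)
  have "(\<lambda>n. LINT x|M. (f n x - v x)\<^sup>2) \<longlonglongrightarrow> 0"
  proof (rule LIMSEQ_I)
    fix e :: real assume e: "e > 0"
    then obtain N where N: "\<forall>m\<ge>N. \<forall>n\<ge>N. (LINT x|M. (f m x - f n x)\<^sup>2) < e / 2" using Cauchy[of "e / 2"] by auto
    have "norm ((LINT x|M. (f n x - v x)\<^sup>2) - 0) < e" if "n \<ge> N" for n
    proof -
      have "ennreal (LINT x|M. (f n x - v x)\<^sup>2) \<le> ennreal (e / 2)"
        using key[OF N that] e nn_integral_eq_integral[OF dv[of n]] by simp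
      then have "(LINT x|M. (f n x - v x)\<^sup>2) \<le> e / 2" using e by simp
      then show ?thesis using e by simp
    qed
    then show "\<exists>N. \<forall>n\<ge>N. norm ((LINT x|M. (f n x - v x)\<^sup>2) - 0) < e" by blast
  qed
  then show ?thesis using v that by blast
qed

text \<open>The representing function is the limit of a minimising sequence of
  \<open>\<phi> \<mapsto> \<integral> \<phi>\<^sup>2 - 2 l(\<phi>)\<close>, which is Cauchy by the parallelogram identity.\<close>
lemma Riesz_representation:
  assumes M: "finite_measure M"
    and T: "\<And>\<phi>. \<phi> \<in> T \<Longrightarrow> square_integrable M \<phi>"
    and T_lin: "\<And>\<phi> \<psi> c d. \<phi> \<in> T \<Longrightarrow> \<psi> \<in> T \<Longrightarrow> (\<lambda>x. c * \<phi> x + d * \<psi> x) \<in> T"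
    and T_ne: "\<phi>0 \<in> T"
    and l_lin: "\<And>\<phi> \<psi> c d. \<phi> \<in> T \<Longrightarrow> \<psi> \<in> T \<Longrightarrow> l (\<lambda>x. c * \<phi> x + d * \<psi> x) = c * l \<phi> + d * l \<psi>"
    and l_bd: "\<And>\<phi>. \<phi> \<in> T \<Longrightarrow> l \<phi> \<le> L * sqrt (LINT x|M. (\<phi> x)\<^sup>2)"
    and L: "0 \<le> L"
  obtains v where "square_integrable M v" "(LINT x|M. (v x)\<^sup>2) \<le> L\<^sup>2"
    "\<And>\<phi>. \<phi> \<in> T \<Longrightarrow> l \<phi> = (LINT x|M. v x * \<phi> x)"
proof -
  define N where "N \<phi> = (LINT x|M. (\<phi> x)\<^sup>2)" for \<phi> :: "'a \<Rightarrow> real"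
  define J where "J \<phi> = N \<phi> - 2 * l \<phi>" for \<phi> :: "'a \<Rightarrow> real"
  define j where "j = Inf (J ` T)"
  have N0: "N \<phi> \<ge> 0" for \<phi> by (simp add: N_def)
  \<comment> \<open>Completing the square in the norm of \<open>\<phi>\<close>.\<close>
  have J_lower: "- L\<^sup>2 \<le> J \<phi>" if "\<phi> \<in> T" for \<phi>
  proof -
    have "0 \<le> (sqrt (N \<phi>) - L)\<^sup>2" by simp
    also have "\<dots> = N \<phi> - 2 * (L * sqrt (N \<phi>)) + L\<^sup>2" using N0 by (simp add: power2_diff)
    also have "\<dots> \<le> J \<phi> + L\<^sup>2" using l_bd[OF that] by (simp add: J_def N_def)
    finally show ?thesis by simp
  qed
  then have bdd: "bdd_below (J ` T)" by (intro bdd_belowI2)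
  have j_le: "j \<le> J \<phi>" if "\<phi> \<in> T" for \<phi>
    unfolding j_def using that bdd by (intro cInf_lower) auto
  have "\<exists>\<phi>\<in>T. J \<phi> < j + 1 / real (Suc n)" for n
  proof -
    have "Inf (J ` T) < j + 1 / real (Suc n)" by (simp add: j_def)
    then show ?thesis using cInf_lessD[of "J ` T"] T_ne by blast
  qed
  then obtain f where f: "\<And>n. f n \<in> T" "\<And>n. J (f n) < j + 1 / real (Suc n)" by metis
  \<comment> \<open>The linear part of \<open>J\<close> cancels in the parallelogram identity. As
    the midpoint has \<open>J\<close> at least \<open>j\<close>, two near-minimisers must be
    close.\<close>
  have par: "N (\<lambda>x. \<phi> x - \<psi> x) = 2 * (J \<phi> + J \<psi>) - 4 * J (\<lambda>x. (1/2) * \<phi> x + (1/2) * \<psi> x)"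
    if "\<phi> \<in> T" "\<psi> \<in> T" for \<phi> \<psi>
    using integral_lincomb_square[OF T[OF that(1)] T[OF that(2)], of 1 "-1"]
      integral_lincomb_square[OF T[OF that(1)] T[OF that(2)], of "1/2" "1/2"] l_lin[OF that, of "1/2" "1/2"]
    by (simp add: N_def J_def power2_eq_square algebra_simps)
  have Cau: "N (\<lambda>x. f m x - f n x) < 2 / real (Suc m) + 2 / real (Suc n)" for m n
    using par[OF f(1)[of m] f(1)[of n]] j_le[OF T_lin[OF f(1)[of m] f(1)[of n]], of "1/2" "1/2"] f(2)[of m] f(2)[of n]
    by simp
  have Cauchy: "\<exists>K. \<forall>m\<ge>K. \<forall>n\<ge>K. (LINT x|M. (f m x - f n x)\<^sup>2) < e" if e: "e > 0" for e
  proof -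
    obtain K where K: "K > 0" "4 / e < real K" using reals_Archimedean2[of "4/e"] e
      by (metis divide_pos_pos less_trans of_nat_0_less_iff zero_less_numeral)
    have "2 / real (Suc m) \<le> e / 2" if "m \<ge> K" for m
    proof -
      have "4 / e < real (Suc m)" using K that by simp
      then show ?thesis using e by (simp add: field_simps)
    qed
    then have "N (\<lambda>x. f m x - f n x) < e" if "m \<ge> K" "n \<ge> K" for m n
      using Cau[of m n] that by (smt (verit) field_sum_of_halves)
    then show ?thesis by (auto simp: N_def)
  qed
  obtain v where v: "square_integrable M v" "(\<lambda>n. LINT x|M. (f n x - v x)\<^sup>2) \<longlonglongrightarrow> 0"
    using square_integrable_complete[OF M T[OF f(1)] Cauchy] by blast
  have sqrt_lim: "(\<lambda>n. sqrt (LINT x|M. (f n x - v x)\<^sup>2)) \<longlonglongrightarrow> 0"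
    using tendsto_real_sqrt[OF v(2)] by simp
  have inner_lim: "(\<lambda>n. LINT x|M. f n x * g x) \<longlonglongrightarrow> (LINT x|M. v x * g x)" if g: "square_integrable M g" for g
  proof (rule LIM_zero_cancel, rule Lim_null_comparison)
    have d: "square_integrable M (\<lambda>x. f n x - v x)" for n
      using square_integrable_lincomb[OF T[OF f(1)] v(1), of 1 n "-1"] by simp
    show "\<forall>\<^sub>F n in sequentially. norm ((LINT x|M. f n x * g x) - (LINT x|M. v x * g x))
        \<le> sqrt (LINT x|M. (f n x - v x)\<^sup>2) * sqrt (LINT x|M. (g x)\<^sup>2)"
    proof (intro always_eventually allI)
      fix n
      have "(LINT x|M. f n x * g x) - (LINT x|M. v x * g x) = (LINT x|M. (f n x - v x) * g x)"
        using square_integrable_mult[OF T[OF f(1)[of n]] g] square_integrable_mult[OF v(1) g]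
        by (simp add: left_diff_distrib)
      then show "norm ((LINT x|M. f n x * g x) - (LINT x|M. v x * g x))
          \<le> sqrt (LINT x|M. (f n x - v x)\<^sup>2) * sqrt (LINT x|M. (g x)\<^sup>2)"
        using square_integrable_Cauchy_Schwarz[OF d g, of n] by simp
    qed
    show "(\<lambda>n. sqrt (LINT x|M. (f n x - v x)\<^sup>2) * sqrt (LINT x|M. (g x)\<^sup>2)) \<longlonglongrightarrow> 0"
      using tendsto_mult_left_zero[OF sqrt_lim] .
  qed
  \<comment> \<open>First variation: along \<open>f n + t \<psi>\<close> the functional
    \<open>J\<close> stays above its infimum. In the limit this leaves a nonnegative quadratic
    polynomial in \<open>t\<close> without constant term, so its linear coefficient
    vanishes.\<close>
  have rep: "l \<psi> = (LINT x|M. v x * \<psi> x)" if \<psi>: "\<psi> \<in> T" for \<psi>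
  proof -
    have "0 \<le> N \<psi> * t\<^sup>2 + 2 * ((LINT x|M. v x * \<psi> x) - l \<psi>) * t" for t
    proof (rule tendsto_lowerbound)
      have "(\<lambda>n. N \<psi> * t\<^sup>2 + 2 * ((LINT x|M. f n x * \<psi> x) - l \<psi>) * t + inverse (real (Suc n)))
          \<longlonglongrightarrow> N \<psi> * t\<^sup>2 + 2 * ((LINT x|M. v x * \<psi> x) - l \<psi>) * t + 0"
        by (intro tendsto_intros inner_lim[OF T[OF \<psi>]] LIMSEQ_inverse_real_of_nat)
      then show "(\<lambda>n. N \<psi> * t\<^sup>2 + 2 * ((LINT x|M. f n x * \<psi> x) - l \<psi>) * t + 1 / real (Suc n))
          \<longlonglongrightarrow> N \<psi> * t\<^sup>2 + 2 * ((LINT x|M. v x * \<psi> x) - l \<psi>) * t"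
        by (simp only: inverse_eq_divide add_0_right)
      have "0 \<le> N \<psi> * t\<^sup>2 + 2 * ((LINT x|M. f n x * \<psi> x) - l \<psi>) * t + 1 / real (Suc n)" for n
      proof -
        have "J (\<lambda>x. 1 * f n x + t * \<psi> x) = J (f n) + (N \<psi> * t\<^sup>2 + 2 * ((LINT x|M. f n x * \<psi> x) - l \<psi>) * t)"
          unfolding J_def N_def integral_lincomb_square[OF T[OF f(1)] T[OF \<psi>]] l_lin[OF f(1) \<psi>]
          by (simp add: algebra_simps)
        then show ?thesis using j_le[OF T_lin[OF f(1)[of n] \<psi>, of 1 t]] f(2)[of n] by simp
      qed
      then show "\<forall>\<^sub>F n in sequentially. 0 \<le> N \<psi> * t\<^sup>2 + 2 * ((LINT x|M. f n x * \<psi> x) - l \<psi>) * t + 1 / real (Suc n)"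
        by simp
    qed simp
    then have "(LINT x|M. v x * \<psi> x) - l \<psi> = 0" by (rule quadratic_nonneg_imp)
    then show ?thesis by simp
  qed
  have N_lim: "(\<lambda>n. N (f n)) \<longlonglongrightarrow> N v"
  proof -
    have "N (f n) = (LINT x|M. (f n x - v x)\<^sup>2) + 2 * (LINT x|M. f n x * v x) - N v" for n
      using integral_lincomb_square[OF T[OF f(1)[of n]] v(1), of 1 "-1"] by (simp add: N_def)
    moreover have "(\<lambda>n. (LINT x|M. (f n x - v x)\<^sup>2) + 2 * (LINT x|M. f n x * v x) - N v) \<longlonglongrightarrow> 0 + 2 * (LINT x|M. v x * v x) - N v"
      by (intro tendsto_intros v inner_lim)
    ultimately show ?thesis by (simp add: N_def power2_eq_square)
  qed
  \<comment> \<open>\<open>v\<close> need not lie in \<open>T\<close>, so the bound on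
    \<open>l\<close> is passed along the minimising sequence, on which \<open>l\<close> tends to
    \<open>N v\<close>.\<close>
  have "N v \<le> L * sqrt (N v)"
  proof (rule tendsto_le[of sequentially])
    show "(\<lambda>n. L * sqrt (N (f n))) \<longlonglongrightarrow> L * sqrt (N v)" by (intro tendsto_intros N_lim)
    have "(\<lambda>n. l (f n)) \<longlonglongrightarrow> (LINT x|M. v x * v x)"
      using inner_lim[OF v(1)] rep[OF f(1)] by (simp add: mult.commute)
    then show "(\<lambda>n. l (f n)) \<longlonglongrightarrow> N v" by (simp add: N_def power2_eq_square)
  qed (use l_bd[OF f(1)] in \<open>auto simp: N_def\<close>)
  then have "sqrt (N v) * sqrt (N v) \<le> L * sqrt (N v)" using N0[of v] by simp
  then have "sqrt (N v) \<le> L" using L N0[of v] by (metis mult_le_cancel_right real_sqrt_ge_zero not_less le_less_trans order_le_less)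
  then have "N v \<le> L\<^sup>2" using N0[of v] by (metis real_sqrt_le_iff real_sqrt_abs abs_of_nonneg L)
  then show ?thesis using v(1) rep that by (auto simp: N_def)
qed

subsection \<open>Wasserstein convergence implies weak convergence\<close>

lemma sets_Tmeas: "sets (Tmeas \<mu>) = sets Tspace"
  by (simp add: Tmeas_def)

lemma measurable_Tspace: "f \<in> borel_measurable borel \<Longrightarrow> f \<in> borel_measurable Tspace"
  by (simp add: Tspace_def measurable_restrict_space1)

lemma prob_density_integrable:
  assumes "prob_density \<mu>" "continuous_on UNIV f"
  shows "set_integrable lborel {0..1} (\<lambda>x. \<mu> x * f x)"
  using assms by (intro set_integrable_cont_mult) (auto simp: prob_density_def intro: continuous_on_subset)

lemma integral_Tmeas:
  assumes \<mu>: "prob_density \<mu>" and f: "continuous_on UNIV f"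
  shows "integrable (Tmeas \<mu>) f" "(LINT x|Tmeas \<mu>. f x) = (LINT x:{0..1}|lborel. \<mu> x * f x)"
proof -
  have m: "\<mu> \<in> borel_measurable Tspace" "f \<in> borel_measurable Tspace"
    using \<mu> borel_measurable_continuous_onI[OF f] by (auto simp: prob_density_def intro: measurable_Tspace)
  have nn: "\<And>x. 0 \<le> \<mu> x" using \<mu> by (simp add: prob_density_def)
  have ae: "AE x in lborel. indicator {0..1} x *\<^sub>R (\<mu> x * f x) = indicator {0..<1} x *\<^sub>R (\<mu> x * f x)"
    using AE_lborel_singleton[of "1::real"] by eventually_elim (auto simp: indicator_def)
  have i: "integrable lborel (\<lambda>x. indicator {0..1} x *\<^sub>R (\<mu> x * f x))"
    using prob_density_integrable[OF \<mu> f] by (simp add: set_integrable_def)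
  have fm: "f \<in> borel_measurable borel" using f by (rule borel_measurable_continuous_onI)
  have mm: "\<mu> \<in> borel_measurable borel" using \<mu> by (simp add: prob_density_def)
  have m2: "(\<lambda>x. indicator {0..<1} x *\<^sub>R (\<mu> x * f x)) \<in> borel_measurable lborel"
    using fm mm by measurable
  have i2: "integrable lborel (\<lambda>x. indicator {0..<1} x *\<^sub>R (\<mu> x * f x))"
    using integrable_cong_AE_imp[OF i m2] ae by (auto elim: eventually_mono)
  have "integrable Tspace (\<lambda>x. \<mu> x *\<^sub>R f x)"
    using i2 by (simp add: Tspace_def integrable_restrict_space mult_ac)
  then show "integrable (Tmeas \<mu>) f"
    unfolding Tmeas_def using m nn by (subst integrable_density) auto
  have "(LINT x|Tmeas \<mu>. f x) = (LINT x|Tspace. \<mu> x *\<^sub>R f x)"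
    unfolding Tmeas_def using m nn by (subst integral_density) auto
  also have "\<dots> = (LINT x|lborel. indicator {0..<1} x *\<^sub>R (\<mu> x * f x))"
    unfolding Tspace_def by (subst integral_restrict_space) auto
  also have "\<dots> = (LINT x:{0..1}|lborel. \<mu> x * f x)"
    unfolding set_lebesgue_integral_def using ae i m2
    by (intro integral_cong_AE) (auto elim: eventually_mono)
  finally show "(LINT x|Tmeas \<mu>. f x) = (LINT x:{0..1}|lborel. \<mu> x * f x)" .
qed

lemma prob_space_Tmeas: assumes "prob_density \<mu>" shows "prob_space (Tmeas \<mu>)"
proof -
  have c: "continuous_on UNIV (\<lambda>_::real. 1::real)" by simp
  have fin: "emeasure (Tmeas \<mu>) (space (Tmeas \<mu>)) < \<top>"
    using integral_Tmeas(1)[OF assms c] by (simp add: integrable_iff_bounded)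
  have "measure (Tmeas \<mu>) (space (Tmeas \<mu>)) = 1"
    using integral_Tmeas(2)[OF assms c] assms by (simp add: prob_density_def)
  then show ?thesis
    using fin by (intro prob_spaceI) (simp add: emeasure_eq_ennreal_measure)
qed

text \<open>Makes the set of couplings nonempty. Since \<open>enn2real\<close> sends infinity to 0,
  a small value of \<open>d2\<close> is informative only if the infimum is finite; the cost of the
  product coupling is at most 1.\<close>

lemma coupling_product:
  assumes "prob_density \<mu>" "prob_density \<nu>"
  shows "coupling (Tmeas \<mu> \<Otimes>\<^sub>M Tmeas \<nu>) \<mu> \<nu>"
proof -
  interpret A: prob_space "Tmeas \<mu>" by (rule prob_space_Tmeas) fact
  interpret B: prob_space "Tmeas \<nu>" by (rule prob_space_Tmeas) fact
  have sets: "sets (Tmeas \<mu> \<Otimes>\<^sub>M Tmeas \<nu>) = sets (Tspace \<Otimes>\<^sub>M Tspace)"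
    by (intro sets_pair_measure_cong sets_Tmeas)
  have sp: "space (Tmeas \<mu>) = space Tspace" "space (Tmeas \<nu>) = space Tspace"
    by (simp_all add: Tmeas_def)
  have top: "space Tspace \<in> sets Tspace" by (rule sets.top)
  have fst: "distr (Tmeas \<mu> \<Otimes>\<^sub>M Tmeas \<nu>) Tspace fst = Tmeas \<mu>"
  proof (rule measure_eqI)
    fix A assume "A \<in> sets (distr (Tmeas \<mu> \<Otimes>\<^sub>M Tmeas \<nu>) Tspace fst)"
    then have A: "A \<in> sets Tspace" by simp
    have fm: "fst \<in> measurable (Tmeas \<mu> \<Otimes>\<^sub>M Tmeas \<nu>) Tspace"
      by (subst measurable_cong_sets[OF refl sets_Tmeas[symmetric, of \<mu>]]) simp
    have "fst -` A \<inter> space (Tmeas \<mu> \<Otimes>\<^sub>M Tmeas \<nu>) = A \<times> space (Tmeas \<nu>)"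
      using sets.sets_into_space[OF A] by (auto simp: space_pair_measure sp)
    then show "emeasure (distr (Tmeas \<mu> \<Otimes>\<^sub>M Tmeas \<nu>) Tspace fst) A = emeasure (Tmeas \<mu>) A"
      using A fm B.emeasure_pair_measure_Times[of A "Tmeas \<mu>" "space (Tmeas \<nu>)"]
      by (simp add: emeasure_distr sets_Tmeas B.emeasure_space_1[unfolded sp] top sp)
  qed (simp add: sets_Tmeas)
  have snd: "distr (Tmeas \<mu> \<Otimes>\<^sub>M Tmeas \<nu>) Tspace snd = Tmeas \<nu>"
  proof (rule measure_eqI)
    fix A assume "A \<in> sets (distr (Tmeas \<mu> \<Otimes>\<^sub>M Tmeas \<nu>) Tspace snd)"
    then have A: "A \<in> sets Tspace" by simp
    have fm: "snd \<in> measurable (Tmeas \<mu> \<Otimes>\<^sub>M Tmeas \<nu>) Tspace"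
      by (subst measurable_cong_sets[OF refl sets_Tmeas[symmetric, of \<nu>]]) simp
    have "snd -` A \<inter> space (Tmeas \<mu> \<Otimes>\<^sub>M Tmeas \<nu>) = space (Tmeas \<mu>) \<times> A"
      using sets.sets_into_space[OF A] by (auto simp: space_pair_measure sp)
    then show "emeasure (distr (Tmeas \<mu> \<Otimes>\<^sub>M Tmeas \<nu>) Tspace snd) A = emeasure (Tmeas \<nu>) A"
      using A fm B.emeasure_pair_measure_Times[of "space (Tmeas \<mu>)" "Tmeas \<mu>" A]
      by (simp add: emeasure_distr sets_Tmeas A.emeasure_space_1[unfolded sp] top sp)
  qed (simp add: sets_Tmeas)
  show ?thesis
    unfolding coupling_def using sets fst snd prob_space_pair[OF A.prob_space_axioms B.prob_space_axioms] by blast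
qed

section \<open>Testing the transport distance against smooth functions\<close>

lemma dist_T_le: "dist_T x y \<le> 1 / 2"
  unfolding dist_T_def using of_int_round_abs_le[of "x - y"] by (simp add: abs_minus_commute)

lemma dist_T_nonneg: "0 \<le> dist_T x y"
  by (simp add: dist_T_def)

text \<open>Periodicity allows \<open>x\<close> to be shifted by the integer nearest to
  \<open>x - y\<close> before the mean value theorem is applied.\<close>

lemma dist_T_Lipschitz:
  assumes "test_fun \<phi>" "\<And>x. \<bar>deriv \<phi> x\<bar> \<le> B"
  shows "\<bar>\<phi> x - \<phi> y\<bar> \<le> B * dist_T x y"
proof -
  have "\<phi> x = \<phi> (x - of_int (round (x - y)))"
    using periodic1_int[OF test_fun_periodic[OF assms(1)], of x "- round (x - y)"] by simp
  moreover have "norm (\<phi> (x - of_int (round (x - y))) - \<phi> y) \<le> B * norm (x - of_int (round (x - y)) - y)"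
    by (rule field_differentiable_bound[where S = UNIV and f' = "deriv \<phi>"])
      (use assms test_fun_differentiable in auto)
  ultimately show ?thesis by (simp add: dist_T_def algebra_simps)
qed

lemma d2_less_coupling:
  assumes "prob_density \<mu>" "prob_density \<nu>" "d2 \<mu> \<nu> < \<eta>"
  obtains \<gamma> where "coupling \<gamma> \<mu> \<nu>" "(\<integral>\<^sup>+ z. ennreal ((dist_T (fst z) (snd z))\<^sup>2) \<partial>\<gamma>) < ennreal (\<eta>\<^sup>2)"
proof -
  let ?c = "\<lambda>\<gamma>. \<integral>\<^sup>+ z. ennreal ((dist_T (fst z) (snd z))\<^sup>2) \<partial>\<gamma>"
  let ?I = "INF \<gamma> \<in> {\<gamma>. coupling \<gamma> \<mu> \<nu>}. ?c \<gamma>"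
  let ?p = "Tmeas \<mu> \<Otimes>\<^sub>M Tmeas \<nu>"
  have cp: "coupling ?p \<mu> \<nu>" using assms by (intro coupling_product)
  then interpret P: prob_space ?p by (simp add: coupling_def)
  have "?I \<le> ?c ?p" using cp by (intro INF_lower) auto
  also have "\<dots> \<le> (\<integral>\<^sup>+ z. 1 \<partial>?p)"
  proof (intro nn_integral_mono)
    fix z :: "real \<times> real"
    have "(dist_T (fst z) (snd z))\<^sup>2 \<le> 1\<^sup>2"
      using dist_T_le[of "fst z" "snd z"] dist_T_nonneg[of "fst z" "snd z"] by (intro power_mono) auto
    then show "ennreal ((dist_T (fst z) (snd z))\<^sup>2) \<le> 1" by simp
  qed
  also have "\<dots> = 1" by (simp add: P.emeasure_space_1)
  finally have fin: "?I < \<top>" by (auto intro: le_less_trans)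
  have "0 \<le> d2 \<mu> \<nu>" by (simp add: d2_def)
  then have "(d2 \<mu> \<nu>)\<^sup>2 < \<eta>\<^sup>2" using assms(3) by (intro power_strict_mono) auto
  moreover have "(d2 \<mu> \<nu>)\<^sup>2 = enn2real ?I" by (simp add: d2_def)
  ultimately have "ennreal (enn2real ?I) < ennreal (\<eta>\<^sup>2)"
    by (simp add: ennreal_less_iff)
  then have "?I < ennreal (\<eta>\<^sup>2)"
    using ennreal_enn2real[OF fin] by (simp only:)
  then obtain \<gamma> where "\<gamma> \<in> {\<gamma>. coupling \<gamma> \<mu> \<nu>}" "?c \<gamma> < ennreal (\<eta>\<^sup>2)"
    unfolding INF_less_iff by (elim bexE)
  then show ?thesis by (intro that[of \<gamma>]) (simp only: mem_Collect_eq)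
qed

text \<open>The difference of the two integrals is one integral of
  \<open>\<phi> (fst z) - \<phi> (snd z)\<close> against a coupling of cost below
  \<open>\<eta>\<close> squared.\<close>

lemma coupling_test_bound:
  assumes \<mu>: "prob_density \<mu>" and \<nu>: "prob_density \<nu>" and d: "d2 \<mu> \<nu> < \<eta>"
    and \<phi>: "test_fun \<phi>" "\<And>x. \<bar>deriv \<phi> x\<bar> \<le> B"
  shows "\<bar>(LINT x:{0..1}|lborel. \<mu> x * \<phi> x) - (LINT x:{0..1}|lborel. \<nu> x * \<phi> x)\<bar> \<le> 2 * B * \<eta>"
proof -
  obtain \<gamma> where \<gamma>: "coupling \<gamma> \<mu> \<nu>" and cost: "(\<integral>\<^sup>+ z. ennreal ((dist_T (fst z) (snd z))\<^sup>2) \<partial>\<gamma>) < ennreal (\<eta>\<^sup>2)"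
    by (rule d2_less_coupling[OF \<mu> \<nu> d])
  interpret G: prob_space \<gamma> using \<gamma> by (simp add: coupling_def)
  have sets: "sets \<gamma> = sets (Tspace \<Otimes>\<^sub>M Tspace)" using \<gamma> by (simp add: coupling_def)
  have \<eta>: "\<eta> > 0" using d by (smt (verit) d2_def enn2real_nonneg real_sqrt_ge_zero)
  have B: "B \<ge> 0" using \<phi>(2)[of 0] by linarith
  have pm: "fst \<in> measurable \<gamma> Tspace" "snd \<in> measurable \<gamma> Tspace"
    by (simp_all add: measurable_cong_sets[OF sets refl])
  have idm: "(\<lambda>x. x) \<in> measurable Tspace borel" by (intro measurable_Tspace) simp
  have rm: "fst \<in> borel_measurable \<gamma>" "snd \<in> borel_measurable \<gamma>"
    using measurable_compose[OF pm(1) idm] measurable_compose[OF pm(2) idm] by simp_all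
  have dm: "(\<lambda>z. dist_T (fst z) (snd z)) \<in> borel_measurable \<gamma>"
    unfolding dist_T_def round_def using rm by measurable
  have c: "continuous_on UNIV \<phi>" by (rule test_fun_continuous[OF \<phi>(1)])
  have \<phi>m: "\<phi> \<in> borel_measurable Tspace"
    by (intro measurable_Tspace borel_measurable_continuous_onI c)
  have 1: "integrable \<gamma> (\<lambda>z. \<phi> (fst z))" "(LINT z|\<gamma>. \<phi> (fst z)) = (LINT x:{0..1}|lborel. \<mu> x * \<phi> x)"
    using integral_Tmeas[OF \<mu> c] \<gamma> integrable_distr_eq[OF pm(1) \<phi>m] integral_distr[OF pm(1) \<phi>m]
    by (auto simp: coupling_def)
  have 2: "integrable \<gamma> (\<lambda>z. \<phi> (snd z))" "(LINT z|\<gamma>. \<phi> (snd z)) = (LINT x:{0..1}|lborel. \<nu> x * \<phi> x)"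
    using integral_Tmeas[OF \<nu> c] \<gamma> integrable_distr_eq[OF pm(2) \<phi>m] integral_distr[OF pm(2) \<phi>m]
    by (auto simp: coupling_def)
  have dsq: "integrable \<gamma> (\<lambda>z. (dist_T (fst z) (snd z))\<^sup>2)"
    using dm cost by (auto simp: integrable_iff_bounded intro: less_trans)
  have "ennreal (LINT z|\<gamma>. (dist_T (fst z) (snd z))\<^sup>2) < ennreal (\<eta>\<^sup>2)"
    using cost nn_integral_eq_integral[OF dsq] by simp
  then have cost': "(LINT z|\<gamma>. (dist_T (fst z) (snd z))\<^sup>2) \<le> \<eta>\<^sup>2"
    by (simp add: ennreal_less_iff)
  \<comment> \<open>A distance \<open>d\<close> is at most \<open>\<eta> + d^2 / \<eta>\<close>.
    After integration the two terms contribute \<open>B \<eta>\<close> each.\<close>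
  have ptw: "\<bar>\<phi> (fst z) - \<phi> (snd z)\<bar> \<le> B * \<eta> + B / \<eta> * (dist_T (fst z) (snd z))\<^sup>2" for z
  proof -
    let ?d = "dist_T (fst z) (snd z)"
    have "?d \<le> \<eta> + ?d\<^sup>2 / \<eta>"
    proof (cases "?d \<le> \<eta>")
      case True
      then show ?thesis using \<eta> by (smt (verit) divide_nonneg_pos zero_le_power2)
    next
      case False
      then have "?d * \<eta> \<le> ?d * ?d" using dist_T_nonneg by (intro mult_left_mono) auto
      then have "?d \<le> ?d\<^sup>2 / \<eta>" using \<eta> by (simp add: power2_eq_square field_simps)
      then show ?thesis using \<eta> by simp
    qed
    then have "B * ?d \<le> B * (\<eta> + ?d\<^sup>2 / \<eta>)" using B by (intro mult_left_mono)
    then show ?thesis using dist_T_Lipschitz[OF \<phi>, of "fst z" "snd z"] by (simp add: algebra_simps)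
  qed
  have "\<bar>(LINT z|\<gamma>. \<phi> (fst z)) - (LINT z|\<gamma>. \<phi> (snd z))\<bar> = \<bar>LINT z|\<gamma>. \<phi> (fst z) - \<phi> (snd z)\<bar>"
    using 1 2 by simp
  also have "\<dots> \<le> (LINT z|\<gamma>. B * \<eta> + B / \<eta> * (dist_T (fst z) (snd z))\<^sup>2)"
    using 1(1) 2(1) dsq ptw by (intro order_trans[OF integral_abs_bound] integral_mono) auto
  also have "\<dots> = B * \<eta> + B / \<eta> * (LINT z|\<gamma>. (dist_T (fst z) (snd z))\<^sup>2)"
    using dsq by (simp add: G.prob_space)
  also have "\<dots> \<le> B * \<eta> + B / \<eta> * \<eta>\<^sup>2"
    using cost' B \<eta> by (intro add_left_mono mult_left_mono) auto
  also have "\<dots> = 2 * B * \<eta>" using \<eta> by (simp add: power2_eq_square)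
  finally show ?thesis using 1 2 by simp
qed

lemma prob_density_integral_close:
  assumes \<mu>: "prob_density \<mu>" and f: "continuous_on UNIV f" "continuous_on UNIV g"
    and close: "\<And>x. \<bar>f x - g x\<bar> \<le> e"
  shows "\<bar>(LINT x:{0..1}|lborel. \<mu> x * f x) - (LINT x:{0..1}|lborel. \<mu> x * g x)\<bar> \<le> e"
proof -
  have i: "set_integrable lborel {0..1} (\<lambda>x. \<mu> x * f x)" "set_integrable lborel {0..1} (\<lambda>x. \<mu> x * g x)"
    "set_integrable lborel {0..1} \<mu>"
    using prob_density_integrable[OF \<mu>] f \<mu> by (auto simp: prob_density_def)
  have "\<bar>LINT x:{0..1}|lborel. \<mu> x * f x - \<mu> x * g x\<bar> \<le> (LINT x:{0..1}|lborel. e * \<mu> x)"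
  proof (rule LINT_abs_bound)
    fix x
    have "\<mu> x * \<bar>f x - g x\<bar> \<le> \<mu> x * e" using \<mu> close by (intro mult_left_mono) (auto simp: prob_density_def)
    moreover have "\<bar>\<mu> x * f x - \<mu> x * g x\<bar> = \<mu> x * \<bar>f x - g x\<bar>"
      using \<mu> by (simp add: right_diff_distrib[symmetric] abs_mult prob_density_def del: right_diff_distrib)
    ultimately show "\<bar>\<mu> x * f x - \<mu> x * g x\<bar> \<le> e * \<mu> x" by (simp add: mult.commute)
  qed (use i in \<open>auto intro: set_integral_diff\<close>)
  also have "\<dots> = e" using \<mu> by (simp add: prob_density_def)
  finally show ?thesis using i by (simp add: set_integral_diff)
qed

text \<open>Replacing \<open>f\<close> by a uniformly close test function costs the same small error
  for every \<open>\<mu> n\<close> and for \<open>\<nu>\<close>, since all masses are 1.\<close>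

lemma d2_imp_weak_convergence:
  assumes \<mu>: "\<And>n. prob_density (\<mu> n)" and \<nu>: "prob_density \<nu>"
    and conv: "(\<lambda>n. d2 (\<mu> n) \<nu>) \<longlonglongrightarrow> 0"
    and f: "continuous_on UNIV f" "periodic1 f"
  shows "(\<lambda>n. LINT x:{0..1}|lborel. \<mu> n x * f x) \<longlonglongrightarrow> (LINT x:{0..1}|lborel. \<nu> x * f x)"
proof (rule LIMSEQ_I)
  fix e :: real assume e: "e > 0"
  obtain \<phi> where \<phi>: "test_fun \<phi>" "\<And>x. \<bar>f x - \<phi> x\<bar> < e / 4"
    using periodic_approx_test_fun[OF f, of "e/4"] e by auto
  have "bounded (deriv \<phi> ` {0..1})"
    by (intro compact_imp_bounded compact_continuous_image test_fun_continuous test_fun_deriv \<phi>) auto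
  then obtain B0 where B0: "\<forall>y\<in>deriv \<phi> ` {0..1}. norm y \<le> B0" unfolding bounded_iff by blast
  define B where "B = \<bar>B0\<bar> + 1"
  have B: "\<bar>deriv \<phi> x\<bar> \<le> B" "B > 0" for x
  proof -
    have "frac x \<in> {0..1}" using frac_lt_1[of x] by auto
    then have "\<bar>deriv \<phi> (frac x)\<bar> \<le> B0" using B0 by auto
    then show "\<bar>deriv \<phi> x\<bar> \<le> B"
      using periodic1_frac[OF test_fun_periodic[OF test_fun_deriv[OF \<phi>(1)]], of x] by (simp add: B_def)
  qed (simp add: B_def)
  define \<eta> where "\<eta> = e / (8 * B)"
  have \<eta>: "\<eta> > 0" "2 * B * \<eta> = e / 4" using e B(2) by (auto simp: \<eta>_def)
  obtain N where N: "\<And>n. n \<ge> N \<Longrightarrow> norm (d2 (\<mu> n) \<nu> - 0) < \<eta>"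
    using LIMSEQ_D[OF conv \<eta>(1)] by blast
  have "norm ((LINT x:{0..1}|lborel. \<mu> n x * f x) - (LINT x:{0..1}|lborel. \<nu> x * f x)) < e" if "n \<ge> N" for n
  proof -
    have "d2 (\<mu> n) \<nu> < \<eta>" using N[OF that] by simp
    from coupling_test_bound[OF \<mu> \<nu> this \<phi>(1) B(1)]
    have 1: "\<bar>(LINT x:{0..1}|lborel. \<mu> n x * \<phi> x) - (LINT x:{0..1}|lborel. \<nu> x * \<phi> x)\<bar> \<le> e / 4"
      using \<eta> by simp
    have c: "continuous_on UNIV \<phi>" by (rule test_fun_continuous[OF \<phi>(1)])
    have 2: "\<bar>(LINT x:{0..1}|lborel. \<mu> n x * f x) - (LINT x:{0..1}|lborel. \<mu> n x * \<phi> x)\<bar> \<le> e / 4"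
      using \<phi>(2) by (intro prob_density_integral_close \<mu> f c) (auto intro: less_imp_le)
    have 3: "\<bar>(LINT x:{0..1}|lborel. \<nu> x * f x) - (LINT x:{0..1}|lborel. \<nu> x * \<phi> x)\<bar> \<le> e / 4"
      using \<phi>(2) by (intro prob_density_integral_close \<nu> f c) (auto intro: less_imp_le)
    show ?thesis using 1 2 3 e unfolding real_norm_def by linarith
  qed
  then show "\<exists>N. \<forall>n\<ge>N. norm ((LINT x:{0..1}|lborel. \<mu> n x * f x) - (LINT x:{0..1}|lborel. \<nu> x * f x)) < e" by blast
qed

subsection \<open>Primitives of periodic functions\<close>

lemma set_integral_combine:
  fixes f :: "real \<Rightarrow> real"
  assumes "set_integrable lborel {a..c} f" "a \<le> b" "b \<le> c"
  shows "(LINT x:{a..c}|lborel. f x) = (LINT x:{a..b}|lborel. f x) + (LINT x:{b..c}|lborel. f x)"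
proof -
  have "set_integrable lborel {a..b} f" "set_integrable lborel {b..c} f"
    using assms by (auto intro: set_integrable_subset)
  then show ?thesis
    using assms Henstock_Kurzweil_Integration.integral_combine[OF assms(2,3) set_borel_integral_eq_integral(1)[OF assms(1)]]
    by (simp add: set_borel_integral_eq_integral(2))
qed

lemma set_integral_shift:
  fixes f :: "real \<Rightarrow> real"
  shows "(LINT x:{a + d..b + d}|lborel. f x) = (LINT x:{a..b}|lborel. f (x + d))"
    "set_integrable lborel {a + d..b + d} f \<longleftrightarrow> set_integrable lborel {a..b} (\<lambda>x. f (x + d))"
proof -
  have eq: "indicator {a + d..b + d} (d + 1 * x) *\<^sub>R f (d + 1 * x) = indicator {a..b} x *\<^sub>R f (x + d)" for x
    by (auto simp: indicator_def add.commute)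
  show "(LINT x:{a + d..b + d}|lborel. f x) = (LINT x:{a..b}|lborel. f (x + d))"
    unfolding set_lebesgue_integral_def
    by (subst lborel_integral_real_affine[of 1 _ d]) (simp_all only: eq, simp_all)
  show "set_integrable lborel {a + d..b + d} f \<longleftrightarrow> set_integrable lborel {a..b} (\<lambda>x. f (x + d))"
    using lborel_integrable_real_affine_iff[of 1 "\<lambda>x. indicator {a + d..b + d} x *\<^sub>R f x" d]
    unfolding eq set_integrable_def by simp
qed

lemma periodic1_set_integrable:
  assumes f: "periodic1 f" "set_integrable lborel {0..1} f"
  shows "set_integrable lborel {a..b} f"
proof -
  have unit: "set_integrable lborel {of_int k..of_int k + 1} f" for k :: int
    using set_integral_shift(2)[of 0 "of_int k" 1 f] f periodic1_int[OF f(1)] by (simp add: add.commute)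
  have u: "set_integrable lborel (\<Union>k\<in>{\<lfloor>a\<rfloor>..\<lfloor>b\<rfloor>}. {of_int k..of_int k + 1}) f"
    by (intro set_integrable_UN unit) auto
  have sub: "{a..b} \<subseteq> (\<Union>k\<in>{\<lfloor>a\<rfloor>..\<lfloor>b\<rfloor>}. {of_int k..of_int k + 1})"
  proof
    fix x assume "x \<in> {a..b}"
    then have "\<lfloor>x\<rfloor> \<in> {\<lfloor>a\<rfloor>..\<lfloor>b\<rfloor>}" by (auto intro: floor_mono)
    moreover have "x \<in> {of_int \<lfloor>x\<rfloor>..of_int \<lfloor>x\<rfloor> + 1}" using floor_correct[of x] by auto
    ultimately show "x \<in> (\<Union>k\<in>{\<lfloor>a\<rfloor>..\<lfloor>b\<rfloor>}. {of_int k..of_int k + 1})" by blast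
  qed
  show ?thesis by (rule set_integrable_subset[OF u _ sub]) simp
qed

lemma periodic1_integral_unit:
  assumes f: "periodic1 f" "set_integrable lborel {0..1} f"
  shows "(LINT t:{x..x + 1}|lborel. f t) = (LINT t:{0..1}|lborel. f t)"
proof -
  let ?n = "of_int \<lfloor>x\<rfloor> :: real"
  have n: "?n \<le> x" "x \<le> ?n + 1" using floor_correct[of x] by auto
  have i: "set_integrable lborel {a..b} f" for a b by (rule periodic1_set_integrable[OF f])
  have sh: "(LINT t:{a + 1..b + 1}|lborel. f t) = (LINT t:{a..b}|lborel. f t)" for a b
    using f(1) by (simp add: set_integral_shift periodic1_def)
  have "(LINT t:{x..x + 1}|lborel. f t) = (LINT t:{x..?n + 1}|lborel. f t) + (LINT t:{?n + 1..x + 1}|lborel. f t)"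
    using n by (intro set_integral_combine i) auto
  also have "\<dots> = (LINT t:{?n..?n + 1}|lborel. f t)"
    using n set_integral_combine[OF i, of ?n x "?n + 1"] sh[of ?n x] by simp
  also have "\<dots> = (LINT t:{0..1}|lborel. f t)"
    using set_integral_shift(1)[of 0 ?n 1 f] periodic1_int[OF f(1)] by (simp add: add.commute)
  finally show ?thesis .
qed

text \<open>The signed integral from 0, on the whole line, so that periodicity of a primitive can be
  expressed.\<close>

definition prim :: "(real \<Rightarrow> real) \<Rightarrow> real \<Rightarrow> real" where
  "prim f x = (if 0 \<le> x then LINT t:{0..x}|lborel. f t else - (LINT t:{x..0}|lborel. f t))"

lemma prim_diff:
  assumes i: "\<And>a b. set_integrable lborel {a..b} f" and "x \<le> y"
  shows "prim f y - prim f x = (LINT t:{x..y}|lborel. f t)"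
proof -
  consider "0 \<le> x" | "x < 0" "0 \<le> y" | "y < 0" by linarith
  then show ?thesis
  proof cases
    case 1
    then show ?thesis using assms set_integral_combine[OF i, of 0 x y] by (simp add: prim_def)
  next
    case 2
    then show ?thesis using assms set_integral_combine[OF i, of x 0 y] by (simp add: prim_def)
  next
    case 3
    then show ?thesis using assms set_integral_combine[OF i, of x y 0] by (simp add: prim_def)
  qed
qed

lemma prim_periodic:
  assumes f: "periodic1 f" "set_integrable lborel {0..1} f" and zero: "(LINT t:{0..1}|lborel. f t) = 0"
  shows "periodic1 (prim f)"
  unfolding periodic1_def
proof
  fix x
  show "prim f (x + 1) = prim f x"
    using prim_diff[OF periodic1_set_integrable[OF f], of x "x + 1"] periodic1_integral_unit[OF f, of x] zero by simp
qed

lemma prim_deriv: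
  assumes "continuous_on UNIV f"
  shows "(prim f has_real_derivative f x) (at x)"
proof -
  have i: "set_integrable lborel {a..b} f" for a b
    using assms continuous_on_subset by (blast intro: set_integrable_continuous)
  have "((\<lambda>y. prim f (x - 1) + integral {x - 1..y} f) has_real_derivative f x) (at x within {x - 1..x + 1})"
    using assms continuous_on_subset[of UNIV f "{x - 1..x + 1}"]
    by (auto intro!: derivative_eq_intros integral_has_real_derivative)
  then have "((\<lambda>y. prim f (x - 1) + integral {x - 1..y} f) has_real_derivative f x) (at x)"
    using at_within_Icc_at[of "x - 1" x "x + 1"] by simp
  then show ?thesis
  proof (rule has_field_derivative_transform_within_open[where S = "{x - 1<..<x + 1}"])
    fix y assume "y \<in> {x - 1<..<x + 1}"
    then show "prim f (x - 1) + integral {x - 1..y} f = prim f y"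
      using prim_diff[OF i, of "x - 1" y] set_borel_integral_eq_integral(2)[OF i, of "x - 1" y] by simp
  qed auto
qed

lemma prim_continuous:
  assumes i: "\<And>a b. set_integrable lborel {a..b} f"
  shows "continuous_on UNIV (prim f)"
proof -
  have "isCont (prim f) x" for x
  proof -
    have "continuous_on {x - 1..x + 1} (\<lambda>y. prim f (x - 1) + integral {x - 1..y} f)"
      using set_borel_integral_eq_integral(1)[OF i]
      by (intro continuous_intros indefinite_integral_continuous_1)
    moreover have "prim f (x - 1) + integral {x - 1..y} f = prim f y" if "y \<in> {x - 1..x + 1}" for y
      using prim_diff[OF i, of "x - 1" y] set_borel_integral_eq_integral(2)[OF i, of "x - 1" y] that by simp
    ultimately have "continuous_on {x - 1..x + 1} (prim f)"
      using continuous_on_cong[of "{x - 1..x + 1}" "{x - 1..x + 1}"] by (metis (no_types, lifting))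
    then show ?thesis by (intro continuous_on_interior[of "{x - 1..x + 1}"]) auto
  qed
  then show ?thesis by (simp add: continuous_at_imp_continuous_on)
qed

text \<open>As \<open>s\<close> is merely integrable, \<open>prim s\<close> need not be
  differentiable everywhere. Writing \<open>\<phi> 1 - \<phi> x\<close> as the integral of
  \<open>\<phi>'\<close> and exchanging the order of integration avoids differentiating it.\<close>

lemma integral_by_parts_prim:
  assumes s: "\<And>a b. set_integrable lborel {a..b} s"
    and \<phi>: "\<And>x. (\<phi> has_real_derivative \<phi>' x) (at x)" "continuous_on UNIV \<phi>'"
  shows "(LINT x:{0..1}|lborel. s x * \<phi> x) = prim s 1 * \<phi> 1 - (LINT x:{0..1}|lborel. prim s x * \<phi>' x)"
proof -
  define S where "S x = indicator {0..1} x *\<^sub>R s x" for x :: real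
  define D where "D t = indicator {0..1} t *\<^sub>R \<phi>' t" for t :: real
  have S: "integrable lborel S" using s[of 0 1] by (simp add: set_integrable_def S_def[abs_def])
  have \<phi>'i: "set_integrable lborel {a..b} \<phi>'" for a b
    using \<phi>(2) continuous_on_subset by (blast intro: set_integrable_continuous)
  have D: "integrable lborel D" using \<phi>'i[of 0 1] by (simp add: set_integrable_def D_def[abs_def])
  have Sm[measurable]: "S \<in> borel_measurable borel" and Dm[measurable]: "D \<in> borel_measurable borel"
    using S D by auto
  \<comment> \<open>The integrand of the double integral over the triangle \<open>x \<le> t\<close>
    in the unit square.\<close>
  define k where "k x t = S x * D t * indicator {0..} (t - x)" for x t :: real
  have km: "case_prod k \<in> borel_measurable (lborel \<Otimes>\<^sub>M lborel)"
    unfolding k_def split_beta' by measurable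
  have kb: "norm (k x t) \<le> norm (S x * D t)" for x t
    by (auto simp: k_def indicator_def)
  have kx: "integrable lborel (k x)" for x
  proof (rule Bochner_Integration.integrable_bound)
    show "integrable lborel (\<lambda>t. S x * D t)" using D by simp
    show "k x \<in> borel_measurable lborel" unfolding k_def by measurable
  qed (use kb in auto)
  have kS: "integrable (lborel \<Otimes>\<^sub>M lborel) (\<lambda>z. S (fst z) * D (snd z))"
  proof (rule lborel_pair.Fubini_integrable)
    show "(\<lambda>z. S (fst z) * D (snd z)) \<in> borel_measurable (lborel \<Otimes>\<^sub>M lborel)" by measurable
    have "(\<lambda>x. LINT y|lborel. norm (S (fst (x, y)) * D (snd (x, y)))) = (\<lambda>x. \<bar>S x\<bar> * (LINT y|lborel. \<bar>D y\<bar>))"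
      by (simp add: abs_mult)
    then show "integrable lborel (\<lambda>x. LINT y|lborel. norm (S (fst (x, y)) * D (snd (x, y))))"
      using S by simp
  qed (use D in auto)
  have k: "integrable (lborel \<Otimes>\<^sub>M lborel) (case_prod k)"
    by (rule Bochner_Integration.integrable_bound[OF kS km]) (use kb in \<open>auto simp: split_beta\<close>)
  have inner1: "(LINT t|lborel. k x t) = S x * (\<phi> 1 - \<phi> x)" for x
  proof (cases "x \<in> {0..1}")
    case True
    have "(LINT t|lborel. k x t) = S x * (LINT t:{x..1}|lborel. \<phi>' t)"
      unfolding set_lebesgue_integral_def integral_mult_right_zero[symmetric]
      using True by (intro Bochner_Integration.integral_cong) (auto simp: k_def D_def indicator_def)
    also have "(LINT t:{x..1}|lborel. \<phi>' t) = \<phi> 1 - \<phi> x"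
    proof -
      have "(\<phi>' has_integral (\<phi> 1 - \<phi> x)) {x..1}"
        using True \<phi>(1)
        by (intro fundamental_theorem_of_calculus)
          (auto simp: has_real_derivative_iff_has_vector_derivative[symmetric] intro: has_field_derivative_at_within)
      then show ?thesis using set_borel_integral_eq_integral(2)[OF \<phi>'i, of x 1] by (simp add: integral_unique)
    qed
    finally show ?thesis .
  next
    case False
    then show ?thesis by (simp add: k_def S_def)
  qed
  have inner2: "(LINT x|lborel. k x t) = D t * prim s t" for t
  proof (cases "t \<in> {0..1}")
    case True
    have "(LINT x|lborel. k x t) = D t * (LINT x:{0..t}|lborel. s x)"
      unfolding set_lebesgue_integral_def integral_mult_right_zero[symmetric]
      using True by (intro Bochner_Integration.integral_cong) (auto simp: k_def S_def indicator_def)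
    then show ?thesis using True by (simp add: prim_def)
  next
    case False
    then show ?thesis by (simp add: k_def D_def)
  qed
  have "(LINT x|lborel. S x * (\<phi> 1 - \<phi> x)) = (LINT t|lborel. D t * prim s t)"
    using lborel_pair.Fubini_integral[OF k] inner1 inner2 by simp
  moreover have "(LINT x|lborel. S x * (\<phi> 1 - \<phi> x)) = prim s 1 * \<phi> 1 - (LINT x:{0..1}|lborel. s x * \<phi> x)"
  proof -
    have c: "continuous_on {0..1} \<phi>" using \<phi>(1) by (meson DERIV_atLeastAtMost_imp_continuous_on)
    have "(LINT x|lborel. S x * (\<phi> 1 - \<phi> x)) = (LINT x:{0..1}|lborel. s x * \<phi> 1 - s x * \<phi> x)"
      unfolding set_lebesgue_integral_def S_def by (auto intro!: Bochner_Integration.integral_cong simp: algebra_simps)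
    also have "\<dots> = (LINT x:{0..1}|lborel. s x * \<phi> 1) - (LINT x:{0..1}|lborel. s x * \<phi> x)"
      by (intro set_integral_diff set_integrable_cont_mult s c) auto
    finally show ?thesis by (simp add: prim_def)
  qed
  moreover have "(LINT t|lborel. D t * prim s t) = (LINT x:{0..1}|lborel. prim s x * \<phi>' x)"
    unfolding set_lebesgue_integral_def D_def by (auto intro!: Bochner_Integration.integral_cong simp: mult_ac)
  ultimately show ?thesis by simp
qed

lemma set_integral_Cauchy_Schwarz:
  fixes f g :: "real \<Rightarrow> real"
  assumes S: "S \<in> sets borel" and m: "f \<in> borel_measurable borel" "g \<in> borel_measurable borel"
    and i: "set_integrable lborel S (\<lambda>x. (f x)\<^sup>2)" "set_integrable lborel S (\<lambda>x. (g x)\<^sup>2)"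
  shows "set_integrable lborel S (\<lambda>x. f x * g x)"
    "\<bar>LINT x:S|lborel. f x * g x\<bar> \<le> sqrt (LINT x:S|lborel. (f x)\<^sup>2) * sqrt (LINT x:S|lborel. (g x)\<^sup>2)"
proof -
  have eq: "(indicator S x * h x)\<^sup>2 = indicator S x * (h x)\<^sup>2" for h :: "real \<Rightarrow> real" and x
    by (auto simp: indicator_def)
  have eq2: "(indicator S x * f x) * (indicator S x * g x) = indicator S x * (f x * g x)" for x
    by (auto simp: indicator_def)
  have sq: "square_integrable lborel (\<lambda>x. indicator S x * f x)" "square_integrable lborel (\<lambda>x. indicator S x * g x)"
    using S m i by (auto simp: square_integrable_def set_integrable_def eq)
  show "set_integrable lborel S (\<lambda>x. f x * g x)"
    using square_integrable_mult[OF sq] by (simp add: eq2 set_integrable_def)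
  show "\<bar>LINT x:S|lborel. f x * g x\<bar> \<le> sqrt (LINT x:S|lborel. (f x)\<^sup>2) * sqrt (LINT x:S|lborel. (g x)\<^sup>2)"
    using square_integrable_Cauchy_Schwarz[OF sq] by (simp add: eq eq2 set_lebesgue_integral_def)
qed

lemma periodic1_integral_le_unit:
  assumes f: "periodic1 f" "set_integrable lborel {0..1} f" "\<And>x. 0 \<le> f x" and "x \<le> y" "y - x \<le> 1"
  shows "(LINT t:{x..y}|lborel. f t) \<le> (LINT t:{0..1}|lborel. f t)"
proof -
  have i: "set_integrable lborel {a..b} f" for a b by (rule periodic1_set_integrable[OF f(1,2)])
  have "(LINT t:{x..x + 1}|lborel. f t) = (LINT t:{x..y}|lborel. f t) + (LINT t:{y..x + 1}|lborel. f t)"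
    using assms by (intro set_integral_combine i) auto
  moreover have "0 \<le> (LINT t:{y..x + 1}|lborel. f t)"
    using f(3) by (simp add: set_lebesgue_integral_def)
  ultimately show ?thesis using periodic1_integral_unit[OF f(1,2), of x] by simp
qed

subsection \<open>Regularity of the densities\<close>

context potential
begin

text \<open>If \<open>\<rho> \<rho>'\<close> has a continuous weak derivative, then it is continuously differentiable, also
  across the zeros of \<open>\<rho>\<close>.\<close>
lemma Tset_strong_form:
  assumes \<rho>: "periodic1 \<rho>" "\<And>x. (\<rho> has_real_derivative \<rho>' x) (at x)" "continuous_on UNIV \<rho>'"
    and \<rho>_nonneg: "\<And>x. 0 \<le> \<rho> x" and \<epsilon>: "0 < \<epsilon>"
    and g: "g \<in> Tset W W' \<epsilon> \<rho>"
  defines "s \<equiv> \<lambda>x. sqrt (\<rho> x) * g (frac x)"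
  obtains c where
    "\<And>x. ((\<lambda>x. \<rho> x * \<rho>' x) has_real_derivative
        (\<rho> x * W' (\<rho> x) - W (\<rho> x) + 3 * \<epsilon>\<^sup>2 / 2 * (\<rho>' x)\<^sup>2 - (prim s x - c)) / \<epsilon>\<^sup>2) (at x)"
    "periodic1 (prim s)"
    "(LINT x:{0..1}|lborel. prim s x - c) =
      (LINT x:{0..1}|lborel. \<rho> x * W' (\<rho> x) - W (\<rho> x) + 3 * \<epsilon>\<^sup>2 / 2 * (\<rho>' x)\<^sup>2)"
    "periodic1 s" "set_integrable lborel {0..1} s"
proof -
  have \<rho>c: "continuous_on A \<rho>" for A
    using \<rho>(2) by (meson DERIV_continuous continuous_at_imp_continuous_on)
  have \<rho>'c: "continuous_on A \<rho>'" for A using \<rho>(3) continuous_on_subset by blast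
  have \<rho>'p: "periodic1 \<rho>'" by (rule periodic1_deriv[OF \<rho>(1,2)])
  have Wc: "continuous_on A (\<lambda>x. W (\<rho> x))" "continuous_on A (\<lambda>x. W' (\<rho> x))" for A
    using \<rho>_nonneg by (auto intro!: continuous_on_compose2[OF W_cont \<rho>c] continuous_on_compose2[OF W'_cont \<rho>c])
  define A where "A x = \<rho> x * W' (\<rho> x) - W (\<rho> x) + 3 * \<epsilon>\<^sup>2 / 2 * (\<rho>' x)\<^sup>2" for x
  define B where "B x = \<rho> x * \<rho>' x" for x
  have Ac: "continuous_on S A" for S unfolding A_def by (intro continuous_intros Wc \<rho>c \<rho>'c)
  have Bc: "continuous_on S B" for S unfolding B_def by (intro continuous_intros \<rho>c \<rho>'c)
  have Ap: "periodic1 A" using \<rho>(1) \<rho>'p by (simp add: periodic1_def A_def)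
  have Bp: "periodic1 B" using \<rho>(1) \<rho>'p by (simp add: periodic1_def B_def)
  have gm: "g \<in> borel_measurable borel" and g2: "set_integrable lborel {0..1} (\<lambda>x. (g x)\<^sup>2)"
    using g by (auto simp: Tset_def)
  have gi: "set_integrable lborel {0..1} g"
    using set_integral_Cauchy_Schwarz(1)[of "{0..1}" g "\<lambda>_. 1"] gm g2 by (simp add: set_integrable_continuous)
  \<comment> \<open>Members of \<open>Tset\<close> are constrained on the unit interval only and
    need not be periodic. Composition with \<open>frac\<close> makes \<open>g\<close> periodic and
    changes it there at the single point 1.\<close>
  have ae1: "AE x in lborel. x \<in> {0..1} \<longrightarrow> g (frac x) = g x"
    using AE_lborel_singleton[of "1::real"] by eventually_elim (auto simp: frac_eq)
  have fracm: "(frac :: real \<Rightarrow> real) \<in> borel_measurable borel" unfolding frac_def[abs_def] by measurable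
  have gfm: "(\<lambda>x. g (frac x)) \<in> borel_measurable borel" using gm fracm by measurable
  have gfi: "set_integrable lborel {0..1} (\<lambda>x. g (frac x))"
    using gi unfolding set_integrable_def
    by (rule integrable_cong_AE_imp) (use gfm ae1 in \<open>auto elim!: eventually_mono simp: indicator_def\<close>)
  have s_int: "set_integrable lborel {0..1} s"
    unfolding s_def mult.commute[of "sqrt _"] by (intro set_integrable_cont_mult gfi continuous_intros \<rho>c)
  have s_per: "periodic1 s"
    using \<rho>(1) by (simp add: s_def periodic1_def frac_1_eq)
  have sI: "set_integrable lborel {a..b} s" for a b by (rule periodic1_set_integrable[OF s_per s_int])
  have s_eq: "(LINT x:{0..1}|lborel. sqrt (\<rho> x) * g x * \<phi> x) = (LINT x:{0..1}|lborel. s x * \<phi> x)"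
    if "continuous_on UNIV \<phi>" for \<phi>
  proof -
    have \<phi>m: "\<phi> \<in> borel_measurable borel" by (rule borel_measurable_continuous_onI[OF that])
    have \<rho>m: "\<rho> \<in> borel_measurable borel" by (rule borel_measurable_continuous_onI[OF \<rho>c])
    show ?thesis
      unfolding set_lebesgue_integral_def s_def
      by (intro integral_cong_AE) (use \<phi>m \<rho>m gm gfm ae1 in \<open>auto elim!: eventually_mono simp: indicator_def\<close>)
  qed
  have wd: "AE x in lborel. x \<in> {0..1} \<longrightarrow> wd \<rho> x = \<rho>' x"
    by (rule wd_AE[OF weak_deriv_C1[OF \<rho>]])
  have wd_int: "set_integrable lborel {0..1} (wd \<rho>)"
    using weak_deriv_wd[OF weak_deriv_C1[OF \<rho>]] by (simp add: weak_deriv_def)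
  \<comment> \<open>Nothing is known of \<open>wd \<rho>\<close> outside the unit interval, so only
    its product with the indicator is measurable.\<close>
  have wdm: "(\<lambda>x. indicator {0..1} x * wd \<rho> x) \<in> borel_measurable borel"
    using wd_int by (simp add: set_integrable_def)
  have weak: "- (LINT x:{0..1}|lborel. A x * deriv \<phi> x) - \<epsilon>\<^sup>2 * (LINT x:{0..1}|lborel. B x * deriv (deriv \<phi>) x)
      = (LINT x:{0..1}|lborel. s x * \<phi> x)" if \<phi>: "test_fun \<phi>" for \<phi>
  proof -
    have d1: "deriv \<phi> \<in> borel_measurable borel" "deriv (deriv \<phi>) \<in> borel_measurable borel"
      using \<phi> by (auto intro!: borel_measurable_continuous_onI test_fun_continuous test_fun_deriv)
    have m: "\<rho> \<in> borel_measurable borel" "\<rho>' \<in> borel_measurable borel"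
      "(\<lambda>x. \<rho> x * W' (\<rho> x) - W (\<rho> x)) \<in> borel_measurable borel"
      by (intro borel_measurable_continuous_onI continuous_intros Wc \<rho>c \<rho>'c)+
    have 1: "(LINT x:{0..1}|lborel. (\<rho> x * W' (\<rho> x) - W (\<rho> x) + 3 * \<epsilon>\<^sup>2 / 2 * (wd \<rho> x)\<^sup>2) * deriv \<phi> x)
        = (LINT x:{0..1}|lborel. A x * deriv \<phi> x)"
      unfolding set_lebesgue_integral_def
    proof (rule integral_cong_AE)
      have "(\<lambda>x. (indicator {0..1} x * (\<rho> x * W' (\<rho> x) - W (\<rho> x)) + 3 * \<epsilon>\<^sup>2 / 2 * (indicator {0..1} x * wd \<rho> x)\<^sup>2) * deriv \<phi> x)
          \<in> borel_measurable lborel"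
        using d1 m wdm by measurable
      moreover have "(\<lambda>x. (indicator {0..1} x * (\<rho> x * W' (\<rho> x) - W (\<rho> x)) + 3 * \<epsilon>\<^sup>2 / 2 * (indicator {0..1} x * wd \<rho> x)\<^sup>2) * deriv \<phi> x)
          = (\<lambda>x. indicator {0..1} x *\<^sub>R ((\<rho> x * W' (\<rho> x) - W (\<rho> x) + 3 * \<epsilon>\<^sup>2 / 2 * (wd \<rho> x)\<^sup>2) * deriv \<phi> x))"
        by (auto simp: indicator_def)
      ultimately show "(\<lambda>x. indicator {0..1} x *\<^sub>R ((\<rho> x * W' (\<rho> x) - W (\<rho> x) + 3 * \<epsilon>\<^sup>2 / 2 * (wd \<rho> x)\<^sup>2) * deriv \<phi> x)) \<in> borel_measurable lborel"
        by simp
      have "A \<in> borel_measurable borel" by (rule borel_measurable_continuous_onI[OF Ac])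
      then show "(\<lambda>x. indicator {0..1} x *\<^sub>R (A x * deriv \<phi> x)) \<in> borel_measurable lborel"
        using d1 by measurable
    qed (use wd in \<open>auto elim!: eventually_mono simp: indicator_def A_def\<close>)
    have 2: "(LINT x:{0..1}|lborel. \<rho> x * wd \<rho> x * deriv (deriv \<phi>) x) = (LINT x:{0..1}|lborel. B x * deriv (deriv \<phi>) x)"
      unfolding set_lebesgue_integral_def
    proof (rule integral_cong_AE)
      have "(\<lambda>x. \<rho> x * (indicator {0..1} x * wd \<rho> x) * deriv (deriv \<phi>) x) \<in> borel_measurable lborel"
        using d1 m wdm by measurable
      then show "(\<lambda>x. indicator {0..1} x *\<^sub>R (\<rho> x * wd \<rho> x * deriv (deriv \<phi>) x)) \<in> borel_measurable lborel"
        by (simp add: mult_ac)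
      have "B \<in> borel_measurable borel" by (rule borel_measurable_continuous_onI[OF Bc])
      then show "(\<lambda>x. indicator {0..1} x *\<^sub>R (B x * deriv (deriv \<phi>) x)) \<in> borel_measurable lborel"
        using d1 by measurable
    qed (use wd in \<open>auto elim!: eventually_mono simp: indicator_def B_def\<close>)
    show ?thesis
      using g \<phi> s_eq[OF test_fun_continuous[OF \<phi>]] unfolding Tset_def 1[symmetric] 2[symmetric] by (simp only: mem_Collect_eq)
  qed
  have d0: "deriv (\<lambda>_::real. c::real) = (\<lambda>_. 0)" for c by (rule deriv_eqI) auto
  \<comment> \<open>A constant test function shows that \<open>s\<close> has mean zero; hence its
    primitive \<open>P\<close> is periodic.\<close>
  have s_zero: "(LINT x:{0..1}|lborel. s x) = 0"
    using weak[OF test_fun_const[of 1]] by (simp add: d0 set_lebesgue_integral_def)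
  define P where "P = prim s"
  have P1: "P 1 = 0" using s_zero by (simp add: P_def prim_def)
  have Pp: "periodic1 P" unfolding P_def by (rule prim_periodic[OF s_per s_int s_zero])
  have Pc: "continuous_on S P" for S
    using prim_continuous[OF sI] continuous_on_subset unfolding P_def by blast
  have parts: "(LINT x:{0..1}|lborel. s x * \<phi> x) = - (LINT x:{0..1}|lborel. P x * deriv \<phi> x)" if \<phi>: "test_fun \<phi>" for \<phi>
    using integral_by_parts_prim[OF sI test_fun_differentiable[OF \<phi>] test_fun_continuous[OF test_fun_deriv[OF \<phi>]]] P1
    by (simp add: P_def)
  have i: "set_integrable lborel {0..1} (\<lambda>x. f x * h x)" if "continuous_on UNIV f" "continuous_on UNIV h" for f h :: "real \<Rightarrow> real"
    by (intro set_integrable_continuous continuous_intros) (use that continuous_on_subset in blast)+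
  have i1: "set_integrable lborel {0..1} f" if "continuous_on UNIV f" for f :: "real \<Rightarrow> real"
    using i[OF that continuous_on_const[of _ 1]] by simp
  have one: "(LINT x:{0..1::real}|lborel. c) = c" for c :: real
    by (simp add: set_lebesgue_integral_def)
  \<comment> \<open>The constant of integration of the flux \<open>P - c\<close>, chosen so that
    \<open>K = P - A - c\<close> has mean zero and a periodic primitive.\<close>
  define c where "c = (LINT x:{0..1}|lborel. P x - A x)"
  define K where "K x = P x - A x - c" for x
  have Kc: "continuous_on S K" for S unfolding K_def by (intro continuous_intros Pc Ac)
  have Kp: "periodic1 K" using Pp Ap by (simp add: periodic1_def K_def)
  have PAc: "continuous_on S (\<lambda>x. P x - A x)" for S by (intro continuous_intros Pc Ac)
  have K0: "(LINT x:{0..1}|lborel. K x) = 0"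
    unfolding K_def using set_integral_diff(2)[OF i1[OF PAc] i1[OF continuous_on_const[of _ c]]] by (simp add: one c_def[symmetric])
  \<comment> \<open>After integration by parts the equation involves only
    \<open>deriv \<phi>\<close>. A function is the derivative of a test function as soon as it is a
    test function with its mean removed.\<close>
  have mean_free: "\<exists>\<phi>. test_fun \<phi> \<and> deriv \<phi> = (\<lambda>x. \<psi> x - (LINT x:{0..1}|lborel. \<psi> x)) \<and> deriv (deriv \<phi>) = deriv \<psi>"
    if \<psi>: "test_fun \<psi>" for \<psi>
  proof -
    define m where "m = (LINT x:{0..1}|lborel. \<psi> x)"
    define \<omega> where "\<omega> x = \<psi> x - m" for x
    have \<omega>: "test_fun \<omega>"
      using test_fun_lincomb[OF \<psi> test_fun_const[of 1], of 1 "- m"] by (simp add: \<omega>_def[abs_def])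
    have \<omega>c: "continuous_on UNIV \<omega>" by (rule test_fun_continuous[OF \<omega>])
    have "(LINT x:{0..1}|lborel. \<omega> x) = 0"
      unfolding \<omega>_def using set_integral_diff(2)[OF i1[OF test_fun_continuous[OF \<psi>]] i1[OF continuous_on_const[of _ m]]]
      by (simp add: one m_def[symmetric])
    then have "periodic1 (prim \<omega>)"
      by (intro prim_periodic test_fun_periodic[OF \<omega>] i1 \<omega>c)
    then have "test_fun (prim \<omega>)"
      using prim_deriv[OF \<omega>c] \<omega> by (rule test_fun_of_deriv)
    moreover have "deriv (prim \<omega>) = \<omega>" by (rule deriv_eqI[OF prim_deriv[OF \<omega>c]])
    moreover have "deriv \<omega> = deriv \<psi>"
      by (rule deriv_eqI) (auto simp: \<omega>_def[abs_def] intro!: derivative_eq_intros test_fun_differentiable[OF \<psi>])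
    ultimately show ?thesis unfolding \<omega>_def m_def by metis
  qed
  have ortho: "(LINT x:{0..1}|lborel. f x * (\<psi> x - (LINT x:{0..1}|lborel. \<psi> x))) = (LINT x:{0..1}|lborel. (f x - (LINT x:{0..1}|lborel. f x)) * \<psi> x)"
    if "continuous_on UNIV f" "continuous_on UNIV \<psi>" for f \<psi> :: "real \<Rightarrow> real"
    using i[OF that] i1[OF that(1)] i1[OF that(2)]
    by (simp add: left_diff_distrib right_diff_distrib set_integral_diff)
  have KB: "(LINT x:{0..1}|lborel. K x * \<psi> x) = \<epsilon>\<^sup>2 * (LINT x:{0..1}|lborel. B x * deriv \<psi> x)" if \<psi>: "test_fun \<psi>" for \<psi>
  proof -
    obtain \<phi> where \<phi>: "test_fun \<phi>" "deriv \<phi> = (\<lambda>x. \<psi> x - (LINT x:{0..1}|lborel. \<psi> x))" "deriv (deriv \<phi>) = deriv \<psi>"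
      using mean_free[OF \<psi>] by blast
    have dc: "continuous_on UNIV (deriv \<phi>)" by (intro test_fun_continuous test_fun_deriv \<phi>(1))
    have "(LINT x:{0..1}|lborel. P x * deriv \<phi> x) - (LINT x:{0..1}|lborel. A x * deriv \<phi> x)
        = \<epsilon>\<^sup>2 * (LINT x:{0..1}|lborel. B x * deriv (deriv \<phi>) x)"
      using weak[OF \<phi>(1)] parts[OF \<phi>(1)] by simp
    then have "(LINT x:{0..1}|lborel. (P x - A x) * deriv \<phi> x) = \<epsilon>\<^sup>2 * (LINT x:{0..1}|lborel. B x * deriv (deriv \<phi>) x)"
      using set_integral_diff(2)[OF i[OF Pc dc] i[OF Ac dc]] by (simp add: left_diff_distrib)
    then show ?thesis
      using ortho[OF PAc test_fun_continuous[OF \<psi>]] unfolding \<phi>(3) unfolding \<phi>(2) K_def c_def by simp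
  qed
  define S where "S = prim K"
  have S_deriv: "(S has_real_derivative K x) (at x)" for x unfolding S_def by (rule prim_deriv[OF Kc])
  have Sp: "periodic1 S" unfolding S_def by (intro prim_periodic Kp K0 i1 Kc)
  have Sc: "continuous_on T S" for T using S_deriv by (meson DERIV_continuous continuous_at_imp_continuous_on)
  \<comment> \<open>The equation says that \<open>R\<close> has zero weak derivative. A continuous
    \<open>R\<close> is then constant, which expresses \<open>\<rho> \<rho>'\<close> through the
    continuously differentiable \<open>S\<close>.\<close>
  define R where "R x = \<epsilon>\<^sup>2 * B x + S x" for x
  have Rc: "continuous_on T R" for T unfolding R_def by (intro continuous_intros Bc Sc)
  have Rp: "periodic1 R" using Bp Sp by (simp add: periodic1_def R_def)
  have R_orth: "(LINT x:{0..1}|lborel. R x * deriv \<psi> x) = 0" if \<psi>: "test_fun \<psi>" for \<psi>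
  proof -
    have dc: "continuous_on UNIV (deriv \<psi>)" by (intro test_fun_continuous test_fun_deriv \<psi>)
    have "(LINT x:{0..1}|lborel. S x * deriv \<psi> x) = - (LINT x:{0..1}|lborel. K x * \<psi> x)"
      by (rule integral_product_rule_periodic[OF S_deriv Kc Sp test_fun_differentiable[OF \<psi>] dc test_fun_periodic[OF \<psi>]])
    moreover have "(LINT x:{0..1}|lborel. R x * deriv \<psi> x)
        = \<epsilon>\<^sup>2 * (LINT x:{0..1}|lborel. B x * deriv \<psi> x) + (LINT x:{0..1}|lborel. S x * deriv \<psi> x)"
    proof -
      have "(LINT x:{0..1}|lborel. R x * deriv \<psi> x) = (LINT x:{0..1}|lborel. \<epsilon>\<^sup>2 * (B x * deriv \<psi> x) + S x * deriv \<psi> x)"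
        by (simp add: R_def algebra_simps)
      also have "\<dots> = (LINT x:{0..1}|lborel. \<epsilon>\<^sup>2 * (B x * deriv \<psi> x)) + (LINT x:{0..1}|lborel. S x * deriv \<psi> x)"
        by (intro set_integral_add set_integrable_mult_right i Bc Sc dc)
      finally show ?thesis by simp
    qed
    ultimately show ?thesis using KB[OF \<psi>] by simp
  qed
  define r where "r = (LINT x:{0..1}|lborel. R x)"
  have "R x - r = 0" for x
  proof (rule fundamental_lemma_continuous[where f = "\<lambda>x. R x - r"])
    show "continuous_on UNIV (\<lambda>x. R x - r)" by (intro continuous_intros Rc)
    show "periodic1 (\<lambda>x. R x - r)" using Rp by (simp add: periodic1_def)
    fix \<psi> assume \<psi>: "test_fun \<psi>"
    obtain \<phi> where \<phi>: "test_fun \<phi>" "deriv \<phi> = (\<lambda>x. \<psi> x - (LINT x:{0..1}|lborel. \<psi> x))"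
      using mean_free[OF \<psi>] by blast
    show "(LINT x:{0..1}|lborel. (R x - r) * \<psi> x) = 0"
      using R_orth[OF \<phi>(1)] ortho[OF Rc test_fun_continuous[OF \<psi>]] by (simp add: \<phi>(2) r_def)
  qed
  then have B_eq: "B = (\<lambda>x. (r - S x) / \<epsilon>\<^sup>2)"
    using \<epsilon> by (auto simp: R_def field_simps)
  have B_deriv: "(B has_real_derivative (A x - (P x - c)) / \<epsilon>\<^sup>2) (at x)" for x
  proof -
    have "((\<lambda>x. (r - S x) / \<epsilon>\<^sup>2) has_real_derivative (0 - K x) / \<epsilon>\<^sup>2) (at x)"
      by (intro DERIV_cdivide DERIV_diff DERIV_const S_deriv)
    then show ?thesis unfolding B_eq by (simp add: K_def algebra_simps)
  qed
  have mean: "(LINT x:{0..1}|lborel. P x - c) = (LINT x:{0..1}|lborel. A x)"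
  proof -
    have "continuous_on UNIV (\<lambda>x. P x - c)" by (intro continuous_intros Pc)
    from set_integral_diff(2)[OF i1[OF this] i1[OF Ac]] K0
    show ?thesis by (simp add: K_def algebra_simps)
  qed
  show ?thesis
    by (rule that[of c]) (use B_deriv Pp mean s_per s_int in \<open>simp_all only: A_def B_def[abs_def] P_def\<close>)
qed

end

subsection \<open>Local analysis of a single profile\<close>

text \<open>Adding \<open>k / 2 * x^2\<close> makes \<open>f\<close> concave; the claim is midpoint
  concavity of the sum.\<close>

lemma second_difference_le:
  fixes f :: "real \<Rightarrow> real"
  assumes f: "\<And>x. x \<in> {m - h..m + h} \<Longrightarrow> (f has_real_derivative f' x) (at x)"
    and f': "\<And>x. x \<in> {m - h..m + h} \<Longrightarrow> (f' has_real_derivative f'' x) (at x)"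
    and f'': "\<And>x. x \<in> {m - h..m + h} \<Longrightarrow> f'' x \<le> - k"
    and h: "0 \<le> h"
  shows "f (m - h) + f (m + h) - 2 * f m \<le> - k * h\<^sup>2"
proof -
  have "concave_on {m - h..m + h} (\<lambda>x. f x + k / 2 * x\<^sup>2)"
  proof (rule f''_le0_imp_concave[where f' = "\<lambda>x. f' x + k * x" and f'' = "\<lambda>x. f'' x + k"])
    fix x assume x: "x \<in> {m - h..m + h}"
    show "((\<lambda>x. f x + k / 2 * x\<^sup>2) has_real_derivative f' x + k * x) (at x)"
      using f[OF x] by (auto intro!: derivative_eq_intros)
    show "((\<lambda>x. f' x + k * x) has_real_derivative f'' x + k) (at x)"
      using f'[OF x] by (auto intro!: derivative_eq_intros)
    show "f'' x + k \<le> 0" using f''[OF x] by simp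
  qed simp
  then have c: "(1 - 1/2) * (f (m - h) + k / 2 * (m - h)\<^sup>2) + 1/2 * (f (m + h) + k / 2 * (m + h)\<^sup>2)
      \<le> f ((1 - 1/2) *\<^sub>R (m - h) + (1/2) *\<^sub>R (m + h)) + k / 2 * ((1 - 1/2) *\<^sub>R (m - h) + (1/2) *\<^sub>R (m + h))\<^sup>2"
    using h by (intro concave_onD) auto
  have "(1 - 1/2) *\<^sub>R (m - h) + (1/2) *\<^sub>R (m + h) = m" by (simp add: field_simps)
  from c[unfolded this] show ?thesis by (simp add: power2_eq_square algebra_simps)
qed

text \<open>Serves to shorten a window so that the function stays above the cut-off: the new end is
  either the old one or a point exactly at the cut-off level.\<close>

lemma last_crossing:
  fixes f :: "real \<Rightarrow> real"
  assumes f: "continuous_on UNIV f" and ab: "a \<le> b" and fb: "\<delta> < f b"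
  obtains \<alpha> where "a \<le> \<alpha>" "\<alpha> \<le> b" "\<And>t. \<alpha> \<le> t \<Longrightarrow> t \<le> b \<Longrightarrow> \<delta> \<le> f t" "\<alpha> = a \<or> f \<alpha> = \<delta>"
proof (cases "\<exists>t\<in>{a..b}. f t \<le> \<delta>")
  case False
  then show ?thesis using ab by (intro that[of a]) (auto simp: not_le less_imp_le)
next
  case True
  define S where "S = {a..b} \<inter> f -` {..\<delta>}"
  have "closed (f -` {..\<delta>})" using f by (intro closed_vimage) auto
  then have "compact S" unfolding S_def by (intro compact_Int_closed) auto
  moreover have "S \<noteq> {}" using True by (auto simp: S_def)
  ultimately obtain \<alpha> where \<alpha>: "\<alpha> \<in> S" "\<And>t. t \<in> S \<Longrightarrow> t \<le> \<alpha>"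
    using compact_attains_sup by metis
  have \<alpha>': "a \<le> \<alpha>" "\<alpha> \<le> b" "f \<alpha> \<le> \<delta>" using \<alpha>(1) by (auto simp: S_def)
  have above: "\<delta> < f t" if "\<alpha> < t" "t \<le> b" for t
    using \<alpha>(2)[of t] that \<alpha>' by (force simp: S_def)
  have "\<delta> \<le> f \<alpha>"
  proof (rule ccontr)
    assume "\<not> \<delta> \<le> f \<alpha>"
    then obtain t where "\<alpha> \<le> t" "t \<le> b" "f t = (f \<alpha> + \<delta>) / 2"
      using IVT'[of f \<alpha> "(f \<alpha> + \<delta>) / 2" b] fb \<alpha>' continuous_on_subset[OF f] by auto
    then show False using above[of t] \<open>\<not> \<delta> \<le> f \<alpha>\<close> by (cases "t = \<alpha>") auto
  qed
  then have "f \<alpha> = \<delta>" using \<alpha>' by simp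
  then show ?thesis using \<alpha>' above by (intro that[of \<alpha>]) (auto simp: le_less)
qed

lemma first_crossing:
  fixes f :: "real \<Rightarrow> real"
  assumes f: "continuous_on UNIV f" and ab: "a \<le> b" and fa: "\<delta> < f a"
  obtains \<beta> where "a \<le> \<beta>" "\<beta> \<le> b" "\<And>t. a \<le> t \<Longrightarrow> t \<le> \<beta> \<Longrightarrow> \<delta> \<le> f t" "\<beta> = b \<or> f \<beta> = \<delta>"
proof -
  have c: "continuous_on UNIV (\<lambda>t. f (- t))"
    by (rule continuous_on_compose2[OF f]) (auto intro: continuous_intros)
  obtain \<alpha> where \<alpha>: "- b \<le> \<alpha>" "\<alpha> \<le> - a" "\<And>t. \<alpha> \<le> t \<Longrightarrow> t \<le> - a \<Longrightarrow> \<delta> \<le> f (- t)" "\<alpha> = - b \<or> f (- \<alpha>) = \<delta>"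
    by (rule last_crossing[OF c, of "- b" "- a" \<delta>]) (use ab fa that in auto)
  show ?thesis
  proof (rule that[of "- \<alpha>"])
    fix t assume "a \<le> t" "t \<le> - \<alpha>"
    then show "\<delta> \<le> f t" using \<alpha>(3)[of "- t"] by simp
  qed (use \<alpha> in auto)
qed

text \<open>\<open>G\<close> is the momentum flux and \<open>H\<close> a primitive of the modulus of
  its derivative, so increments of \<open>H\<close> bound those of \<open>G\<close> and add up over
  adjacent intervals. The equation is kept for \<open>u * u'\<close> because \<open>u'\<close> need
  not be differentiable at zeros of \<open>u\<close>.\<close>

locale profile = potential +
  fixes \<epsilon> K M :: real and u u' G H :: "real \<Rightarrow> real"
  assumes eps: "0 < \<epsilon>"
    and u_deriv: "\<And>x. (u has_real_derivative u' x) (at x)"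
    and u'_cont: "continuous_on UNIV u'"
    and u_nonneg: "\<And>x. 0 \<le> u x" and u_le: "\<And>x. u x \<le> M"
    and uu'_deriv: "\<And>x. ((\<lambda>x. u x * u' x) has_real_derivative
        (u x * W' (u x) - W (u x) + 3 * \<epsilon>\<^sup>2 / 2 * (u' x)\<^sup>2 - G x) / \<epsilon>\<^sup>2) (at x)"
    and G_H: "\<And>x y. x \<le> y \<Longrightarrow> \<bar>G y - G x\<bar> \<le> H y - H x"
    and H_holder: "\<And>x y. x \<le> y \<Longrightarrow> y - x \<le> 1 \<Longrightarrow> H y - H x \<le> K * sqrt (y - x)"
begin

lemma u_cont: "continuous_on A u"
  using u_deriv by (meson DERIV_continuous continuous_at_imp_continuous_on)

lemma K_nonneg: "0 \<le> K"
  using G_H[of 0 1] H_holder[of 0 1] by simp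

lemma M_nonneg: "0 \<le> M"
  using u_nonneg[of 0] u_le[of 0] by simp

lemma G_holder: "\<bar>y - x\<bar> \<le> 1 \<Longrightarrow> \<bar>G y - G x\<bar> \<le> K * sqrt \<bar>y - x\<bar>"
  using G_H[of x y] G_H[of y x] H_holder[of x y] H_holder[of y x] by (cases "x \<le> y") (auto simp: abs_minus_commute)

lemma G_near:
  assumes "0 < e"
  obtains d where "0 < d" "\<And>x y. \<bar>y - x\<bar> < d \<Longrightarrow> \<bar>G y - G x\<bar> \<le> e"
proof
  define d where "d = min 1 ((e / (K + 1))\<^sup>2)"
  show "0 < d" using assms K_nonneg by (auto simp: d_def)
  fix x y assume xy: "\<bar>y - x\<bar> < d"
  have "sqrt \<bar>y - x\<bar> \<le> e / (K + 1)"
    using xy assms K_nonneg by (intro real_le_lsqrt) (auto simp: d_def)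
  then have "K * sqrt \<bar>y - x\<bar> \<le> K * (e / (K + 1))" using K_nonneg by (intro mult_left_mono)
  also have "\<dots> \<le> e" using K_nonneg assms by (simp add: field_simps)
  finally show "\<bar>G y - G x\<bar> \<le> e" using G_holder[of y x] xy by (simp add: d_def)
qed

text \<open>At a zero both \<open>u\<close> and \<open>u'\<close> vanish, so \<open>u u' = o(x - z)\<close>.\<close>
lemma G_zero: assumes z: "u z = 0" shows "G z = 0"
proof -
  have u'z: "u' z = 0"
    using DERIV_local_min[OF u_deriv[of z], of 1] u_nonneg z by auto
  have "((\<lambda>x. u' x * ((u x - u z) / (x - z))) \<longlongrightarrow> u' z * u' z) (at z)"
    using u'_cont u_deriv[of z]
    by (intro tendsto_mult) (auto simp: continuous_on_eq_continuous_at isCont_def has_field_derivative_iff)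
  moreover have "((\<lambda>x. (u x * u' x - u z * u' z) / (x - z)) \<longlongrightarrow>
      (u z * W' (u z) - W (u z) + 3 * \<epsilon>\<^sup>2 / 2 * (u' z)\<^sup>2 - G z) / \<epsilon>\<^sup>2) (at z)"
    using uu'_deriv[of z] by (simp add: has_field_derivative_iff)
  then have "((\<lambda>x. u' x * ((u x - u z) / (x - z))) \<longlongrightarrow> - G z / \<epsilon>\<^sup>2) (at z)"
    using u'z W0 z by (simp add: mult.commute)
  ultimately have "- G z / \<epsilon>\<^sup>2 = u' z * u' z"
    using tendsto_unique[of "at z"] by (auto simp: trivial_limit_at)
  then show ?thesis using u'z eps by simp
qed

text \<open>Obtained from \<open>(u u')' = u u'' + u'^2\<close> where \<open>u\<close> is positive;
  the subtraction turns the coefficient 3/2 of the kinetic term into 1/2.\<close>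

definition u'' where "u'' x = (u x * W' (u x) - W (u x) + \<epsilon>\<^sup>2 / 2 * (u' x)\<^sup>2 - G x) / (\<epsilon>\<^sup>2 * u x)"

lemma u'_deriv: assumes x: "0 < u x" shows "(u' has_real_derivative u'' x) (at x)"
proof -
  have e: "\<epsilon>\<^sup>2 \<noteq> 0" using eps by simp
  define B' where "B' = (u x * W' (u x) - W (u x) + 3 * \<epsilon>\<^sup>2 / 2 * (u' x)\<^sup>2 - G x) / \<epsilon>\<^sup>2"
  have B': "((\<lambda>x. u x * u' x) has_real_derivative B') (at x)"
    unfolding B'_def by (rule uu'_deriv)
  have "((\<lambda>x. (u x * u' x) / u x) has_real_derivative (B' * u x - (u x * u' x) * u' x) / (u x * u x)) (at x)"
    using x by (intro DERIV_divide B' u_deriv) auto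
  also have "(B' * u x - (u x * u' x) * u' x) / (u x * u x) = (B' - (u' x)\<^sup>2) / u x"
    using x by (simp add: field_simps power2_eq_square)
  also have "B' - (u' x)\<^sup>2 = (u x * W' (u x) - W (u x) + \<epsilon>\<^sup>2 / 2 * (u' x)\<^sup>2 - G x) / \<epsilon>\<^sup>2"
    unfolding B'_def using e by (simp add: field_simps)
  also have "\<dots> / u x = u'' x" by (simp add: u''_def)
  finally have "((\<lambda>x. (u x * u' x) / u x) has_real_derivative u'' x) (at x)" .
  moreover have "open {x. 0 < u x}" using u_cont by (intro open_Collect_less) auto
  ultimately show ?thesis
    by (rule has_field_derivative_transform_within_open) (use x in auto)
qed

text \<open>The chemical potential \<open>W'(u) - \<epsilon>^2 u''\<close>, rewritten through the
  energy relation so that only first derivatives of \<open>u\<close> occur.\<close>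

definition \<mu> where "\<mu> x = (G x + W (u x) - \<epsilon>\<^sup>2 / 2 * (u' x)\<^sup>2) / u x"

lemma energy: "0 < u x \<Longrightarrow> W (u x) = \<mu> x * u x - G x + \<epsilon>\<^sup>2 / 2 * (u' x)\<^sup>2"
  by (simp add: \<mu>_def)

lemma u''_\<mu>: "0 < u x \<Longrightarrow> \<epsilon>\<^sup>2 * u'' x = W' (u x) - \<mu> x"
  using eps by (simp add: \<mu>_def u''_def field_simps)

text \<open>With a constant \<open>g\<close> in place of \<open>G\<close> all terms of the equation
  cancel except the discrepancy \<open>G x - g\<close>, which is small on short intervals.\<close>

lemma frozen_\<mu>_deriv:
  assumes x: "0 < u x"
  shows "((\<lambda>x. (g + W (u x) - \<epsilon>\<^sup>2 / 2 * (u' x)\<^sup>2) / u x) has_real_derivative u' x * (G x - g) / (u x)\<^sup>2) (at x)"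
proof -
  have "((\<lambda>x. W (u x)) has_real_derivative W' (u x) * u' x) (at x)"
    by (rule DERIV_chain2[OF W_deriv_at[OF x] u_deriv])
  then have "((\<lambda>x. (g + W (u x) - \<epsilon>\<^sup>2 / 2 * (u' x)\<^sup>2) / u x) has_real_derivative
      ((W' (u x) * u' x - \<epsilon>\<^sup>2 * (u' x * u'' x)) * u x - (g + W (u x) - \<epsilon>\<^sup>2 / 2 * (u' x)\<^sup>2) * u' x) / (u x * u x)) (at x)"
    using x u'_deriv[OF x] u_deriv by (auto intro!: derivative_eq_intros)
  also have "(W' (u x) * u' x - \<epsilon>\<^sup>2 * (u' x * u'' x)) * u x - (g + W (u x) - \<epsilon>\<^sup>2 / 2 * (u' x)\<^sup>2) * u' x
      = u' x * (W' (u x) * u x - (\<epsilon>\<^sup>2 * u'' x) * u x - (g + W (u x) - \<epsilon>\<^sup>2 / 2 * (u' x)\<^sup>2))"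
    by (simp add: algebra_simps)
  also have "(\<epsilon>\<^sup>2 * u'' x) * u x = u x * W' (u x) - W (u x) + \<epsilon>\<^sup>2 / 2 * (u' x)\<^sup>2 - G x"
    using x eps by (simp add: u''_def)
  finally show ?thesis by (simp add: power2_eq_square algebra_simps)
qed

text \<open>Formally \<open>\<mu>' = G' / u\<close>; as \<open>G\<close> is not differentiable, it is frozen on short intervals.\<close>
lemma \<mu>_oscillation:
  assumes xy: "x \<le> y" and \<delta>: "0 < \<delta>" "\<And>t. x \<le> t \<Longrightarrow> t \<le> y \<Longrightarrow> \<delta> \<le> u t"
  shows "\<bar>\<mu> y - \<mu> x\<bar> \<le> (H y - H x) / \<delta>"
proof -
  have "bounded (u' ` {x..y})"
    using u'_cont continuous_on_subset by (blast intro: compact_imp_bounded compact_continuous_image)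
  then obtain L0 where L0: "\<forall>v\<in>u' ` {x..y}. norm v \<le> L0" unfolding bounded_iff by blast
  define L where "L = \<bar>L0\<bar> + 1"
  have L: "L > 0" "\<And>t. x \<le> t \<Longrightarrow> t \<le> y \<Longrightarrow> \<bar>u' t\<bar> \<le> L" using L0 by (force simp: L_def)+
  \<comment> \<open>An estimate that is additive in the interval, with a slack \<open>\<eta>\<close>
    per unit length. By Bolzano's bisection principle it only has to be checked on short
    intervals.\<close>
  define P where "P \<eta> a b \<longleftrightarrow> (x \<le> a \<and> b \<le> y \<longrightarrow> \<bar>\<mu> b - \<mu> a\<bar> \<le> (H b - H a) / \<delta> + \<eta> * (b - a))" for \<eta> a b
  have approx: "P \<eta> x y" if \<eta>: "\<eta> > 0" for \<eta>
    using xy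
  proof (induction rule: Bolzano)
    case (trans a b c)
    show ?case
      unfolding P_def
    proof
      assume ac: "x \<le> a \<and> c \<le> y"
      then have "\<bar>\<mu> b - \<mu> a\<bar> \<le> (H b - H a) / \<delta> + \<eta> * (b - a)" "\<bar>\<mu> c - \<mu> b\<bar> \<le> (H c - H b) / \<delta> + \<eta> * (c - b)"
        using trans by (auto simp: P_def)
      then have "\<bar>\<mu> c - \<mu> a\<bar> \<le> (H b - H a) / \<delta> + \<eta> * (b - a) + ((H c - H b) / \<delta> + \<eta> * (c - b))" by linarith
      also have "\<dots> = (H c - H a) / \<delta> + \<eta> * (c - a)" by (simp add: algebra_simps diff_divide_distrib)
      finally show "\<bar>\<mu> c - \<mu> a\<bar> \<le> (H c - H a) / \<delta> + \<eta> * (c - a)" .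
    qed
  next
    case (local z)
    define e where "e = \<eta> * \<delta>\<^sup>2 / L"
    have e: "e > 0" using \<eta> \<delta> L by (simp add: e_def)
    obtain d where d: "0 < d" "\<And>s t. \<bar>t - s\<bar> < d \<Longrightarrow> \<bar>G t - G s\<bar> \<le> e" by (rule G_near[OF e]) (rule that)
    have "\<bar>\<mu> b - \<mu> a\<bar> \<le> (H b - H a) / \<delta> + \<eta> * (b - a)"
      if az: "a \<le> z" "z \<le> b" "b - a < d" and ac: "x \<le> a" "b \<le> y" for a b
    proof -
      define \<nu> where "\<nu> t = (G z + W (u t) - \<epsilon>\<^sup>2 / 2 * (u' t)\<^sup>2) / u t" for t
      have pos2: "\<delta> \<le> u t" if "a \<le> t" "t \<le> b" for t
        by (rule \<delta>(2)[OF order_trans[OF ac(1) that(1)] order_trans[OF that(2) ac(2)]])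
      have pos1: "0 < u t" if "a \<le> t" "t \<le> b" for t
        using pos2[OF that] \<delta>(1) by linarith
      have mid: "norm (\<nu> b - \<nu> a) \<le> \<eta> * norm (b - a)"
      proof (rule field_differentiable_bound[where S = "{a..b}" and f' = "\<lambda>t. u' t * (G t - G z) / (u t)\<^sup>2"])
        fix t assume t: "t \<in> {a..b}"
        show "(\<nu> has_real_derivative u' t * (G t - G z) / (u t)\<^sup>2) (at t within {a..b})"
          unfolding \<nu>_def[abs_def] using t
          by (intro has_field_derivative_at_within[OF frozen_\<mu>_deriv] pos1) simp_all
        have tz: "\<bar>t - z\<bar> < d" using t az unfolding atLeastAtMost_iff by linarith
        have txy: "x \<le> t" "t \<le> y" using t ac unfolding atLeastAtMost_iff by linarith+
        have "\<bar>u' t\<bar> * \<bar>G t - G z\<bar> \<le> L * e"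
          by (rule mult_mono[OF L(2)[OF txy] d(2)[OF tz]]) (use L(1) in simp_all)
        also have "\<dots> = \<eta> * \<delta>\<^sup>2" using L by (simp add: e_def)
        also have "\<dots> \<le> \<eta> * (u t)\<^sup>2"
          using pos2[of t] t \<eta> \<delta>(1) by (intro mult_left_mono power_mono) simp_all
        finally have le: "\<bar>u' t\<bar> * \<bar>G t - G z\<bar> \<le> \<eta> * (u t)\<^sup>2" .
        have "0 < (u t)\<^sup>2" using pos1[of t] t by simp
        then show "norm (u' t * (G t - G z) / (u t)\<^sup>2) \<le> \<eta>"
          using le by (simp add: abs_mult pos_divide_le_eq)
      qed (use az in auto)
      have ends: "\<bar>\<mu> t - \<nu> t\<bar> \<le> h / \<delta>" if "\<bar>G t - G z\<bar> \<le> h" "a \<le> t" "t \<le> b" for t h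
      proof -
        have "\<mu> t - \<nu> t = (G t - G z) / u t"
          unfolding \<mu>_def \<nu>_def diff_divide_distrib[symmetric] by simp
        then have "\<bar>\<mu> t - \<nu> t\<bar> = \<bar>G t - G z\<bar> / u t" using pos1[OF that(2,3)] by simp
        also have "\<dots> \<le> h / \<delta>"
          using that(1) pos2[OF that(2,3)] \<delta>(1) by (intro frac_le) simp_all
        finally show ?thesis .
      qed
      have "\<bar>\<mu> b - \<nu> b\<bar> \<le> (H b - H z) / \<delta>" using G_H[OF az(2)] az by (intro ends) auto
      moreover have "\<bar>\<mu> a - \<nu> a\<bar> \<le> (H z - H a) / \<delta>" using G_H[OF az(1)] az by (intro ends) (auto simp: abs_minus_commute)
      ultimately have "\<bar>\<mu> b - \<mu> a\<bar> \<le> (H b - H z) / \<delta> + (H z - H a) / \<delta> + \<eta> * (b - a)"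
        using mid az unfolding real_norm_def by linarith
      then show ?thesis by (simp add: diff_divide_distrib)
    qed
    then show ?case using d(1) unfolding P_def by blast
  qed
  have "\<bar>\<mu> y - \<mu> x\<bar> \<le> (H y - H x) / \<delta> + e" if e: "e > 0" for e
  proof -
    have "\<bar>\<mu> y - \<mu> x\<bar> \<le> (H y - H x) / \<delta> + e / (y - x + 1) * (y - x)"
      using approx[of "e / (y - x + 1)"] e xy by (simp add: P_def)
    moreover have "e / (y - x + 1) * (y - x) \<le> e" using e xy by (simp add: field_simps)
    ultimately show ?thesis by linarith
  qed
  then show ?thesis by (rule field_le_epsilon)
qed

text \<open>Where \<open>G\<close> is positive, \<open>sqrt u\<close> is strongly concave as long as \<open>u\<close> is small, and \<open>u\<close> has
  no small local minimum.\<close>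
lemma u_lower_bound:
  assumes \<kappa>: "0 < \<kappa>" and \<delta>: "0 < \<delta>" and l: "0 < l" "16 * \<epsilon>\<^sup>2 * \<delta>\<^sup>2 < \<kappa> * l\<^sup>2"
    and G: "\<And>t. x - l \<le> t \<Longrightarrow> t \<le> x + l \<Longrightarrow> 2 * \<kappa> \<le> G t"
    and small: "\<And>s. 0 \<le> s \<Longrightarrow> s \<le> \<delta> \<Longrightarrow> s * W' s - W s \<le> \<kappa>"
  shows "\<delta> \<le> u x"
proof (rule ccontr)
  assume "\<not> \<delta> \<le> u x"
  then have x: "u x < \<delta>" by simp
  have pos: "0 < u t" if "x - l \<le> t" "t \<le> x + l" for t
    using G[OF that] G_zero[of t] u_nonneg[of t] \<kappa> by (cases "u t = 0") auto
  \<comment> \<open>On an interval of length \<open>l\<close> inside the window \<open>u\<close>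
    must reach \<open>\<delta>\<close>, as strong concavity would otherwise force
    \<open>sqrt u\<close> out of the range between 0 and \<open>sqrt \<delta>\<close>.\<close>
  have ex: "\<exists>t\<in>{m - l / 2..m + l / 2}. \<delta> \<le> u t" if m: "x - l \<le> m - l / 2" "m + l / 2 \<le> x + l" for m
  proof (rule ccontr)
    assume "\<not> ?thesis"
    then have lt: "u t < \<delta>" if "t \<in> {m - l / 2..m + l / 2}" for t using that by force
    define v where "v t = sqrt (u t)" for t
    \<comment> \<open>The second derivative of \<open>sqrt u\<close> is
      \<open>(u u'' - u'^2 / 2) / (2 (sqrt u)^3)\<close>, and the equation makes the numerator at
      most \<open>- \<kappa> / \<epsilon>^2\<close>. The bound
      \<open>k (l / 2)^2 \<le> 2 sqrt \<delta>\<close> is then exactly what the factor 16 in the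
      hypothesis on \<open>l\<close> excludes.\<close>
    define k where "k = \<kappa> / (2 * \<epsilon>\<^sup>2 * (sqrt \<delta>)^3)"
    have p: "0 < u t" if "t \<in> {m - l / 2..m + l / 2}" for t using pos that m by auto
    have v: "0 < v t" "v t \<le> sqrt \<delta>" "(v t)\<^sup>2 = u t" if "t \<in> {m - l / 2..m + l / 2}" for t
      using p[OF that] lt[OF that] by (auto simp: v_def)
    have v_deriv: "(v has_real_derivative u' t / (2 * v t)) (at t)" if "t \<in> {m - l / 2..m + l / 2}" for t
    proof -
      have "(v has_real_derivative inverse (sqrt (u t)) / 2 * u' t) (at t)"
        unfolding v_def using p[OF that] by (intro DERIV_chain2[OF DERIV_real_sqrt u_deriv])
      then show ?thesis by (simp add: v_def field_simps)
    qed
    have "v (m - l / 2) + v (m + l / 2) - 2 * v m \<le> - k * (l / 2)\<^sup>2"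
    proof (rule second_difference_le)
      fix t assume t: "t \<in> {m - l / 2..m + l / 2}"
      show "(v has_real_derivative u' t / (2 * v t)) (at t)" by (rule v_deriv[OF t])
      show "((\<lambda>t. u' t / (2 * v t)) has_real_derivative
          (u'' t * (2 * v t) - u' t * (2 * (u' t / (2 * v t)))) / (2 * v t * (2 * v t))) (at t)"
        using v(1)[OF t] u'_deriv[OF p[OF t]] v_deriv[OF t] by (auto intro!: derivative_eq_intros)
      have "\<epsilon>\<^sup>2 * u t * u'' t = u t * W' (u t) - W (u t) + \<epsilon>\<^sup>2 / 2 * (u' t)\<^sup>2 - G t"
        using p[OF t] eps by (simp add: u''_def)
      then have "\<epsilon>\<^sup>2 * u t * u'' t \<le> \<epsilon>\<^sup>2 / 2 * (u' t)\<^sup>2 - \<kappa>"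
        using small[of "u t"] G[of t] p[OF t] lt[OF t] t m by auto
      then have main: "2 * \<epsilon>\<^sup>2 * (u t * u'' t - (u' t)\<^sup>2 / 2) \<le> - 2 * \<kappa>" by (simp add: algebra_simps)
      have e: "0 < \<epsilon>\<^sup>2" using eps by simp
      have "(u'' t * (2 * v t) - u' t * (2 * (u' t / (2 * v t)))) / (2 * v t * (2 * v t))
          = (u t * u'' t - (u' t)\<^sup>2 / 2) / (2 * (v t)^3)"
        using v(1)[OF t] unfolding v(3)[OF t, symmetric] by (simp add: field_simps power2_eq_square power3_eq_cube)
      also have "\<dots> \<le> (- \<kappa> / \<epsilon>\<^sup>2) / (2 * (v t)^3)"
        using main e v(1)[OF t] by (intro divide_right_mono) (auto simp: field_simps)
      also have "\<dots> \<le> - k"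
      proof -
        have "(v t)^3 \<le> (sqrt \<delta>)^3" using v[OF t] by (intro power_mono) auto
        then have "\<kappa> / (2 * \<epsilon>\<^sup>2 * (sqrt \<delta>)^3) \<le> \<kappa> / (2 * \<epsilon>\<^sup>2 * (v t)^3)"
          using \<kappa> e v(1)[OF t] by (intro divide_left_mono mult_left_mono mult_pos_pos) (auto simp: \<delta>)
        then show ?thesis by (simp add: k_def mult_ac)
      qed
      finally show "(u'' t * (2 * v t) - u' t * (2 * (u' t / (2 * v t)))) / (2 * v t * (2 * v t)) \<le> - k" .
    qed (use l in auto)
    moreover have "- 2 * sqrt \<delta> \<le> v (m - l / 2) + v (m + l / 2) - 2 * v m"
      using v[of "m - l / 2"] v[of "m + l / 2"] v[of m] l by auto
    ultimately have "k * (l / 2)\<^sup>2 \<le> 2 * sqrt \<delta>" by linarith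
    then have "\<kappa> * l\<^sup>2 \<le> 16 * \<epsilon>\<^sup>2 * ((sqrt \<delta>)^3 * sqrt \<delta>)"
      using eps \<delta> by (simp add: k_def field_simps power2_eq_square)
    also have "(sqrt \<delta>)^3 * sqrt \<delta> = \<delta>\<^sup>2"
    proof -
      have "(sqrt \<delta>)^3 * sqrt \<delta> = ((sqrt \<delta>)\<^sup>2)\<^sup>2" by (simp add: power3_eq_cube power2_eq_square mult_ac)
      then show ?thesis using \<delta> by simp
    qed
    finally show False using l by simp
  qed
  obtain p where p: "x - l \<le> p" "p \<le> x" "\<delta> \<le> u p" using ex[of "x - l / 2"] l by auto
  obtain q where q: "x \<le> q" "q \<le> x + l" "\<delta> \<le> u q" using ex[of "x + l / 2"] l by auto
  \<comment> \<open>A minimum between two points where \<open>u\<close> is at least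
    \<open>\<delta>\<close> is interior. At this critical point the equation gives
    \<open>u'' < 0\<close>, which contradicts minimality.\<close>
  obtain z where z: "z \<in> {p..q}" "\<And>t. t \<in> {p..q} \<Longrightarrow> u z \<le> u t"
    using continuous_attains_inf[of "{p..q}" u] u_cont p q by fastforce
  have uz: "u z < \<delta>" using z(2)[of x] p q x by auto
  then have zpq: "p < z" "z < q" using z(1) p q by (auto simp: le_less)
  have zr: "x - l \<le> z" "z \<le> x + l" using zpq p q by auto
  have u'z: "u' z = 0"
    using zpq z(2) by (intro DERIV_local_min[OF u_deriv, of "min (z - p) (q - z)"]) (auto simp: abs_if split: if_splits)
  have neg: "u'' z < 0"
  proof -
    have "u z * W' (u z) - W (u z) - G z < 0"
      using small[of "u z"] G[OF zr] uz \<kappa> u_nonneg[of z] by auto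
    then show ?thesis using pos[OF zr] eps by (simp add: u''_def u'z divide_neg_pos)
  qed
  obtain d where d: "0 < d" "\<And>h. 0 < h \<Longrightarrow> h < d \<Longrightarrow> u' (z + h) < u' z"
    using DERIV_neg_dec_right[OF u'_deriv[OF pos[OF zr]] neg] by auto
  define h where "h = min (d / 2) (q - z)"
  have h: "0 < h" "h < d" "z + h \<le> q" using d zpq by (auto simp: h_def)
  obtain \<xi> where \<xi>: "z < \<xi>" "\<xi> < z + h" "u (z + h) - u z = h * u' \<xi>"
    using MVT2[of z "z + h" u u'] u_deriv h by auto
  have "u' \<xi> < 0" using d(2)[of "\<xi> - z"] \<xi> h u'z by auto
  then have "u (z + h) < u z" using \<xi>(3) h by (smt (verit) mult_pos_neg)
  then show False using z(2)[of "z + h"] h zpq by auto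
qed

text \<open>Around \<open>z\<close> there are slow points at distance \<open>sqrt \<epsilon>\<close>. Between them \<open>u\<close> sweeps an interval on which
  \<open>W\<close> lies above a line, up to a small error, with equality at the extreme values; the lower end may instead
  be the cut-off \<open>\<delta>\<close>.\<close>
lemma range_between_slow_points:
  assumes eps1: "\<epsilon> \<le> 1" and uz: "\<delta> < u z"
    and \<delta>_def: "\<delta> = sqrt (sqrt (sqrt \<epsilon>))"
    and E_def: "E = K * (M * \<delta> + \<delta>\<^sup>2) + 2 * M\<^sup>2 * \<epsilon> + (4 * M * \<epsilon> + K * \<delta>)"
  shows "\<exists>m Mx p s. \<delta> \<le> m \<and> m \<le> u z \<and> u z \<le> Mx \<and> Mx \<le> M \<and>
    (\<forall>s. m \<le> s \<and> s \<le> Mx \<longrightarrow> \<mu> z * s - G z \<le> W s + E) \<and>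
    \<bar>W Mx - (\<mu> z * Mx - G z)\<bar> \<le> E \<and>
    (m = \<delta> \<or> \<bar>W m - (\<mu> z * m - G z)\<bar> \<le> E) \<and>
    \<bar>p - z\<bar> \<le> sqrt \<epsilon> \<and> u p = m \<and>
    (m = \<delta> \<or> m \<le> s \<and> s \<le> Mx \<and> \<bar>W' s - \<mu> z\<bar> \<le> E)"
proof -
  \<comment> \<open>The window has half-width \<open>h\<close>, and
    \<open>\<delta>^2 = sqrt h\<close>. Across it \<open>H\<close> grows by at most
    \<open>K \<delta>^2\<close>, so after division by the lower bound \<open>\<delta>\<close> the
    potential \<open>\<mu>\<close> varies by at most \<open>K \<delta>\<close>.\<close>
  define h where "h = sqrt \<epsilon>"
  have h: "0 < h" "h \<le> 1" "h * h = \<epsilon>" using eps eps1 by (auto simp: h_def)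
  have \<delta>: "0 < \<delta>" "\<delta>\<^sup>2 = sqrt h" using eps by (auto simp: \<delta>_def h_def)
  have KM: "0 \<le> K" "0 \<le> M" using K_nonneg M_nonneg by auto
  have E1: "K * (M * \<delta> + \<delta>\<^sup>2) + 2 * M\<^sup>2 * \<epsilon> \<le> E" and E2: "4 * M * \<epsilon> + K * \<delta> \<le> E"
    using KM \<delta>(1) eps by (auto simp: E_def)
  have diff: "\<bar>u s - u t\<bar> \<le> M" for s t
    using u_nonneg[of s] u_nonneg[of t] u_le[of s] u_le[of t] by linarith
  \<comment> \<open>As \<open>u\<close> varies by at most \<open>M\<close>, the mean value theorem
    on an interval of length \<open>h / 2\<close> yields a point with
    \<open>\<bar>u'\<bar> \<le> 2 M / h\<close>. The kinetic term there is at most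
    \<open>2 M^2 \<epsilon>\<close>.\<close>
  obtain x1 where x1: "z - h < x1" "x1 < z - h / 2" "u (z - h / 2) - u (z - h) = h / 2 * u' x1"
    using MVT2[of "z - h" "z - h / 2" u u'] u_deriv h by auto
  obtain x2 where x2: "z + h / 2 < x2" "x2 < z + h" "u (z + h) - u (z + h / 2) = h / 2 * u' x2"
    using MVT2[of "z + h / 2" "z + h" u u'] u_deriv h by auto
  have slow_h: "\<bar>u' x\<bar> \<le> 2 * M / h" if "\<bar>h / 2 * u' x\<bar> \<le> M" for x
    using that h by (simp add: abs_mult field_simps)
  have slow12: "\<bar>u' x1\<bar> \<le> 2 * M / h" "\<bar>u' x2\<bar> \<le> 2 * M / h"
    using slow_h diff x1(3) x2(3) by metis+
  obtain \<alpha> where \<alpha>: "x1 \<le> \<alpha>" "\<alpha> \<le> z" "\<And>t. \<alpha> \<le> t \<Longrightarrow> t \<le> z \<Longrightarrow> \<delta> \<le> u t" "\<alpha> = x1 \<or> u \<alpha> = \<delta>"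
    by (rule last_crossing[OF u_cont, of x1 z \<delta>]) (use x1 h uz that in auto)
  obtain \<beta> where \<beta>: "z \<le> \<beta>" "\<beta> \<le> x2" "\<And>t. z \<le> t \<Longrightarrow> t \<le> \<beta> \<Longrightarrow> \<delta> \<le> u t" "\<beta> = x2 \<or> u \<beta> = \<delta>"
    by (rule first_crossing[OF u_cont, of z x2 \<delta>]) (use x2 h uz that in auto)
  have lower: "\<delta> \<le> u t" if "\<alpha> \<le> t" "t \<le> \<beta>" for t
    using \<alpha>(3)[of t] \<beta>(3)[of t] that by (cases "t \<le> z") auto
  have pos: "0 < u t" if "\<alpha> \<le> t" "t \<le> \<beta>" for t using lower[OF that] \<delta>(1) by linarith
  have dist: "\<bar>t - z\<bar> \<le> h" if "\<alpha> \<le> t" "t \<le> \<beta>" for t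
    using that \<alpha>(1) \<beta>(2) x1(1) x2(2) by linarith
  have \<mu>_osc: "\<bar>\<mu> t - \<mu> z\<bar> \<le> K * \<delta>" if t: "\<alpha> \<le> t" "t \<le> \<beta>" for t
  proof -
    have Hd: "H y - H x \<le> K * \<delta>\<^sup>2" if "x \<le> y" "y - x \<le> h" for x y
    proof -
      have "H y - H x \<le> K * sqrt (y - x)" using that h by (intro H_holder) auto
      also have "\<dots> \<le> K * \<delta>\<^sup>2" unfolding \<delta>(2) using that KM by (intro mult_left_mono) auto
      finally show ?thesis .
    qed
    have div: "K * \<delta>\<^sup>2 / \<delta> = K * \<delta>" using \<delta>(1) by (simp add: power2_eq_square)
    show ?thesis
    proof (cases "t \<le> z")
      case True
      have "\<bar>\<mu> z - \<mu> t\<bar> \<le> (H z - H t) / \<delta>"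
        using True t \<beta>(1) by (intro \<mu>_oscillation lower \<delta>(1)) auto
      also have "\<dots> \<le> K * \<delta>\<^sup>2 / \<delta>"
        using Hd[of t z] True dist[OF t] \<delta>(1) by (intro divide_right_mono) auto
      finally show ?thesis using div by (simp add: abs_minus_commute)
    next
      case False
      have "\<bar>\<mu> t - \<mu> z\<bar> \<le> (H t - H z) / \<delta>"
        using False t \<alpha>(2) by (intro \<mu>_oscillation lower \<delta>(1)) auto
      also have "\<dots> \<le> K * \<delta>\<^sup>2 / \<delta>"
        using Hd[of z t] False dist[OF t] \<delta>(1) by (intro divide_right_mono) auto
      finally show ?thesis using div by simp
    qed
  qed
  have key: "\<bar>W (u t) - (\<mu> z * u t - G z) - \<epsilon>\<^sup>2 / 2 * (u' t)\<^sup>2\<bar> \<le> K * (M * \<delta> + \<delta>\<^sup>2)" if t: "\<alpha> \<le> t" "t \<le> \<beta>" for t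
  proof -
    have "W (u t) - (\<mu> z * u t - G z) - \<epsilon>\<^sup>2 / 2 * (u' t)\<^sup>2 = (\<mu> t - \<mu> z) * u t - (G t - G z)"
      using energy[OF pos[OF t]] by (simp add: algebra_simps)
    moreover have "\<bar>(\<mu> t - \<mu> z) * u t\<bar> \<le> K * \<delta> * M"
      unfolding abs_mult using \<mu>_osc[OF t] u_nonneg[of t] u_le[of t] KM \<delta>(1) by (intro mult_mono) auto
    moreover have "\<bar>G t - G z\<bar> \<le> K * \<delta>\<^sup>2"
    proof -
      have "\<bar>G t - G z\<bar> \<le> K * sqrt \<bar>t - z\<bar>" using dist[OF t] h by (intro G_holder) auto
      also have "\<dots> \<le> K * \<delta>\<^sup>2" unfolding \<delta>(2) using dist[OF t] KM by (intro mult_left_mono) auto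
      finally show ?thesis .
    qed
    ultimately have "\<bar>W (u t) - (\<mu> z * u t - G z) - \<epsilon>\<^sup>2 / 2 * (u' t)\<^sup>2\<bar> \<le> K * \<delta> * M + K * \<delta>\<^sup>2" by linarith
    then show ?thesis by (simp add: algebra_simps)
  qed
  have slow: "\<bar>W (u t) - (\<mu> z * u t - G z)\<bar> \<le> E" if t: "\<alpha> \<le> t" "t \<le> \<beta>" and s: "\<bar>u' t\<bar> \<le> 2 * M / h" for t
  proof -
    have "(u' t)\<^sup>2 \<le> (2 * M / h)\<^sup>2" using power_mono[OF s, of 2] by simp
    then have "\<epsilon>\<^sup>2 / 2 * (u' t)\<^sup>2 \<le> \<epsilon>\<^sup>2 / 2 * (2 * M / h)\<^sup>2" by (intro mult_left_mono) auto
    also have "\<dots> = 2 * M\<^sup>2 * \<epsilon>"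
      unfolding h(3)[symmetric] using h(1) by (simp add: power2_eq_square field_simps)
    finally have "\<bar>\<epsilon>\<^sup>2 / 2 * (u' t)\<^sup>2\<bar> \<le> 2 * M\<^sup>2 * \<epsilon>" by simp
    then show ?thesis using key[OF t] E1 by linarith
  qed
  have ab: "\<alpha> \<le> \<beta>" using \<alpha>(2) \<beta>(1) by simp
  obtain p where p: "p \<in> {\<alpha>..\<beta>}" "\<And>t. t \<in> {\<alpha>..\<beta>} \<Longrightarrow> u p \<le> u t"
    using continuous_attains_inf[of "{\<alpha>..\<beta>}" u] u_cont ab by fastforce
  obtain q where q: "q \<in> {\<alpha>..\<beta>}" "\<And>t. t \<in> {\<alpha>..\<beta>} \<Longrightarrow> u t \<le> u q"
    using continuous_attains_sup[of "{\<alpha>..\<beta>}" u] u_cont ab by fastforce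
  have zin: "z \<in> {\<alpha>..\<beta>}" using \<alpha> \<beta> by auto
  have Mh: "0 \<le> 2 * M / h" using KM h by simp
  have q_slow: "\<bar>u' q\<bar> \<le> 2 * M / h"
  proof -
    \<comment> \<open>The maximum is above the cut-off, so it is attained at a slow point or at an
      interior critical point; in both cases the kinetic term is negligible.\<close>
    have "u q \<noteq> \<delta>" using q(2)[OF zin] uz by simp
    then consider "q = x1" | "q = x2" | "\<alpha> < q" "q < \<beta>"
      using q(1) \<alpha>(4) \<beta>(4) by (auto simp: le_less)
    then show ?thesis
    proof cases
      case 3
      then have "u' q = 0"
        using q(2) by (intro DERIV_local_max[OF u_deriv, of "min (q - \<alpha>) (\<beta> - q)"]) (auto simp: abs_if split: if_splits)
      then show ?thesis using Mh by simp
    qed (use slow12 in auto)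
  qed
  have p_slow: "\<bar>u' p\<bar> \<le> 2 * M / h" if ne: "u p \<noteq> \<delta>"
  proof -
    consider "p = x1" | "p = x2" | "\<alpha> < p" "p < \<beta>"
      using ne p(1) \<alpha>(4) \<beta>(4) by (auto simp: le_less)
    then show ?thesis
    proof cases
      case 3
      then have "u' p = 0"
        using p(2) by (intro DERIV_local_min[OF u_deriv, of "min (p - \<alpha>) (\<beta> - p)"]) (auto simp: abs_if split: if_splits)
      then show ?thesis using Mh by simp
    qed (use slow12 in auto)
  qed
  have above: "\<mu> z * s - G z \<le> W s + E" if s: "u p \<le> s" "s \<le> u q" for s
  proof -
    have "connected (u ` {\<alpha>..\<beta>})" by (intro connected_continuous_image u_cont) auto
    then have "{u p..u q} \<subseteq> u ` {\<alpha>..\<beta>}" using p(1) q(1) by (intro connected_contains_Icc) auto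
    then obtain t where t: "t \<in> {\<alpha>..\<beta>}" "s = u t" using s by auto
    have "0 \<le> \<epsilon>\<^sup>2 / 2 * (u' t)\<^sup>2" by simp
    moreover have "0 \<le> 2 * M\<^sup>2 * \<epsilon>" using eps by simp
    moreover have "\<bar>W (u t) - (\<mu> z * u t - G z) - \<epsilon>\<^sup>2 / 2 * (u' t)\<^sup>2\<bar> \<le> K * (M * \<delta> + \<delta>\<^sup>2)"
      using key t(1) by simp
    ultimately show ?thesis using E1 unfolding t(2) by linarith
  qed
  \<comment> \<open>If the minimum is above the cut-off, both ends of the window are the slow
    points, at distance at least \<open>h\<close>. The mean value theorem for \<open>u'\<close> then
    gives a point with \<open>\<epsilon>^2 \<bar>u''\<bar> \<le> 4 M \<epsilon>\<close>, where
    \<open>W'\<close> is close to \<open>\<mu>\<close>. This supplies the slope when the swept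
    interval shrinks to a point.\<close>
  have tangent: "\<exists>s. u p \<le> s \<and> s \<le> u q \<and> \<bar>W' s - \<mu> z\<bar> \<le> E" if "u p \<noteq> \<delta>"
  proof -
    have "\<delta> < u p" using lower[of p] p(1) that by auto
    then have ends: "\<alpha> = x1" "\<beta> = x2"
      using \<alpha>(4) \<beta>(4) p(2)[of \<alpha>] p(2)[of \<beta>] ab by auto
    have lt: "x1 < x2" "h \<le> x2 - x1" using x1 x2 h by linarith+
    obtain \<xi> where \<xi>: "x1 < \<xi>" "\<xi> < x2" "u' x2 - u' x1 = (x2 - x1) * u'' \<xi>"
      using MVT2[OF lt(1), of u' u''] u'_deriv pos ends by auto
    have \<xi>in: "\<alpha> \<le> \<xi>" "\<xi> \<le> \<beta>" using \<xi> ends by auto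
    have "(x2 - x1) * \<bar>u'' \<xi>\<bar> = \<bar>u' x2 - u' x1\<bar>" using \<xi>(3) lt by (simp add: abs_mult)
    also have "\<dots> \<le> 4 * M / h" using slow12 by linarith
    finally have "(x2 - x1) * \<bar>u'' \<xi>\<bar> \<le> 4 * M / h" .
    moreover have "h * \<bar>u'' \<xi>\<bar> \<le> (x2 - x1) * \<bar>u'' \<xi>\<bar>" using lt by (intro mult_right_mono) auto
    ultimately have "h * \<bar>u'' \<xi>\<bar> \<le> 4 * M / h" by linarith
    then have "h * h * \<bar>u'' \<xi>\<bar> \<le> 4 * M" using h(1) by (simp add: pos_le_divide_eq mult_ac)
    then have "\<epsilon> * (\<epsilon> * \<bar>u'' \<xi>\<bar>) \<le> \<epsilon> * (4 * M)" unfolding h(3) using eps by (intro mult_left_mono) auto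
    then have "\<bar>\<epsilon>\<^sup>2 * u'' \<xi>\<bar> \<le> 4 * M * \<epsilon>" by (simp add: abs_mult power2_eq_square mult_ac)
    then have "\<bar>W' (u \<xi>) - \<mu> \<xi>\<bar> \<le> 4 * M * \<epsilon>" using u''_\<mu>[OF pos[OF \<xi>in]] by simp
    then have "\<bar>W' (u \<xi>) - \<mu> z\<bar> \<le> E" using \<mu>_osc[OF \<xi>in] E2 by linarith
    then show ?thesis using p(2)[of \<xi>] q(2)[of \<xi>] \<xi>in by auto
  qed
  obtain s where s: "u p \<noteq> \<delta> \<longrightarrow> u p \<le> s \<and> s \<le> u q \<and> \<bar>W' s - \<mu> z\<bar> \<le> E"
    using tangent by blast
  have pd: "\<alpha> \<le> p" "p \<le> \<beta>" and qd: "\<alpha> \<le> q" "q \<le> \<beta>" using p(1) q(1) by auto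
  show ?thesis
  proof (rule exI[of _ "u p"], rule exI[of _ "u q"], rule exI[of _ p], rule exI[of _ s], intro conjI allI impI)
    show "\<delta> \<le> u p" by (rule lower[OF pd])
    show "u p \<le> u z" "u z \<le> u q" using p(2) q(2) zin by auto
    show "u q \<le> M" by (rule u_le)
    show "\<bar>W (u q) - (\<mu> z * u q - G z)\<bar> \<le> E" by (rule slow[OF qd q_slow])
    show "u p = \<delta> \<or> \<bar>W (u p) - (\<mu> z * u p - G z)\<bar> \<le> E" using slow[OF pd p_slow] by blast
    show "\<bar>p - z\<bar> \<le> sqrt \<epsilon>" using dist[OF pd] by (simp add: h_def)
    show "u p = \<delta> \<or> u p \<le> s \<and> s \<le> u q \<and> \<bar>W' s - \<mu> z\<bar> \<le> E" using s by blast
  qed (use above in auto)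
qed

end

subsection \<open>The limit of the local structure\<close>

context potential
begin

text \<open>Both ends of the swept interval and the slope of the line are bounded, so a subsequence
  converges to a chord to which \<open>Q_chord\<close> applies. The delicate case is a lower end
  tending to 0, where no equality is available before the limit.\<close>

lemma profile_limit_value:
  assumes prof: "\<And>n. profile W W' (\<epsilon> n) K M (u n) (u' n) (G n) (H n)"
    and \<epsilon>: "\<epsilon> \<longlonglongrightarrow> 0" and z: "z \<longlonglongrightarrow> x0"
    and r: "(\<lambda>n. u n (z n)) \<longlonglongrightarrow> r" "0 < r" and G: "(\<lambda>n. G n x0) \<longlonglongrightarrow> G0"
  shows "Q r = G0 \<or> Q r \<in> Q ` \<rat>"
proof -
  have eps: "0 < \<epsilon> n" for n using profile.eps[OF prof] .
  have KM: "0 \<le> K" "0 \<le> M" using profile.K_nonneg[OF prof] profile.M_nonneg[OF prof] by auto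
  have near: "\<forall>\<^sub>F n in sequentially. \<bar>z n - x0\<bar> \<le> 1"
    using tendstoD[OF z zero_less_one] by eventually_elim (auto simp: dist_real_def)
  have Gz: "(\<lambda>n. G n (z n)) \<longlonglongrightarrow> G0"
  proof -
    have "(\<lambda>n. G n (z n) - G n x0) \<longlonglongrightarrow> 0"
    proof (rule Lim_null_comparison)
      show "\<forall>\<^sub>F n in sequentially. norm (G n (z n) - G n x0) \<le> K * sqrt \<bar>z n - x0\<bar>"
        using near by eventually_elim (use profile.G_holder[OF prof] in auto)
      have "(\<lambda>n. K * sqrt \<bar>z n - x0\<bar>) \<longlonglongrightarrow> K * sqrt \<bar>x0 - x0\<bar>" by (intro tendsto_intros z)
      then show "(\<lambda>n. K * sqrt \<bar>z n - x0\<bar>) \<longlonglongrightarrow> 0" by simp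
    qed
    from tendsto_add[OF this G] show ?thesis by simp
  qed
  define \<delta> where "\<delta> n = sqrt (sqrt (sqrt (\<epsilon> n)))" for n
  have \<delta>0: "\<delta> \<longlonglongrightarrow> 0"
    unfolding \<delta>_def using tendsto_real_sqrt[OF tendsto_real_sqrt[OF tendsto_real_sqrt[OF \<epsilon>]]] by simp
  define E where "E n = K * (M * \<delta> n + (\<delta> n)\<^sup>2) + 2 * M\<^sup>2 * \<epsilon> n + (4 * M * \<epsilon> n + K * \<delta> n)" for n
  have E0: "E \<longlonglongrightarrow> 0"
  proof -
    have "E \<longlonglongrightarrow> K * (M * 0 + 0\<^sup>2) + 2 * M\<^sup>2 * 0 + (4 * M * 0 + K * 0)"
      unfolding E_def by (intro tendsto_intros \<delta>0 \<epsilon>)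
    then show ?thesis by simp
  qed
  have "\<forall>\<^sub>F n in sequentially. \<epsilon> n < 1" using order_tendstoD(2)[OF \<epsilon>] by simp
  moreover have "\<forall>\<^sub>F n in sequentially. \<delta> n < r / 2" using order_tendstoD(2)[OF \<delta>0, of "r / 2"] r(2) by simp
  moreover have "\<forall>\<^sub>F n in sequentially. r / 2 < u n (z n)" using order_tendstoD(1)[OF r(1), of "r / 2"] r(2) by simp
  ultimately have "\<forall>\<^sub>F n in sequentially. \<epsilon> n \<le> 1 \<and> \<delta> n < u n (z n) \<and> r / 2 < u n (z n)"
    by eventually_elim auto
  then obtain N where N: "\<And>n. n \<ge> N \<Longrightarrow> \<epsilon> n \<le> 1 \<and> \<delta> n < u n (z n) \<and> r / 2 < u n (z n)"
    unfolding eventually_sequentially by blast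
  define \<nu> where "\<nu> n = profile.\<mu> W (\<epsilon> n) (u n) (u' n) (G n) (z n)" for n
  have "\<forall>n. \<exists>m Mx p s. n \<ge> N \<longrightarrow> \<delta> n \<le> m \<and> m \<le> u n (z n) \<and> u n (z n) \<le> Mx \<and> Mx \<le> M \<and>
    (\<forall>s. m \<le> s \<and> s \<le> Mx \<longrightarrow> \<nu> n * s - G n (z n) \<le> W s + E n) \<and>
    \<bar>W Mx - (\<nu> n * Mx - G n (z n))\<bar> \<le> E n \<and>
    (m = \<delta> n \<or> \<bar>W m - (\<nu> n * m - G n (z n))\<bar> \<le> E n) \<and>
    \<bar>p - z n\<bar> \<le> sqrt (\<epsilon> n) \<and> u n p = m \<and>
    (m = \<delta> n \<or> m \<le> s \<and> s \<le> Mx \<and> \<bar>W' s - \<nu> n\<bar> \<le> E n)"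
    using profile.range_between_slow_points[OF prof _ _ \<delta>_def E_def] N unfolding \<nu>_def by blast
  then obtain m Mx p s where data: "\<And>n. n \<ge> N \<Longrightarrow> \<delta> n \<le> m n \<and> m n \<le> u n (z n) \<and> u n (z n) \<le> Mx n \<and> Mx n \<le> M \<and>
    (\<forall>s. m n \<le> s \<and> s \<le> Mx n \<longrightarrow> \<nu> n * s - G n (z n) \<le> W s + E n) \<and>
    \<bar>W (Mx n) - (\<nu> n * Mx n - G n (z n))\<bar> \<le> E n \<and>
    (m n = \<delta> n \<or> \<bar>W (m n) - (\<nu> n * m n - G n (z n))\<bar> \<le> E n) \<and>
    \<bar>p n - z n\<bar> \<le> sqrt (\<epsilon> n) \<and> u n (p n) = m n \<and>
    (m n = \<delta> n \<or> m n \<le> s n \<and> s n \<le> Mx n \<and> \<bar>W' (s n) - \<nu> n\<bar> \<le> E n)"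
    by metis
  have \<delta>pos: "0 < \<delta> n" for n using eps[of n] by (simp add: \<delta>_def)
  have "bounded (W ` {0..M})"
    by (intro compact_imp_bounded compact_continuous_image continuous_on_subset[OF W_cont]) auto
  then obtain Wm where "\<forall>y\<in>W ` {0..M}. norm y \<le> Wm" unfolding bounded_iff by blast
  then have Wm: "\<bar>W y\<bar> \<le> Wm" if "0 \<le> y" "y \<le> M" for y using that by auto
  obtain Gm where Gm: "\<And>n. \<bar>G n (z n)\<bar> \<le> Gm"
    using convergent_imp_Bseq[OF convergentI[OF Gz]] unfolding Bseq_def real_norm_def by blast
  obtain Em where Em: "\<And>n. \<bar>E n\<bar> \<le> Em"
    using convergent_imp_Bseq[OF convergentI[OF E0]] unfolding Bseq_def real_norm_def by blast
  \<comment> \<open>At the upper end, which is at least \<open>r / 2\<close>, the near equality of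
    \<open>W\<close> and the line determines the slope up to bounded terms.\<close>
  have \<nu>_bd: "\<bar>\<nu> n\<bar> \<le> (Wm + Gm + Em) / (r / 2)" if n: "n \<ge> N" for n
  proof -
    have Mx: "r / 2 \<le> Mx n" "0 \<le> Mx n" "Mx n \<le> M" using data[OF n] N[OF n] r(2) by auto
    have "\<bar>\<nu> n\<bar> * (r / 2) \<le> \<bar>\<nu> n\<bar> * Mx n" using Mx by (intro mult_left_mono) auto
    also have "\<dots> = \<bar>\<nu> n * Mx n\<bar>" using Mx by (simp add: abs_mult)
    also have "\<dots> \<le> Wm + Gm + Em"
    proof -
      have "\<bar>W (Mx n) - (\<nu> n * Mx n - G n (z n))\<bar> \<le> E n" using data[OF n] by blast
      then show ?thesis using Wm[OF Mx(2,3)] Gm[of n] Em[of n] by linarith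
    qed
    finally show ?thesis using r(2) by (simp add: field_simps)
  qed
  have "bounded (range (\<lambda>n. (m (n + N), Mx (n + N), \<nu> (n + N))))"
  proof (rule bounded_subset)
    show "bounded ({0..M} \<times> {0..M} \<times> {- ((Wm + Gm + Em) / (r / 2))..(Wm + Gm + Em) / (r / 2)})"
      by (intro bounded_Times bounded_closed_interval)
    show "range (\<lambda>n. (m (n + N), Mx (n + N), \<nu> (n + N))) \<subseteq>
        {0..M} \<times> {0..M} \<times> {- ((Wm + Gm + Em) / (r / 2))..(Wm + Gm + Em) / (r / 2)}"
    proof (intro image_subsetI)
      fix n
      have n: "n + N \<ge> N" by simp
      show "(m (n + N), Mx (n + N), \<nu> (n + N)) \<in>
        {0..M} \<times> {0..M} \<times> {- ((Wm + Gm + Em) / (r / 2))..(Wm + Gm + Em) / (r / 2)}"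
        using data[OF n] \<nu>_bd[OF n] \<delta>pos[of "n + N"] unfolding abs_le_iff by auto
    qed
  qed
  then obtain l k where k: "strict_mono (k :: nat \<Rightarrow> nat)" and l: "((\<lambda>n. (m (n + N), Mx (n + N), \<nu> (n + N))) \<circ> k) \<longlonglongrightarrow> l"
    using bounded_imp_convergent_subsequence by blast
  define j where "j n = k n + N" for n
  have jN: "j n \<ge> N" for n by (simp add: j_def)
  have j: "filterlim j at_top sequentially"
    unfolding j_def using filterlim_compose[OF filterlim_add_const_nat_at_top filterlim_subseq[OF k]] .
  obtain m0 M0 \<nu>0 where l_eq: "l = (m0, M0, \<nu>0)" by (cases l)
  have lims: "(\<lambda>n. m (j n)) \<longlonglongrightarrow> m0" "(\<lambda>n. Mx (j n)) \<longlonglongrightarrow> M0" "(\<lambda>n. \<nu> (j n)) \<longlonglongrightarrow> \<nu>0"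
    using tendsto_fst[OF l] tendsto_fst[OF tendsto_snd[OF l]] tendsto_snd[OF tendsto_snd[OF l]]
    by (simp_all add: l_eq j_def o_def)
  have subs: "(\<lambda>n. u (j n) (z (j n))) \<longlonglongrightarrow> r" "(\<lambda>n. G (j n) (z (j n))) \<longlonglongrightarrow> G0" "(\<lambda>n. E (j n)) \<longlonglongrightarrow> 0"
    "(\<lambda>n. \<delta> (j n)) \<longlonglongrightarrow> 0" "(\<lambda>n. z (j n)) \<longlonglongrightarrow> x0" "(\<lambda>n. \<epsilon> (j n)) \<longlonglongrightarrow> 0"
    using filterlim_compose[OF r(1) j] filterlim_compose[OF Gz j] filterlim_compose[OF E0 j]
      filterlim_compose[OF \<delta>0 j] filterlim_compose[OF z j] filterlim_compose[OF \<epsilon> j] by simp_all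
  have m0r: "m0 \<le> r" by (rule LIMSEQ_le[OF lims(1) subs(1)]) (use data[OF jN] in blast)
  have rM0: "r \<le> M0" by (rule LIMSEQ_le[OF subs(1) lims(2)]) (use data[OF jN] in blast)
  have m00: "0 \<le> m0"
    by (rule LIMSEQ_le_const[OF lims(1)]) (meson data[OF jN] \<delta>pos less_imp_le order_trans)
  have M0M: "M0 \<le> M" by (rule LIMSEQ_le_const2[OF lims(2)]) (use data[OF jN] in blast)
  have Wlim: "(\<lambda>n. W (y n)) \<longlonglongrightarrow> W y0" if "y \<longlonglongrightarrow> y0" "0 \<le> y0" "\<And>n. 0 \<le> y n" for y y0
    by (rule continuous_on_tendsto_compose[OF W_cont that(1)]) (use that in auto)
  have mn0: "0 \<le> m (j n)" "0 \<le> Mx (j n)" for n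
    using data[OF jN[of n]] \<delta>pos[of "j n"] by auto
  have W_M0: "W M0 = \<nu>0 * M0 - G0"
  proof -
    have "(\<lambda>n. W (Mx (j n)) - (\<nu> (j n) * Mx (j n) - G (j n) (z (j n)))) \<longlonglongrightarrow> W M0 - (\<nu>0 * M0 - G0)"
      using rM0 r(2) mn0 by (intro tendsto_intros Wlim lims subs) auto
    moreover have "(\<lambda>n. W (Mx (j n)) - (\<nu> (j n) * Mx (j n) - G (j n) (z (j n)))) \<longlonglongrightarrow> 0"
      by (rule Lim_null_comparison[OF _ subs(3)]) (use data[OF jN] in auto)
    ultimately have "W M0 - (\<nu>0 * M0 - G0) = 0" by (rule LIMSEQ_unique)
    then show ?thesis by simp
  qed
  have inner: "\<nu>0 * s - G0 \<le> W s" if s: "m0 < s" "s < M0" for s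
  proof -
    have "\<forall>\<^sub>F n in sequentially. m (j n) < s" "\<forall>\<^sub>F n in sequentially. s < Mx (j n)"
      using order_tendstoD(2)[OF lims(1) s(1)] order_tendstoD(1)[OF lims(2) s(2)] by auto
    then have ev: "\<forall>\<^sub>F n in sequentially. \<nu> (j n) * s - G (j n) (z (j n)) \<le> W s + E (j n)"
      by eventually_elim (use data[OF jN] in auto)
    have "\<nu>0 * s - G0 \<le> W s + 0"
    proof (rule tendsto_le[OF sequentially_bot _ _ ev])
      show "(\<lambda>n. W s + E (j n)) \<longlonglongrightarrow> W s + 0" by (intro tendsto_intros subs)
      show "(\<lambda>n. \<nu> (j n) * s - G (j n) (z (j n))) \<longlonglongrightarrow> \<nu>0 * s - G0" by (intro tendsto_intros lims subs)
    qed
    then show ?thesis by simp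
  qed
  have W_m0: "W m0 = \<nu>0 * m0 - G0" and tangent: "m0 = M0 \<Longrightarrow> W' r = \<nu>0"
  proof -
    have "W m0 = \<nu>0 * m0 - G0 \<and> (m0 = M0 \<longrightarrow> W' r = \<nu>0)"
    proof (cases "m0 = 0")
      case False
      then have m0: "0 < m0" using m00 by simp
      then have "\<forall>\<^sub>F n in sequentially. m0 / 2 < m (j n)" "\<forall>\<^sub>F n in sequentially. \<delta> (j n) < m0 / 2"
        using order_tendstoD(1)[OF lims(1), of "m0 / 2"] order_tendstoD(2)[OF subs(4), of "m0 / 2"] by simp_all
      then have ev: "\<forall>\<^sub>F n in sequentially. m (j n) \<noteq> \<delta> (j n)" by eventually_elim auto
      have "(\<lambda>n. W (m (j n)) - (\<nu> (j n) * m (j n) - G (j n) (z (j n)))) \<longlonglongrightarrow> W m0 - (\<nu>0 * m0 - G0)"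
        using m00 mn0 by (intro tendsto_intros Wlim lims subs) auto
      moreover have "(\<lambda>n. W (m (j n)) - (\<nu> (j n) * m (j n) - G (j n) (z (j n)))) \<longlonglongrightarrow> 0"
      proof (rule Lim_null_comparison[OF _ subs(3)])
        show "\<forall>\<^sub>F n in sequentially. norm (W (m (j n)) - (\<nu> (j n) * m (j n) - G (j n) (z (j n)))) \<le> E (j n)"
          using ev by eventually_elim (use data[OF jN] in auto)
      qed
      ultimately have 1: "W m0 - (\<nu>0 * m0 - G0) = 0" by (rule LIMSEQ_unique)
      have 2: "W' r = \<nu>0" if eq: "m0 = M0"
      proof -
        \<comment> \<open>The point \<open>s\<close> is controlled only when the lower end is not
          the cut-off. Clamping it to the swept interval makes convergence to \<open>r\<close> a
          sandwich argument for all \<open>n\<close>.\<close>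
        define y where "y n = max (m (j n)) (min (s (j n)) (Mx (j n)))" for n
        have yb: "m (j n) \<le> y n" "y n \<le> Mx (j n)" for n
          using data[OF jN[of n]] by (auto simp: y_def)
        have "M0 = r" using eq m0r rM0 by simp
        have ylim: "y \<longlonglongrightarrow> r"
          by (rule tendsto_sandwich[OF _ _ lims(1,2)[unfolded eq \<open>M0 = r\<close>]]) (use yb in auto)
        have "(\<lambda>n. W' (y n)) \<longlonglongrightarrow> W' r"
          by (rule continuous_on_tendsto_compose[OF W'_cont ylim])
            (use r(2) yb mn0 in \<open>auto intro!: always_eventually intro: order_trans\<close>)
        then have "(\<lambda>n. W' (y n) - \<nu> (j n)) \<longlonglongrightarrow> W' r - \<nu>0" by (intro tendsto_intros lims)
        moreover have "(\<lambda>n. W' (y n) - \<nu> (j n)) \<longlonglongrightarrow> 0"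
        proof (rule Lim_null_comparison[OF _ subs(3)])
          show "\<forall>\<^sub>F n in sequentially. norm (W' (y n) - \<nu> (j n)) \<le> E (j n)"
            using ev
          proof eventually_elim
            case (elim n)
            then have "m (j n) \<le> s (j n)" "s (j n) \<le> Mx (j n)" "\<bar>W' (s (j n)) - \<nu> (j n)\<bar> \<le> E (j n)"
              using data[OF jN[of n]] by blast+
            then show ?case by (simp add: y_def)
          qed
        qed
        ultimately have "W' r - \<nu>0 = 0" by (rule LIMSEQ_unique)
        then show ?thesis by simp
      qed
      show ?thesis using 1 2 by simp
    next
      case True
      \<comment> \<open>In this case \<open>W m0 = \<nu>0 * m0 - G0\<close> amounts to
        \<open>G0 = 0\<close>. One sign follows by letting \<open>s\<close> tend to 0 in the chord
        inequality. The other holds because a positive flux would keep \<open>u\<close> away from 0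
        near \<open>p\<close>, although \<open>u\<close> at \<open>p\<close> tends to 0.\<close>
      have "- G0 \<le> 0"
      proof (rule tendsto_le)
        have "(W \<longlongrightarrow> W 0) (at 0 within {0..})" using W_cont by (simp add: continuous_on_def)
        then have "(W \<longlongrightarrow> W 0) (at_right 0)" by (rule tendsto_within_subset) auto
        then show "(W \<longlongrightarrow> 0) (at_right 0)" by (simp add: W0)
        show "((\<lambda>s. \<nu>0 * s - G0) \<longlongrightarrow> - G0) (at_right 0)"
          by (auto intro!: tendsto_eq_intros)
        show "\<forall>\<^sub>F s in at_right 0. \<nu>0 * s - G0 \<le> W s"
          using rM0 r(2) True inner by (intro eventually_at_rightI[of 0 M0]) auto
      qed simp
      moreover have "\<not> G0 > 0"
      proof
        assume G0: "G0 > 0"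
        \<comment> \<open>With a quarter of \<open>G0\<close>, the flux at \<open>z\<close>
          eventually exceeds \<open>3 \<kappa>\<close>; a Hoelder error of at most
          \<open>\<kappa>\<close> leaves the \<open>2 \<kappa>\<close> asked for by
          \<open>u_lower_bound\<close>.\<close>
        define \<kappa> where "\<kappa> = G0 / 4"
        have \<kappa>: "\<kappa> > 0" using G0 by (simp add: \<kappa>_def)
        have "((\<lambda>s. s * W' s - W s) \<longlongrightarrow> 0 * W' 0 - W 0) (at 0 within {0..})"
          using W_cont W'_cont by (intro tendsto_intros) (auto simp: continuous_on_def)
        then have "\<forall>\<^sub>F s in at 0 within {0..}. s * W' s - W s < \<kappa>"
          using order_tendstoD(2) \<kappa> W0 by fastforce
        then obtain d where d: "d > 0" "\<And>s. s \<in> {0..} \<Longrightarrow> s \<noteq> 0 \<Longrightarrow> dist s 0 < d \<Longrightarrow> s * W' s - W s < \<kappa>"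
          unfolding eventually_at by blast
        define \<Delta> where "\<Delta> = d / 2"
        have \<Delta>: "0 < \<Delta>" "s * W' s - W s \<le> \<kappa>" if "0 \<le> s" "s \<le> \<Delta>" for s
          using d(1) d(2)[of s] that W0 \<kappa> by (cases "s = 0"; force simp: \<Delta>_def dist_real_def less_imp_le)+
        have \<Delta>0: "0 < \<Delta>" using d by (simp add: \<Delta>_def)
        define e where "e = min 1 ((\<kappa> / (K + 1))\<^sup>2)"
        have e: "0 < e" "e \<le> 1" "K * sqrt e \<le> \<kappa>"
        proof -
          show "0 < e" "e \<le> 1" using \<kappa> KM by (auto simp: e_def)
          have "sqrt e \<le> \<kappa> / (K + 1)" using \<kappa> KM by (intro real_le_lsqrt) (auto simp: e_def)
          then have "K * sqrt e \<le> K * (\<kappa> / (K + 1))" using KM by (intro mult_left_mono) auto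
          also have "\<dots> \<le> \<kappa>" using KM \<kappa> by (simp add: field_simps)
          finally show "K * sqrt e \<le> \<kappa>" .
        qed
        \<comment> \<open>The distance from \<open>z\<close> to a point within \<open>L\<close> of
          \<open>p\<close> is at most \<open>L + sqrt (\<epsilon> (j n))\<close>, hence less than
          \<open>2 L\<close>, and thus within the Hoelder range \<open>e\<close>.\<close>
        define L where "L = e / 4"
        have L: "0 < L" using e by (simp add: L_def)
        have "(\<lambda>n. 16 * (\<epsilon> (j n))\<^sup>2 * \<Delta>\<^sup>2) \<longlonglongrightarrow> 16 * 0\<^sup>2 * \<Delta>\<^sup>2" by (intro tendsto_intros subs)
        then have "\<forall>\<^sub>F n in sequentially. 16 * (\<epsilon> (j n))\<^sup>2 * \<Delta>\<^sup>2 < \<kappa> * L\<^sup>2"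
          using order_tendstoD(2)[of _ "16 * 0\<^sup>2 * \<Delta>\<^sup>2" sequentially "\<kappa> * L\<^sup>2"] \<kappa> L by simp
        moreover have "\<forall>\<^sub>F n in sequentially. sqrt (\<epsilon> (j n)) < L"
          using order_tendstoD(2)[OF tendsto_real_sqrt[OF subs(6)]] L by simp
        moreover have "\<forall>\<^sub>F n in sequentially. 3 * \<kappa> < G (j n) (z (j n))"
          using order_tendstoD(1)[OF subs(2), of "3 * \<kappa>"] G0 by (simp add: \<kappa>_def)
        moreover have "\<forall>\<^sub>F n in sequentially. m (j n) < \<Delta>"
          using order_tendstoD(2)[OF lims(1)] True \<Delta>0 by simp
        ultimately have "\<forall>\<^sub>F n in sequentially. False"
        proof eventually_elim
          case (elim n)
          interpret P: profile W W' "\<epsilon> (j n)" K M "u (j n)" "u' (j n)" "G (j n)" "H (j n)" by (rule prof)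
          have pz: "\<bar>p (j n) - z (j n)\<bar> \<le> sqrt (\<epsilon> (j n))" and up: "u (j n) (p (j n)) = m (j n)"
            using data[OF jN[of n]] by blast+
          have "\<Delta> \<le> u (j n) (p (j n))"
          proof (rule P.u_lower_bound[OF \<kappa> \<Delta>0 L elim(1)])
            fix t assume t: "p (j n) - L \<le> t" "t \<le> p (j n) + L"
            have "\<bar>t - z (j n)\<bar> \<le> e" using t pz elim(2) by (simp add: L_def)
            then have "\<bar>G (j n) t - G (j n) (z (j n))\<bar> \<le> K * sqrt \<bar>t - z (j n)\<bar>" "K * sqrt \<bar>t - z (j n)\<bar> \<le> K * sqrt e"
              using e(2) KM by (auto intro!: P.G_holder mult_left_mono)
            then show "2 * \<kappa> \<le> G (j n) t" using e(3) elim(3) by linarith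
          qed (use \<Delta> in auto)
          then show False using elim(4) up by simp
        qed
        then show False by simp
      qed
      ultimately have "G0 = 0" by linarith
      then show ?thesis using True W0 rM0 r(2) by simp
    qed
    then show "W m0 = \<nu>0 * m0 - G0" "m0 = M0 \<Longrightarrow> W' r = \<nu>0" by auto
  qed
  show ?thesis
  proof (rule Q_chord[OF m00 m0r rM0 r(2) W_m0 W_M0])
    fix s assume "m0 \<le> s" "s \<le> M0"
    then show "\<nu>0 * s - G0 \<le> W s" using inner[of s] W_m0 W_M0 by (cases "s = m0 \<or> s = M0") auto
  qed (rule tangent)
qed

end

subsection \<open>Uniform bounds\<close>

lemma frac_square_integral:
  assumes g: "g \<in> borel_measurable borel" "set_integrable lborel {0..1} (\<lambda>x. (g x)\<^sup>2)"
  shows "(\<lambda>x. g (frac x)) \<in> borel_measurable borel" "periodic1 (\<lambda>x. (g (frac x))\<^sup>2)"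
    "set_integrable lborel {0..1} (\<lambda>x. (g (frac x))\<^sup>2)"
    "(LINT x:{0..1}|lborel. (g (frac x))\<^sup>2) = (LINT x:{0..1}|lborel. (g x)\<^sup>2)"
proof -
  have fracm: "(frac :: real \<Rightarrow> real) \<in> borel_measurable borel" unfolding frac_def[abs_def] by measurable
  show gfm: "(\<lambda>x. g (frac x)) \<in> borel_measurable borel" using g(1) fracm by measurable
  show "periodic1 (\<lambda>x. (g (frac x))\<^sup>2)" by (simp add: periodic1_def frac_1_eq)
  have ae: "AE x in lborel. indicator {0..1} x *\<^sub>R (g x)\<^sup>2 = indicator {0..1} x *\<^sub>R (g (frac x))\<^sup>2"
    using AE_lborel_singleton[of "1::real"] by eventually_elim (auto simp: indicator_def frac_eq)
  have m: "(\<lambda>x. indicator {0..1} x *\<^sub>R (g x)\<^sup>2) \<in> borel_measurable lborel"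
    "(\<lambda>x. indicator {0..1} x *\<^sub>R (g (frac x))\<^sup>2) \<in> borel_measurable lborel"
    using g(1) gfm by measurable
  show "set_integrable lborel {0..1} (\<lambda>x. (g (frac x))\<^sup>2)"
    using g(2) unfolding set_integrable_def by (rule integrable_cong_AE_imp[OF _ m(2)]) (use ae in \<open>auto elim: eventually_mono\<close>)
  show "(LINT x:{0..1}|lborel. (g (frac x))\<^sup>2) = (LINT x:{0..1}|lborel. (g x)\<^sup>2)"
    unfolding set_lebesgue_integral_def using ae by (intro integral_cong_AE m) (auto elim: eventually_mono)
qed

context potential
begin

text \<open>A finite energy forces the branch of \<open>Eeps\<close> with \<open>H1\<close>, and
  there the chosen weak derivative agrees almost everywhere with the classical one.\<close>

lemma energy_bound:
  assumes \<rho>: "periodic1 \<rho>" "\<And>x. (\<rho> has_real_derivative \<rho>' x) (at x)" "continuous_on UNIV \<rho>'" "\<And>x. 0 \<le> \<rho> x"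
    and E: "Eeps W \<epsilon> \<rho> \<le> ennreal C" and C: "0 \<le> C"
  shows "(LINT x:{0..1}|lborel. \<epsilon>\<^sup>2 / 2 * (\<rho>' x)\<^sup>2 + W (\<rho> x)) \<le> C"
proof -
  have \<rho>c: "continuous_on A \<rho>" for A
    using \<rho>(2) by (meson DERIV_continuous continuous_at_imp_continuous_on)
  have \<rho>'c: "continuous_on A \<rho>'" for A using \<rho>(3) continuous_on_subset by blast
  have Wc: "continuous_on A (\<lambda>x. W (\<rho> x))" for A
    using \<rho>(4) by (auto intro!: continuous_on_compose2[OF W_cont \<rho>c])
  define e where "e x = \<epsilon>\<^sup>2 / 2 * (\<rho>' x)\<^sup>2 + W (\<rho> x)" for x
  have e: "continuous_on A e" "0 \<le> e x" for A x
    unfolding e_def using W_nonneg[OF \<rho>(4)] by (auto intro!: continuous_intros Wc \<rho>'c)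
  have wd: "AE x in lborel. x \<in> {0..1} \<longrightarrow> wd \<rho> x = \<rho>' x"
    by (rule wd_AE[OF weak_deriv_C1[OF \<rho>(1-3)]])
  have "H1 \<rho>" using E by (auto simp: Eeps_def top_unique split: if_splits)
  then have "Eeps W \<epsilon> \<rho> = (\<integral>\<^sup>+ x\<in>{0..1}. ennreal (\<epsilon>\<^sup>2 / 2 * (wd \<rho> x)\<^sup>2 + W (\<rho> x)) \<partial>lborel)"
    by (simp add: Eeps_def)
  also have "\<dots> = (\<integral>\<^sup>+ x. ennreal (indicator {0..1} x *\<^sub>R e x) \<partial>lborel)"
    using wd by (intro nn_integral_cong_AE) (auto elim!: eventually_mono simp: e_def indicator_def)
  also have "\<dots> = ennreal (LINT x:{0..1}|lborel. e x)"
    unfolding set_lebesgue_integral_def using set_integrable_continuous[OF e(1)] e(2)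
    by (intro nn_integral_eq_integral) (auto simp: set_integrable_def)
  finally have "ennreal (LINT x:{0..1}|lborel. e x) \<le> ennreal C" using E by simp
  then show ?thesis using C by (simp add: e_def)
qed

text \<open>\<open>G\<close> is the flux \<open>prim s - c\<close> and \<open>H\<close> the
  primitive of \<open>\<bar>s\<bar>\<close>. Cauchy-Schwarz with unit mass bounds the oscillation of
  \<open>G\<close> by \<open>L\<close>, the energy bounds its mean, and at a maximum of
  \<open>\<rho>\<close> the equation bounds \<open>\<rho> W'(\<rho>) - W(\<rho>)\<close> by
  \<open>G\<close>. Once \<open>\<rho> \<le> M\<close> is known, Cauchy-Schwarz gives the Hoelder
  constant \<open>sqrt M * L\<close>.\<close>

lemma profile_exists:
  assumes \<rho>: "prob_density \<rho>" "Ck_on 1 UNIV \<rho>" and \<epsilon>: "0 < \<epsilon>"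
    and g: "g \<in> Tset W W' \<epsilon> \<rho>" "(LINT x:{0..1}|lborel. (g x)\<^sup>2) \<le> L\<^sup>2" and L: "0 \<le> L"
    and E: "Eeps W \<epsilon> \<rho> \<le> ennreal C" and C: "0 \<le> C"
    and C1: "0 \<le> C1" "\<And>y. 0 \<le> y \<Longrightarrow> \<bar>y * W' y - W y\<bar> \<le> C1 * (1 + W y)"
    and M: "\<And>y. 0 \<le> y \<Longrightarrow> y * W' y - W y \<le> C1 * (1 + C) + 3 * C + L \<Longrightarrow> y \<le> M"
  shows "\<exists>G H. profile W W' \<epsilon> (sqrt M * L) M \<rho> (deriv \<rho>) G H \<and>
    (\<forall>x. \<bar>G x\<bar> \<le> C1 * (1 + C) + 3 * C + L) \<and> periodic1 G \<and>
    (\<forall>x y. x \<le> y \<longrightarrow> 0 \<le> x \<longrightarrow> y \<le> 1 \<longrightarrow> H y - H x = (LINT t:{x..y}|lborel. sqrt (\<rho> t) * \<bar>g t\<bar>))"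
proof -
  have \<rho>p: "periodic1 \<rho>" and \<rho>nn: "\<And>x. 0 \<le> \<rho> x" and \<rho>1: "(LINT x:{0..1}|lborel. \<rho> x) = 1"
    and \<rho>i: "set_integrable lborel {0..1} \<rho>" and \<rho>m: "\<rho> \<in> borel_measurable borel"
    using \<rho>(1) by (auto simp: prob_density_def)
  define \<rho>' where "\<rho>' = deriv \<rho>"
  have \<rho>d: "(\<rho> has_real_derivative \<rho>' x) (at x)" for x
    using \<rho>(2) by (simp add: Ck_on_def \<rho>'_def DERIV_deriv_iff_real_differentiable)
  have \<rho>'c0: "continuous_on UNIV \<rho>'" using \<rho>(2) by (simp add: Ck_on_def \<rho>'_def)
  have \<rho>c: "continuous_on A \<rho>" for A
    using \<rho>d by (meson DERIV_continuous continuous_at_imp_continuous_on)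
  have \<rho>'c: "continuous_on A \<rho>'" for A using \<rho>'c0 continuous_on_subset by blast
  have Wc: "continuous_on A (\<lambda>x. W (\<rho> x))" "continuous_on A (\<lambda>x. W' (\<rho> x))" for A
    using \<rho>nn by (auto intro!: continuous_on_compose2[OF W_cont \<rho>c] continuous_on_compose2[OF W'_cont \<rho>c])
  define s where "s = (\<lambda>x. sqrt (\<rho> x) * g (frac x))"
  obtain c where c: "\<And>x. ((\<lambda>x. \<rho> x * \<rho>' x) has_real_derivative
        (\<rho> x * W' (\<rho> x) - W (\<rho> x) + 3 * \<epsilon>\<^sup>2 / 2 * (\<rho>' x)\<^sup>2 - (prim s x - c)) / \<epsilon>\<^sup>2) (at x)"
    and Pp: "periodic1 (prim s)"
    and mean: "(LINT x:{0..1}|lborel. prim s x - c) =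
      (LINT x:{0..1}|lborel. \<rho> x * W' (\<rho> x) - W (\<rho> x) + 3 * \<epsilon>\<^sup>2 / 2 * (\<rho>' x)\<^sup>2)"
    and sp: "periodic1 s" and si: "set_integrable lborel {0..1} s"
    by (rule Tset_strong_form[OF \<rho>p \<rho>d \<rho>'c0 \<rho>nn \<epsilon> g(1), folded s_def]) (rule that)
  have gm: "g \<in> borel_measurable borel" and g2: "set_integrable lborel {0..1} (\<lambda>x. (g x)\<^sup>2)"
    using g by (auto simp: Tset_def)
  note gf = frac_square_integral[OF gm g2]
  define G where "G x = prim s x - c" for x
  define H where "H = prim (\<lambda>x. \<bar>s x\<bar>)"
  have ap: "periodic1 (\<lambda>x. \<bar>s x\<bar>)" using sp by (simp add: periodic1_def)
  have ai: "set_integrable lborel {0..1} (\<lambda>x. \<bar>s x\<bar>)" using si by (rule set_integrable_abs)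
  have sI: "set_integrable lborel {a..b} s" and aI: "set_integrable lborel {a..b} (\<lambda>x. \<bar>s x\<bar>)" for a b
    by (auto intro: periodic1_set_integrable sp si ap ai)
  have G_diff: "G y - G x = (LINT t:{x..y}|lborel. s t)" if "x \<le> y" for x y
    using prim_diff[OF sI that] by (simp add: G_def)
  have H_diff: "H y - H x = (LINT t:{x..y}|lborel. \<bar>s t\<bar>)" if "x \<le> y" for x y
    using prim_diff[OF aI that] by (simp add: H_def)
  have GH: "\<bar>G y - G x\<bar> \<le> H y - H x" if "x \<le> y" for x y
    unfolding G_diff[OF that] H_diff[OF that] by (intro LINT_abs_bound sI aI) simp
  have sm: "(\<lambda>x. sqrt (\<rho> x)) \<in> borel_measurable borel" using \<rho>m by measurable
  have H_CS: "H y - H x \<le> sqrt (LINT t:{x..y}|lborel. \<rho> t) * L" if xy: "x \<le> y" "y - x \<le> 1" for x y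
  proof -
    have i1: "set_integrable lborel {x..y} (\<lambda>t. (sqrt (\<rho> t))\<^sup>2)" using \<rho>nn \<rho>c by (simp add: set_integrable_continuous)
    have i2: "set_integrable lborel {x..y} (\<lambda>t. (\<bar>g (frac t)\<bar>)\<^sup>2)"
      using periodic1_set_integrable[OF gf(2,3)] by simp
    have gam: "(\<lambda>x. \<bar>g (frac x)\<bar>) \<in> borel_measurable borel" using gf(1) by measurable
    have "H y - H x = (LINT t:{x..y}|lborel. sqrt (\<rho> t) * \<bar>g (frac t)\<bar>)"
      using H_diff[OF xy(1)] \<rho>nn by (simp add: s_def abs_mult)
    also have "\<dots> \<le> sqrt (LINT t:{x..y}|lborel. (sqrt (\<rho> t))\<^sup>2) * sqrt (LINT t:{x..y}|lborel. \<bar>g (frac t)\<bar>\<^sup>2)"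
      using set_integral_Cauchy_Schwarz(2)[OF _ sm gam i1 i2] by simp
    also have "\<dots> \<le> sqrt (LINT t:{x..y}|lborel. \<rho> t) * L"
    proof -
      have "(LINT t:{x..y}|lborel. \<bar>g (frac t)\<bar>\<^sup>2) \<le> (LINT t:{0..1}|lborel. (g (frac t))\<^sup>2)"
        unfolding power2_abs using xy by (intro periodic1_integral_le_unit gf(2,3)) auto
      also have "\<dots> \<le> L\<^sup>2" using gf(4) g(2) by simp
      finally have "sqrt (LINT t:{x..y}|lborel. \<bar>g (frac t)\<bar>\<^sup>2) \<le> L" using L by (intro real_le_lsqrt) auto
      moreover have "0 \<le> (LINT t:{x..y}|lborel. \<rho> t)" using \<rho>nn by (simp add: set_lebesgue_integral_def)
      ultimately show ?thesis using \<rho>nn by (intro mult_mono) (auto simp: set_lebesgue_integral_def)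
    qed
    finally show ?thesis .
  qed
  have Gc: "continuous_on A G" for A
    unfolding G_def using continuous_on_subset[OF prim_continuous[OF sI]] by (intro continuous_intros) auto
  have Gp: "periodic1 G" using Pp by (simp add: G_def periodic1_def)
  define A where "A x = \<rho> x * W' (\<rho> x) - W (\<rho> x) + 3 * \<epsilon>\<^sup>2 / 2 * (\<rho>' x)\<^sup>2" for x
  have Ac: "continuous_on S A" for S unfolding A_def by (intro continuous_intros Wc \<rho>c \<rho>'c)
  have one: "(LINT x:{0..1::real}|lborel. k) = k" for k :: real by (simp add: set_lebesgue_integral_def)
  \<comment> \<open>The term \<open>3 \<epsilon>^2 / 2 * \<rho>'^2\<close> is three times the
    kinetic energy density, whence \<open>3 * C\<close>; the rest is controlled by
    \<open>C1 * (1 + W)\<close>.\<close>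
  have A_bound: "\<bar>LINT x:{0..1}|lborel. A x\<bar> \<le> C1 * (1 + C) + 3 * C"
  proof -
    define e where "e x = \<epsilon>\<^sup>2 / 2 * (\<rho>' x)\<^sup>2 + W (\<rho> x)" for x
    have ec: "continuous_on S e" for S unfolding e_def by (intro continuous_intros Wc \<rho>'c)
    have "(LINT x:{0..1}|lborel. e x) \<le> C"
      unfolding e_def by (rule energy_bound[OF \<rho>p \<rho>d \<rho>'c0 \<rho>nn E C])
    then have "C1 + (C1 + 3) * (LINT x:{0..1}|lborel. e x) \<le> C1 + (C1 + 3) * C"
      using C1 by (intro add_left_mono mult_left_mono) auto
    moreover have "\<bar>LINT x:{0..1}|lborel. A x\<bar> \<le> (LINT x:{0..1}|lborel. C1 + (C1 + 3) * e x)"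
    proof (intro LINT_abs_bound set_integrable_continuous Ac)
      show "continuous_on {0..1} (\<lambda>x. C1 + (C1 + 3) * e x)" by (intro continuous_intros ec)
      fix x
      define v w where "v = \<epsilon>\<^sup>2 / 2 * (\<rho>' x)\<^sup>2" and "w = W (\<rho> x)"
      have vw: "0 \<le> v" "0 \<le> w" using W_nonneg[OF \<rho>nn] by (auto simp: v_def w_def)
      have "A x = (\<rho> x * W' (\<rho> x) - W (\<rho> x)) + 3 * v" by (simp add: A_def v_def)
      then have "\<bar>A x\<bar> \<le> C1 * (1 + w) + 3 * v"
        using C1(2)[OF \<rho>nn, of x] vw unfolding w_def by linarith
      also have "\<dots> \<le> C1 + (C1 + 3) * (v + w)"
        using mult_nonneg_nonneg[OF C1(1) vw(1)] vw by (simp add: algebra_simps)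
      also have "v + w = e x" by (simp add: e_def v_def w_def)
      finally show "\<bar>A x\<bar> \<le> C1 + (C1 + 3) * e x" .
    qed
    moreover have "(LINT x:{0..1}|lborel. C1 + (C1 + 3) * e x) = C1 + (C1 + 3) * (LINT x:{0..1}|lborel. e x)"
    proof -
      have "(LINT x:{0..1}|lborel. C1 + (C1 + 3) * e x) = (LINT x:{0..1::real}|lborel. C1) + (LINT x:{0..1}|lborel. (C1 + 3) * e x)"
        by (intro set_integral_add set_integrable_continuous continuous_intros ec)
      then show ?thesis by (simp add: one)
    qed
    ultimately show ?thesis by (simp add: algebra_simps)
  qed
  have G_bound: "\<bar>G x\<bar> \<le> C1 * (1 + C) + 3 * C + L" for x
  proof -
    define y where "y = frac x"
    have y: "0 \<le> y" "y \<le> 1" using frac_lt_1[of x] by (auto simp: y_def)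
    have H01: "H 1 - H 0 \<le> L" using H_CS[of 0 1] \<rho>1 by simp
    have Hmono: "H a \<le> H b" if "a \<le> b" for a b using GH[OF that] by simp
    have osc: "\<bar>G y - G t\<bar> \<le> L" if "t \<in> {0..1}" for t
    proof (cases "t \<le> y")
      case True
      then show ?thesis using GH[OF True] Hmono[of 0 t] Hmono[of y 1] that y H01 by auto
    next
      case False
      then show ?thesis using GH[of y t] Hmono[of 0 y] Hmono[of t 1] that y H01 by auto
    qed
    have "G y - (LINT t:{0..1}|lborel. G t) = (LINT t:{0..1}|lborel. G y - G t)"
      by (subst set_integral_diff) (auto simp: one intro!: set_integrable_continuous Gc)
    moreover have "\<bar>LINT t:{0..1}|lborel. G y - G t\<bar> \<le> (LINT t:{0..1::real}|lborel. L)"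
      by (intro LINT_abs_bound set_integrable_continuous continuous_intros Gc osc)
    moreover have "(LINT t:{0..1}|lborel. G t) = (LINT t:{0..1}|lborel. A t)"
      using mean by (simp add: G_def A_def)
    ultimately have "\<bar>G y\<bar> \<le> C1 * (1 + C) + 3 * C + L" using A_bound one[of L] by linarith
    then show ?thesis using periodic1_frac[OF Gp] by (simp add: y_def)
  qed
  have u_le: "\<rho> x \<le> M" for x
  proof -
    obtain y where y: "y \<in> {0..1}" "\<And>t. t \<in> {0..1} \<Longrightarrow> \<rho> t \<le> \<rho> y"
      using continuous_attains_sup[of "{0..1::real}" \<rho>] \<rho>c by fastforce
    have max: "\<rho> t \<le> \<rho> y" for t
    proof -
      have "frac t \<in> {0..1}" using frac_lt_1[of t] by auto
      then show ?thesis using y(2) periodic1_frac[OF \<rho>p] by metis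
    qed
    have \<rho>'y: "\<rho>' y = 0" by (rule DERIV_local_max[OF \<rho>d zero_less_one]) (use max in auto)
    \<comment> \<open>\<open>\<rho> \<rho>'\<close> vanishes at the maximum. A positive derivative
      would make it, and so \<open>\<rho>'\<close>, positive just to the right, and
      \<open>\<rho>\<close> would increase.\<close>
    have "(\<rho> y * W' (\<rho> y) - W (\<rho> y) + 3 * \<epsilon>\<^sup>2 / 2 * (\<rho>' y)\<^sup>2 - (prim s y - c)) / \<epsilon>\<^sup>2 \<le> 0"
    proof (rule ccontr)
      assume "\<not> ?thesis"
      then obtain d where d: "0 < d" "\<And>h. 0 < h \<Longrightarrow> h < d \<Longrightarrow> \<rho> y * \<rho>' y < \<rho> (y + h) * \<rho>' (y + h)"
        using DERIV_pos_inc_right[OF c[of y]] by auto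
      obtain \<xi> where \<xi>: "y < \<xi>" "\<xi> < y + d" "\<rho> (y + d) - \<rho> y = d * \<rho>' \<xi>"
        using MVT2[of y "y + d" \<rho> \<rho>'] \<rho>d d(1) by auto
      have "0 < \<rho> \<xi> * \<rho>' \<xi>" using d(2)[of "\<xi> - y"] \<xi> \<rho>'y by simp
      then have "0 < \<rho>' \<xi>" using \<rho>nn[of \<xi>] by (simp add: zero_less_mult_iff)
      then have "\<rho> y < \<rho> (y + d)" using \<xi>(3) d(1) by (smt (verit) mult_pos_pos)
      then show False using max[of "y + d"] by simp
    qed
    then have "\<rho> y * W' (\<rho> y) - W (\<rho> y) \<le> G y" using \<epsilon> \<rho>'y by (simp add: G_def divide_le_0_iff)
    then have "\<rho> y \<le> M" using G_bound[of y] \<rho>nn by (intro M) auto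
    then show ?thesis using max[of x] by simp
  qed
  have holder: "H y - H x \<le> sqrt M * L * sqrt (y - x)" if xy: "x \<le> y" "y - x \<le> 1" for x y
  proof -
    have "(LINT t:{x..y}|lborel. \<rho> t) \<le> (LINT t:{x..y}|lborel. M)"
      using u_le \<rho>c by (intro set_integral_mono set_integrable_continuous) auto
    also have "\<dots> = M * (y - x)" using xy by (simp add: set_lebesgue_integral_def)
    finally have "sqrt (LINT t:{x..y}|lborel. \<rho> t) \<le> sqrt (M * (y - x))" by simp
    then have "sqrt (LINT t:{x..y}|lborel. \<rho> t) * L \<le> sqrt (M * (y - x)) * L" using L by (rule mult_right_mono)
    then show ?thesis using H_CS[OF xy] by (simp add: real_sqrt_mult mult_ac)
  qed
  have "profile W W' \<epsilon> (sqrt M * L) M \<rho> \<rho>' G H"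
    by unfold_locales (use \<epsilon> \<rho>d \<rho>'c0 \<rho>nn u_le c GH holder in \<open>auto simp: G_def[abs_def]\<close>)
  moreover have "H y - H x = (LINT t:{x..y}|lborel. sqrt (\<rho> t) * \<bar>g t\<bar>)" if "x \<le> y" "0 \<le> x" "y \<le> 1" for x y
  proof -
    have gam: "(\<lambda>x. \<bar>g (frac x)\<bar>) \<in> borel_measurable borel" "(\<lambda>x. \<bar>g x\<bar>) \<in> borel_measurable borel"
      using gf(1) gm by measurable
    have m: "(\<lambda>t. indicator {x..y} t *\<^sub>R (sqrt (\<rho> t) * \<bar>g (frac t)\<bar>)) \<in> borel_measurable lborel"
       "(\<lambda>t. indicator {x..y} t *\<^sub>R (sqrt (\<rho> t) * \<bar>g t\<bar>)) \<in> borel_measurable lborel"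
      using sm gam by measurable
    have ae: "AE t in lborel. indicator {x..y} t *\<^sub>R (sqrt (\<rho> t) * \<bar>g (frac t)\<bar>) = indicator {x..y} t *\<^sub>R (sqrt (\<rho> t) * \<bar>g t\<bar>)"
      using AE_lborel_singleton[of "1::real"] by eventually_elim (use that in \<open>auto simp: indicator_def frac_eq\<close>)
    have "H y - H x = (LINT t:{x..y}|lborel. sqrt (\<rho> t) * \<bar>g (frac t)\<bar>)"
      using H_diff[OF that(1)] \<rho>nn by (simp add: s_def abs_mult)
    also have "\<dots> = (LINT t:{x..y}|lborel. sqrt (\<rho> t) * \<bar>g t\<bar>)"
      unfolding set_lebesgue_integral_def by (intro integral_cong_AE m ae)
    finally show ?thesis .
  qed
  ultimately show ?thesis using G_bound Gp unfolding \<rho>'_def by blast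
qed

end

subsection \<open>Compactness\<close>

context potential
begin

text \<open>Only the values of \<open>Q\<close> are assumed to converge; the densities at
  \<open>z n\<close> lie in a compact interval, so a subsequence has a limit \<open>r\<close> with
  \<open>f = Q r\<close>. The case \<open>r = 0\<close> is covered because 0 is rational.\<close>

lemma profile_limit_Q:
  assumes prof: "\<And>n. profile W W' (\<epsilon> n) K M (u n) (u' n) (G n) (H n)"
    and \<epsilon>: "\<epsilon> \<longlonglongrightarrow> 0" and z: "z \<longlonglongrightarrow> x0"
    and f: "(\<lambda>n. Q (u n (z n))) \<longlonglongrightarrow> f" and G: "(\<lambda>n. G n x0) \<longlonglongrightarrow> G0"
  shows "f = G0 \<or> f \<in> Q ` \<rat>"
proof -
  have u: "\<forall>n. u n (z n) \<in> {0..M}"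
    using profile.u_nonneg[OF prof] profile.u_le[OF prof] by auto
  obtain r k where r: "r \<in> {0..M}" "strict_mono (k :: nat \<Rightarrow> nat)" "((\<lambda>n. u n (z n)) \<circ> k) \<longlonglongrightarrow> r"
    by (rule seq_compactE[OF compact_imp_seq_compact[OF compact_Icc] u]) (rule that)
  have k: "filterlim k at_top sequentially" by (rule filterlim_subseq[OF r(2)])
  have lim: "(\<lambda>n. u (k n) (z (k n))) \<longlonglongrightarrow> r" using r(3) by (simp add: o_def)
  have "(\<lambda>n. Q (u (k n) (z (k n)))) \<longlonglongrightarrow> Q r"
    by (rule continuous_on_tendsto_compose[OF Q_cont lim]) (use r(1) u in auto)
  moreover have "(\<lambda>n. Q (u (k n) (z (k n)))) \<longlonglongrightarrow> f" using filterlim_compose[OF f k] .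
  ultimately have f_eq: "f = Q r" by (rule LIMSEQ_unique[symmetric])
  show ?thesis
  proof (cases "r = 0")
    case True
    then show ?thesis using f_eq by auto
  next
    case False
    then have "0 < r" using r(1) by auto
    show ?thesis
      unfolding f_eq
      by (rule profile_limit_value[where \<epsilon> = "\<epsilon> \<circ> k" and u = "u \<circ> k" and u' = "u' \<circ> k" and G = "G \<circ> k" and H = "H \<circ> k" and z = "z \<circ> k"])
        (use prof lim \<open>0 < r\<close> filterlim_compose[OF \<epsilon> k] filterlim_compose[OF z k] filterlim_compose[OF G k] in \<open>auto simp: o_def\<close>)
  qed
qed

text \<open>If equicontinuity failed at \<open>x\<close>, then \<open>Q (u n)\<close> would take all values of an interval near \<open>x\<close>
  along a subsequence, but only countably many limit values are possible.\<close>
lemma Q_profile_equicontinuous: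
  assumes prof: "\<And>n. profile W W' (\<epsilon> n) K M (u n) (u' n) (G n) (H n)"
    and \<epsilon>: "\<epsilon> \<longlonglongrightarrow> 0" and G: "(\<lambda>n. G n x) \<longlonglongrightarrow> G0" and e: "0 < e"
  shows "\<exists>d>0. \<forall>n y. \<bar>x - y\<bar> < d \<longrightarrow> \<bar>Q (u n x) - Q (u n y)\<bar> < e"
proof -
  have u: "u n y \<in> {0..M}" for n y
    using profile.u_nonneg[OF prof] profile.u_le[OF prof] by auto
  have Fc: "continuous_on S (\<lambda>y. Q (u n y))" for S n
    by (rule continuous_on_compose2[OF Q_cont profile.u_cont[OF prof]]) (use u in auto)
  have Fb: "Q (u n y) \<in> {0..Q M}" for n y
    using u[of n y] Q_nonneg Q_mono by auto
  \<comment> \<open>The asymptotic statement is the substance; the finitely many remaining indices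
    are handled by continuity of each function and a minimum of radii.\<close>
  have asym: "\<exists>d>0. \<exists>N. \<forall>n\<ge>N. \<forall>y. \<bar>x - y\<bar> < d \<longrightarrow> \<bar>Q (u n x) - Q (u n y)\<bar> < e"
  proof (rule ccontr)
    assume neg: "\<not> ?thesis"
    have "\<exists>n y. n \<ge> i \<and> \<bar>x - y\<bar> < inverse (real (Suc i)) \<and> e \<le> \<bar>Q (u n x) - Q (u n y)\<bar>" for i
    proof -
      have "inverse (real (Suc i)) > 0" by simp
      then show ?thesis using neg by (metis not_less)
    qed
    then obtain n y where ny: "\<And>i. n i \<ge> i" "\<And>i. \<bar>x - y i\<bar> < inverse (real (Suc i))"
      "\<And>i. e \<le> \<bar>Q (u (n i) x) - Q (u (n i) (y i))\<bar>" by metis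
    have cpt: "compact ({0..Q M} \<times> {0..Q M})" by (intro compact_Times compact_Icc)
    have mem: "\<forall>i. (Q (u (n i) x), Q (u (n i) (y i))) \<in> {0..Q M} \<times> {0..Q M}" using Fb by auto
    obtain l k where k: "strict_mono (k :: nat \<Rightarrow> nat)" and l: "((\<lambda>i. (Q (u (n i) x), Q (u (n i) (y i)))) \<circ> k) \<longlonglongrightarrow> l"
      by (rule seq_compactE[OF compact_imp_seq_compact[OF cpt] mem]) (rule that)
    obtain f1 f2 where l_eq: "l = (f1, f2)" by (cases l)
    have lims: "(\<lambda>i. Q (u (n (k i)) x)) \<longlonglongrightarrow> f1" "(\<lambda>i. Q (u (n (k i)) (y (k i)))) \<longlonglongrightarrow> f2"
      using tendsto_fst[OF l] tendsto_snd[OF l] by (simp_all add: l_eq o_def)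
    have "e \<le> \<bar>f1 - f2\<bar>"
      by (rule LIMSEQ_le_const[OF tendsto_rabs[OF tendsto_diff[OF lims]]]) (use ny(3) in auto)
    then have "min f1 f2 < max f1 f2" using e by auto
    then have "uncountable {min f1 f2<..<max f1 f2}" by (simp add: uncountable_open_interval)
    \<comment> \<open>An interval is uncountable, so some \<open>f\<close> strictly between the two
      limits is neither the limit flux nor an exceptional value. The intermediate value theorem
      produces points tending to \<open>x\<close> where \<open>Q (u n)\<close> equals this
      \<open>f\<close>.\<close>
    then obtain f where f: "f \<in> {min f1 f2<..<max f1 f2}" "f \<notin> insert G0 (Q ` \<rat>)"
      using countable_subset[of "{min f1 f2<..<max f1 f2}" "insert G0 (Q ` \<rat>)"] countable_Q_Rats by blast
    have nk: "filterlim (\<lambda>i. n (k i)) at_top sequentially"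
    proof (rule filterlim_at_top_mono[OF filterlim_subseq[OF k]])
      show "\<forall>\<^sub>F i in sequentially. k i \<le> n (k i)" using ny(1) by simp
    qed
    have ivt: "\<exists>z. \<bar>x - z\<bar> \<le> \<bar>x - w\<bar> \<and> Q (u m z) = f"
      if "min (Q (u m x)) (Q (u m w)) \<le> f" "f \<le> max (Q (u m x)) (Q (u m w))" for m w
    proof -
      let ?S = "(\<lambda>z. Q (u m z)) ` closed_segment x w"
      have con: "connected ?S" by (rule connected_continuous_image[OF Fc connected_segment(1)])
      have ends: "Q (u m x) \<in> ?S" "Q (u m w) \<in> ?S" by auto
      have "f \<in> ?S"
      proof (cases "Q (u m x) \<le> Q (u m w)")
        case True
        then show ?thesis using connected_contains_Icc[OF con ends] that by auto
      next
        case False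
        then show ?thesis using connected_contains_Icc[OF con ends(2,1)] that by auto
      qed
      then obtain z where z: "z \<in> closed_segment x w" "Q (u m z) = f" by auto
      have "\<bar>x - z\<bar> \<le> \<bar>x - w\<bar>" using z(1) by (auto simp: closed_segment_eq_real_ivl split: if_splits)
      then show ?thesis using z(2) by blast
    qed
    have "\<forall>\<^sub>F i in sequentially. \<exists>z. \<bar>x - z\<bar> \<le> \<bar>x - y (k i)\<bar> \<and> Q (u (n (k i)) z) = f"
    proof (cases "f1 < f2")
      case True
      then have "\<forall>\<^sub>F i in sequentially. Q (u (n (k i)) x) < f" "\<forall>\<^sub>F i in sequentially. f < Q (u (n (k i)) (y (k i)))"
        using f(1) order_tendstoD(2)[OF lims(1), of f] order_tendstoD(1)[OF lims(2), of f] by auto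
      then show ?thesis by eventually_elim (rule ivt; simp)
    next
      case False
      then have "\<forall>\<^sub>F i in sequentially. f < Q (u (n (k i)) x)" "\<forall>\<^sub>F i in sequentially. Q (u (n (k i)) (y (k i))) < f"
        using f(1) order_tendstoD(1)[OF lims(1), of f] order_tendstoD(2)[OF lims(2), of f] by auto
      then show ?thesis by eventually_elim (rule ivt; simp)
    qed
    then obtain N where N: "\<And>i. i \<ge> N \<Longrightarrow> \<exists>z. \<bar>x - z\<bar> \<le> \<bar>x - y (k i)\<bar> \<and> Q (u (n (k i)) z) = f"
      unfolding eventually_sequentially by blast
    then have "\<forall>i. \<exists>z. \<bar>x - z\<bar> \<le> \<bar>x - y (k (i + N))\<bar> \<and> Q (u (n (k (i + N))) z) = f" by simp
    then obtain z where z: "\<And>i. \<bar>x - z i\<bar> \<le> \<bar>x - y (k (i + N))\<bar>" "\<And>i. Q (u (n (k (i + N))) (z i)) = f" by metis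
    define j where "j i = n (k (i + N))" for i
    have j: "filterlim j at_top sequentially"
      unfolding j_def using filterlim_compose[OF nk filterlim_add_const_nat_at_top] .
    have "(\<lambda>i. x - z i) \<longlonglongrightarrow> 0"
    proof (rule Lim_null_comparison[OF _ LIMSEQ_inverse_real_of_nat])
      have "norm (x - z i) \<le> inverse (real (Suc i))" for i
      proof -
        have "i \<le> k (i + N)" using seq_suble[OF k, of "i + N"] by simp
        then have "inverse (real (Suc (k (i + N)))) \<le> inverse (real (Suc i))" by (intro le_imp_inverse_le) auto
        then show ?thesis using z(1)[of i] ny(2)[of "k (i + N)"] unfolding real_norm_def by linarith
      qed
      then show "\<forall>\<^sub>F i in sequentially. norm (x - z i) \<le> inverse (real (Suc i))" by simp
    qed
    from tendsto_diff[OF tendsto_const[of x] this] have zx: "z \<longlonglongrightarrow> x" by simp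
    have "f = G0 \<or> f \<in> Q ` \<rat>"
      by (rule profile_limit_Q[where \<epsilon> = "\<epsilon> \<circ> j" and u = "u \<circ> j" and u' = "u' \<circ> j" and G = "G \<circ> j" and H = "H \<circ> j" and z = z])
        (use prof zx filterlim_compose[OF \<epsilon> j] filterlim_compose[OF G j] z(2) in \<open>auto simp: o_def j_def\<close>)
    then show False using f(2) by auto
  qed
  then obtain d0 N where d0: "d0 > 0" "\<And>n y. n \<ge> N \<Longrightarrow> \<bar>x - y\<bar> < d0 \<Longrightarrow> \<bar>Q (u n x) - Q (u n y)\<bar> < e"
    by blast
  have "\<exists>d>0. \<forall>y. \<bar>x - y\<bar> < d \<longrightarrow> \<bar>Q (u n x) - Q (u n y)\<bar> < e" for n
  proof -
    have "isCont (\<lambda>y. Q (u n y)) x" using Fc[of UNIV n] by (simp add: continuous_on_eq_continuous_at)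
    then obtain d where "d > 0" "\<And>y. dist y x < d \<Longrightarrow> dist (Q (u n y)) (Q (u n x)) < e"
      using e unfolding continuous_at_eps_delta by blast
    then show ?thesis by (intro exI[of _ d]) (auto simp: dist_real_def abs_minus_commute)
  qed
  then obtain d where d: "\<And>n. d n > 0" "\<And>n y. \<bar>x - y\<bar> < d n \<Longrightarrow> \<bar>Q (u n x) - Q (u n y)\<bar> < e" by metis
  define D where "D = Min (insert d0 (d ` {..<N}))"
  have "D > 0" using d0(1) d(1) by (auto simp: D_def)
  moreover have "\<bar>Q (u n x) - Q (u n y)\<bar> < e" if "\<bar>x - y\<bar> < D" for n y
  proof (cases "n < N")
    case True
    then have "D \<le> d n" by (auto simp: D_def)
    then show ?thesis using d(2)[of y n] that by simp
  next
    case False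
    have "D \<le> d0" by (auto simp: D_def)
    then show ?thesis using d0(2)[of n y] that False by simp
  qed
  ultimately show ?thesis by blast
qed

end

text \<open>The compactness theorem is applied on one period, and its limit is extended by
  \<open>frac\<close>. Uniform convergence on the line then yields continuity also across the
  integers.\<close>

lemma periodic_Arzela_Ascoli:
  fixes f :: "nat \<Rightarrow> real \<Rightarrow> real"
  assumes per: "\<And>n. periodic1 (f n)" and bd: "\<And>n x. \<bar>f n x\<bar> \<le> B"
    and eq: "\<And>x e. 0 < e \<Longrightarrow> \<exists>d>0. \<forall>n y. \<bar>x - y\<bar> < d \<longrightarrow> \<bar>f n x - f n y\<bar> < e"
  obtains g k where "continuous_on UNIV g" "periodic1 g" "strict_mono (k :: nat \<Rightarrow> nat)"
    "\<And>e. 0 < e \<Longrightarrow> \<exists>N. \<forall>n\<ge>N. \<forall>x. \<bar>f (k n) x - g x\<bar> < e"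
proof -
  obtain g0 k where k: "strict_mono (k :: nat \<Rightarrow> nat)"
    and g0: "\<And>e. 0 < e \<Longrightarrow> \<exists>N. \<forall>n x. n \<ge> N \<and> x \<in> {0..1} \<longrightarrow> norm (f (k n) x - g0 x) < e"
  proof (rule Arzela_Ascoli[of "{0..1::real}" f B])
    fix x e :: real assume "0 < e"
    then show "\<exists>d>0. \<forall>n y. y \<in> {0..1} \<and> norm (x - y) < d \<longrightarrow> norm (f n x - f n y) < e"
      using eq[of e x] by (metis real_norm_def)
  qed (use bd in auto)
  define g where "g x = g0 (frac x)" for x
  have conv: "\<exists>N. \<forall>n\<ge>N. \<forall>x. \<bar>f (k n) x - g x\<bar> < e" if e: "0 < e" for e
  proof -
    obtain N where N: "\<And>n x. n \<ge> N \<Longrightarrow> x \<in> {0..1} \<Longrightarrow> norm (f (k n) x - g0 x) < e" using g0[OF e] by blast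
    have "\<bar>f (k n) x - g x\<bar> < e" if "n \<ge> N" for n x
      using N[OF that, of "frac x"] frac_lt_1[of x] periodic1_frac[OF per, of "k n" x] by (simp add: g_def less_imp_le)
    then show ?thesis by blast
  qed
  have "uniform_limit UNIV (\<lambda>n. f (k n)) g sequentially"
    unfolding uniform_limit_sequentially_iff using conv by (simp add: dist_real_def)
  moreover have "continuous_on UNIV (f (k n))" for n
    unfolding continuous_on_eq_continuous_at[OF open_UNIV] continuous_at_eps_delta
  proof (intro ballI allI impI)
    fix x e :: real assume "0 < e"
    then obtain d where "d > 0" "\<And>n y. \<bar>x - y\<bar> < d \<Longrightarrow> \<bar>f n x - f n y\<bar> < e" using eq by blast
    then show "\<exists>d>0. \<forall>x'. dist x' x < d \<longrightarrow> dist (f (k n) x') (f (k n) x) < e"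
      by (intro exI[of _ d]) (auto simp: dist_real_def abs_minus_commute)
  qed
  ultimately have gc: "continuous_on UNIV g"
    by (intro uniform_limit_theorem[where f = "\<lambda>n. f (k n)" and F = sequentially]) auto
  show ?thesis by (rule that[OF gc _ k conv]) (auto simp: g_def periodic1_def frac_1_eq)
qed

context potential
begin

text \<open>Two successive extractions: equicontinuity of \<open>Q (u n)\<close> relies on
  convergence of the fluxes, so these come first.\<close>

lemma profile_compactness:
  assumes prof: "\<And>n. profile W W' (\<epsilon> n) K M (u n) (u' n) (G n) (H n)"
    and \<epsilon>: "\<epsilon> \<longlonglongrightarrow> 0" and G: "\<And>n. periodic1 (G n)" "\<And>n x. \<bar>G n x\<bar> \<le> B" and u: "\<And>n. periodic1 (u n)"
  obtains G0 F k where "continuous_on UNIV G0" "continuous_on UNIV F" "periodic1 F" "strict_mono (k :: nat \<Rightarrow> nat)"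
    "\<And>e. 0 < e \<Longrightarrow> \<exists>N. \<forall>n\<ge>N. \<forall>x. \<bar>G (k n) x - G0 x\<bar> < e"
    "\<And>e. 0 < e \<Longrightarrow> \<exists>N. \<forall>n\<ge>N. \<forall>x. \<bar>Q (u (k n) x) - F x\<bar> < e"
    "\<And>x. F x = G0 x \<or> F x \<in> Q ` \<rat>"
proof -
  have Geq: "\<exists>d>0. \<forall>n y. \<bar>x - y\<bar> < d \<longrightarrow> \<bar>G n x - G n y\<bar> < e" if e: "0 < e" for x e
  proof -
    have K: "0 \<le> K" using profile.K_nonneg[OF prof] .
    define d where "d = min 1 ((e / (2 * (K + 1)))\<^sup>2)"
    have "\<bar>G n x - G n y\<bar> < e" if xy: "\<bar>x - y\<bar> < d" for n y
    proof -
      have "sqrt \<bar>x - y\<bar> \<le> e / (2 * (K + 1))"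
        using xy e K by (intro real_le_lsqrt) (auto simp: d_def)
      then have "K * sqrt \<bar>x - y\<bar> \<le> K * (e / (2 * (K + 1)))" using K by (intro mult_left_mono)
      also have "\<dots> < e" using K e by (simp add: field_simps add_nonneg_pos)
      finally show ?thesis using profile.G_holder[OF prof, of x y n] xy by (simp add: d_def)
    qed
    moreover have "d > 0" using e K by (auto simp: d_def)
    ultimately show ?thesis by blast
  qed
  obtain G0 k1 where G0: "continuous_on UNIV G0" "periodic1 G0" "strict_mono (k1 :: nat \<Rightarrow> nat)"
    "\<And>e. 0 < e \<Longrightarrow> \<exists>N. \<forall>n\<ge>N. \<forall>x. \<bar>G (k1 n) x - G0 x\<bar> < e"
    by (rule periodic_Arzela_Ascoli[of G B, OF G Geq]) (assumption | rule that)+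
  have G_lim: "(\<lambda>n. G (k1 n) x) \<longlonglongrightarrow> G0 x" for x
    by (rule LIMSEQ_I) (use G0(4) in fastforce)
  have \<epsilon>1: "(\<lambda>n. \<epsilon> (k1 n)) \<longlonglongrightarrow> 0" using filterlim_compose[OF \<epsilon> filterlim_subseq[OF G0(3)]] .
  have ub: "u n y \<in> {0..M}" for n y
    using profile.u_nonneg[OF prof] profile.u_le[OF prof] by auto
  have Fb: "\<bar>Q (u n y)\<bar> \<le> Q M" for n y
    using ub[of n y] Q_nonneg Q_mono by auto
  have Fp: "periodic1 (\<lambda>x. Q (u n x))" for n using u by (simp add: periodic1_def)
  obtain F k2 where F: "continuous_on UNIV F" "periodic1 F" "strict_mono (k2 :: nat \<Rightarrow> nat)"
    "\<And>e. 0 < e \<Longrightarrow> \<exists>N. \<forall>n\<ge>N. \<forall>x. \<bar>Q (u (k1 (k2 n)) x) - F x\<bar> < e"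
    by (rule periodic_Arzela_Ascoli[of "\<lambda>n x. Q (u (k1 n) x)" "Q M", OF Fp Fb
        Q_profile_equicontinuous[where u = "\<lambda>n. u (k1 n)", OF prof \<epsilon>1 G_lim]]) (assumption | rule that)+
  define k where "k = k1 \<circ> k2"
  have k: "strict_mono k" unfolding k_def using G0(3) F(3) by (rule strict_mono_o)
  have kf: "filterlim k at_top sequentially" by (rule filterlim_subseq[OF k])
  show ?thesis
  proof (rule that[of G0 F k])
    show "\<exists>N. \<forall>n\<ge>N. \<forall>x. \<bar>G (k n) x - G0 x\<bar> < e" if "0 < e" for e
      using G0(4)[OF that] seq_suble[OF F(3)] unfolding k_def o_def by (meson order_trans)
    show "\<exists>N. \<forall>n\<ge>N. \<forall>x. \<bar>Q (u (k n) x) - F x\<bar> < e" if "0 < e" for e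
      using F(4)[OF that] by (simp add: k_def)
    show "F x = G0 x \<or> F x \<in> Q ` \<rat>" for x
    proof (rule profile_limit_Q[where \<epsilon> = "\<lambda>n. \<epsilon> (k n)" and u = "\<lambda>n. u (k n)" and u' = "\<lambda>n. u' (k n)"
            and G = "\<lambda>n. G (k n)" and H = "\<lambda>n. H (k n)" and z = "\<lambda>_. x"])
      show "(\<lambda>n. Q (u (k n) x)) \<longlonglongrightarrow> F x"
        by (rule LIMSEQ_I) (use F(4) in \<open>fastforce simp: k_def\<close>)
      show "(\<lambda>n. G (k n) x) \<longlonglongrightarrow> G0 x"
        using filterlim_compose[OF G_lim filterlim_subseq[OF F(3)]] by (simp add: k_def)
    qed (use prof filterlim_compose[OF \<epsilon> kf] in auto)
  qed (use G0 F k in auto)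
qed

end

text \<open>On an interval where \<open>F \<noteq> G\<close> the continuous function \<open>F\<close> takes countably many values, so it is
  constant there.\<close>
lemma oscillation_le_of_countable:
  fixes F G :: "real \<Rightarrow> real"
  assumes F: "continuous_on UNIV F" and G: "continuous_on UNIV G" and D: "countable D"
    and FG: "\<And>x. F x = G x \<or> F x \<in> D" and xy: "x \<le> y"
  obtains p q where "x \<le> p" "p \<le> q" "q \<le> y" "F y - F x = G q - G p"
proof -
  \<comment> \<open>The exempted point \<open>c\<close> is the end where \<open>F\<close> meets
    \<open>G\<close>; one additional value keeps the image countable.\<close>
  have const: "F a = F b" if "a \<le> b" and ne: "\<And>t. a \<le> t \<Longrightarrow> t \<le> b \<Longrightarrow> t \<noteq> c \<Longrightarrow> F t \<in> D" for a b c
  proof (rule ccontr)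
    assume "F a \<noteq> F b"
    moreover have "connected (F ` {a..b})"
      by (intro connected_continuous_image continuous_on_subset[OF F]) auto
    ultimately have "uncountable (F ` {a..b})"
      using that(1) by (intro connected_uncountable[of _ "F a" "F b"]) auto
    moreover have "F ` {a..b} \<subseteq> insert (F c) D"
    proof (rule image_subsetI)
      fix t assume "t \<in> {a..b}"
      then show "F t \<in> insert (F c) D" using ne[of t] by (cases "t = c") auto
    qed
    then have "countable (F ` {a..b})" by (rule countable_subset) (simp add: D)
    ultimately show False by simp
  qed
  define T where "T = {x..y} \<inter> {t. F t = G t}"
  have "closed {t. F t = G t}" using F G by (intro closed_Collect_eq)
  then have T: "compact T" unfolding T_def by (intro compact_Int_closed) auto
  show ?thesis
  proof (cases "T = {}")
    case True
    then have "F t \<in> D" if "x \<le> t" "t \<le> y" for t using FG[of t] that by (auto simp: T_def)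
    then have "F x = F y" using xy by (intro const[of x y x])
    then show ?thesis using xy by (intro that[of x x]) auto
  next
    case False
    \<comment> \<open>The first and the last coincidence points. Outside them \<open>F\<close> is
      constant, so its whole increment is \<open>F q - F p = G q - G p\<close>.\<close>
    obtain p where p: "p \<in> T" "\<And>t. t \<in> T \<Longrightarrow> p \<le> t" using compact_attains_inf[OF T False] by blast
    obtain q where q: "q \<in> T" "\<And>t. t \<in> T \<Longrightarrow> t \<le> q" using compact_attains_sup[OF T False] by blast
    have pq: "x \<le> p" "p \<le> q" "q \<le> y" "F p = G p" "F q = G q" using p q by (auto simp: T_def)
    have "F t \<in> D" if "x \<le> t" "t \<le> p" "t \<noteq> p" for t
      using FG[of t] p(2)[of t] that pq by (auto simp: T_def)
    then have "F x = F p" using pq by (intro const[of x p p])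
    moreover have "F t \<in> D" if "q \<le> t" "t \<le> y" "t \<noteq> q" for t
      using FG[of t] q(2)[of t] that pq by (auto simp: T_def)
    then have "F q = F y" using pq by (intro const[of q y q])
    ultimately show ?thesis using pq by (intro that[of p q]) auto
  qed
qed

subsection \<open>Identification of the limit\<close>

text \<open>Sign conditions that are affine in the density can be tested against nonnegative
  continuous functions and so survive weak convergence. The continuous weight \<open>g\<close>
  localises the comparison with the level \<open>s\<close>; the sign \<open>\<sigma>\<close> covers
  upper and lower bounds at once.\<close>

lemma weak_limit_bound:
  fixes s \<sigma> :: real
  assumes \<rho>: "\<And>n. prob_density (\<rho> n)" and \<rho>0: "prob_density \<rho>0"
    and weak: "\<And>f. continuous_on UNIV f \<Longrightarrow> periodic1 f \<Longrightarrow>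
      (\<lambda>n. LINT x:{0..1}|lborel. \<rho> n x * f x) \<longlonglongrightarrow> (LINT x:{0..1}|lborel. \<rho>0 x * f x)"
    and g: "continuous_on UNIV g" "periodic1 g"
    and sign: "\<forall>\<^sub>F n in sequentially. \<forall>x. 0 \<le> (\<sigma> * (s - \<rho> n x)) * g x"
  shows "AE x in lborel. x \<in> {0..1} \<longrightarrow> 0 \<le> (\<sigma> * (s - \<rho>0 x)) * g x"
proof -
  have split: "set_integrable lborel {0..1} (\<lambda>x. (\<sigma> * (s - \<mu> x)) * g x * f x)"
    "(LINT x:{0..1}|lborel. (\<sigma> * (s - \<mu> x)) * g x * f x)
      = \<sigma> * s * (LINT x:{0..1}|lborel. g x * f x) - \<sigma> * (LINT x:{0..1}|lborel. \<mu> x * (g x * f x))"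
    if \<mu>: "prob_density \<mu>" and f: "continuous_on UNIV f" for \<mu> f
  proof -
    have gf: "continuous_on UNIV (\<lambda>x. g x * f x)" by (intro continuous_intros g f)
    have i: "set_integrable lborel {0..1} (\<lambda>x. \<sigma> * s * (g x * f x))" "set_integrable lborel {0..1} (\<lambda>x. \<sigma> * (\<mu> x * (g x * f x)))"
      by (intro set_integrable_mult_right set_integrable_continuous[OF continuous_on_subset[OF gf subset_UNIV]]
          prob_density_integrable[OF \<mu> gf])+
    have eq: "(\<sigma> * (s - \<mu> x)) * g x * f x = \<sigma> * s * (g x * f x) - \<sigma> * (\<mu> x * (g x * f x))" for x
      by (simp add: algebra_simps)
    show "set_integrable lborel {0..1} (\<lambda>x. (\<sigma> * (s - \<mu> x)) * g x * f x)"
      unfolding eq by (rule set_integral_diff(1)[OF i])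
    show "(LINT x:{0..1}|lborel. (\<sigma> * (s - \<mu> x)) * g x * f x)
      = \<sigma> * s * (LINT x:{0..1}|lborel. g x * f x) - \<sigma> * (LINT x:{0..1}|lborel. \<mu> x * (g x * f x))"
      unfolding eq using set_integral_diff(2)[OF i] by simp
  qed
  show ?thesis
  proof (rule fundamental_lemma_nonneg)
    show "set_integrable lborel {0..1} (\<lambda>x. (\<sigma> * (s - \<rho>0 x)) * g x)"
      using split(1)[OF \<rho>0 continuous_on_const[of _ 1]] by simp
    fix f :: "real \<Rightarrow> real" assume f: "continuous_on UNIV f" "periodic1 f" "\<And>x. 0 \<le> f x"
    have gf: "continuous_on UNIV (\<lambda>x. g x * f x)" "periodic1 (\<lambda>x. g x * f x)"
      using g f by (auto intro!: continuous_intros simp: periodic1_def)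
    have lim: "(\<lambda>n. LINT x:{0..1}|lborel. (\<sigma> * (s - \<rho> n x)) * g x * f x)
        \<longlonglongrightarrow> (LINT x:{0..1}|lborel. (\<sigma> * (s - \<rho>0 x)) * g x * f x)"
      unfolding split(2)[OF \<rho> f(1)] split(2)[OF \<rho>0 f(1)] by (intro tendsto_intros weak gf)
    show "0 \<le> (LINT x:{0..1}|lborel. (\<sigma> * (s - \<rho>0 x)) * g x * f x)"
    proof (rule tendsto_lowerbound[OF lim])
      show "\<forall>\<^sub>F n in sequentially. 0 \<le> (LINT x:{0..1}|lborel. (\<sigma> * (s - \<rho> n x)) * g x * f x)"
        using sign
      proof eventually_elim
        case (elim n)
        have "0 \<le> (\<sigma> * (s - \<rho> n x)) * g x * f x" for x
            by (rule mult_nonneg_nonneg[OF spec[OF elim] f(3)])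
        then show ?case by (simp add: set_lebesgue_integral_def integral_nonneg_AE)
      qed
    qed simp
  qed
qed

context potential
begin

text \<open>Reduces a strict inequality for \<open>Q\<close> to rational levels, so that only
  countably many null sets have to be discarded.\<close>

lemma Q_rational_near:
  assumes "0 \<le> r" "c \<noteq> Q r"
  shows "c < Q r \<Longrightarrow> 0 < r \<Longrightarrow> \<exists>s\<in>\<rat>. 0 \<le> s \<and> s < r \<and> c < Q s"
    "Q r < c \<Longrightarrow> \<exists>s\<in>\<rat>. 0 \<le> s \<and> r < s \<and> Q s < c"
proof -
  have "\<exists>d>0. \<forall>s\<in>{0..}. dist s r < d \<longrightarrow> dist (Q s) (Q r) < \<bar>c - Q r\<bar>"
    using Q_cont assms unfolding continuous_on_iff by (metis atLeast_iff zero_less_abs_iff right_minus_eq)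
  then obtain d where d: "d > 0" "\<And>s. 0 \<le> s \<Longrightarrow> \<bar>s - r\<bar> < d \<Longrightarrow> \<bar>Q s - Q r\<bar> < \<bar>c - Q r\<bar>"
    by (auto simp: dist_real_def)
  show "\<exists>s\<in>\<rat>. 0 \<le> s \<and> s < r \<and> c < Q s" if c: "c < Q r" "0 < r"
  proof -
    obtain s where s: "s \<in> \<rat>" "max 0 (r - d) < s" "s < r"
      using Rats_dense_in_real[of "max 0 (r - d)" r] d(1) c by auto
    then have "\<bar>Q s - Q r\<bar> < \<bar>c - Q r\<bar>" using d by auto
    then show ?thesis using s c by (intro bexI[of _ s]) auto
  qed
  show "\<exists>s\<in>\<rat>. 0 \<le> s \<and> r < s \<and> Q s < c" if "Q r < c"
  proof -
    obtain s where s: "s \<in> \<rat>" "r < s" "s < r + d"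
      using Rats_dense_in_real[of r "r + d"] d(1) by auto
    then have "\<bar>Q s - Q r\<bar> < \<bar>c - Q r\<bar>" using d assms by auto
    then show ?thesis using s that assms by (intro bexI[of _ s]) auto
  qed
qed

text \<open>\<open>Q\<close> is monotone, so bounds on \<open>Q (\<rho> n)\<close> are bounds on \<open>\<rho> n\<close>, which survive weak limits.\<close>
lemma Q_limit_AE:
  assumes \<rho>: "\<And>n. prob_density (\<rho> n)" and \<rho>0: "prob_density \<rho>0"
    and weak: "\<And>f. continuous_on UNIV f \<Longrightarrow> periodic1 f \<Longrightarrow>
      (\<lambda>n. LINT x:{0..1}|lborel. \<rho> n x * f x) \<longlonglongrightarrow> (LINT x:{0..1}|lborel. \<rho>0 x * f x)"
    and F: "continuous_on UNIV F" "periodic1 F"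
    and unif: "\<And>e. 0 < e \<Longrightarrow> \<exists>N. \<forall>n\<ge>N. \<forall>x. \<bar>Q (\<rho> n x) - F x\<bar> < e"
  shows "AE x in lborel. x \<in> {0..1} \<longrightarrow> Q (\<rho>0 x) = F x"
proof -
  have nn: "0 \<le> \<rho> n x" "0 \<le> \<rho>0 x" for n x using \<rho> \<rho>0 by (auto simp: prob_density_def)
  have F0: "0 \<le> F x" for x
  proof (rule field_le_epsilon)
    fix e :: real assume "0 < e"
    then obtain N where "\<forall>n\<ge>N. \<forall>x. \<bar>Q (\<rho> n x) - F x\<bar> < e" using unif by blast
    then have "\<bar>Q (\<rho> N x) - F x\<bar> < e" by blast
    then show "0 \<le> F x + e" using Q_nonneg[OF nn(1)[of N x]] by linarith
  qed
  \<comment> \<open>Where \<open>F < c < Q s\<close>, uniform convergence gives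
    \<open>Q (\<rho> n) < Q s\<close>, and monotonicity gives \<open>\<rho> n \<le> s\<close>. The
    weight \<open>max 0 (c - F x)\<close> selects this region continuously.\<close>
  have upper: "AE x in lborel. x \<in> {0..1} \<longrightarrow> 0 \<le> (1 * (s - \<rho>0 x)) * max 0 (c - F x)" if s: "0 \<le> s" "c < Q s" for c s
  proof (rule weak_limit_bound[OF \<rho> \<rho>0 weak])
    show "continuous_on UNIV (\<lambda>x. max 0 (c - F x))" by (intro continuous_intros F)
    show "periodic1 (\<lambda>x. max 0 (c - F x))" using F(2) by (simp add: periodic1_def)
    obtain N where N: "\<And>n x. n \<ge> N \<Longrightarrow> \<bar>Q (\<rho> n x) - F x\<bar> < Q s - c" using unif[of "Q s - c"] s by auto
    have "0 \<le> (1 * (s - \<rho> n x)) * max 0 (c - F x)" if "n \<ge> N" for n x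
    proof (cases "F x < c")
      case True
      then have "Q (\<rho> n x) < Q s" using N[OF that, of x] by linarith
      then have "\<rho> n x \<le> s" using Q_mono[OF s(1), of "\<rho> n x"] by linarith
      then show ?thesis by simp
    qed simp
    then show "\<forall>\<^sub>F n in sequentially. \<forall>x. 0 \<le> (1 * (s - \<rho> n x)) * max 0 (c - F x)"
      unfolding eventually_sequentially by blast
  qed
  have lower: "AE x in lborel. x \<in> {0..1} \<longrightarrow> 0 \<le> ((-1) * (s - \<rho>0 x)) * max 0 (F x - c)" if s: "0 \<le> s" "Q s < c" for c s
  proof (rule weak_limit_bound[OF \<rho> \<rho>0 weak])
    show "continuous_on UNIV (\<lambda>x. max 0 (F x - c))" by (intro continuous_intros F)
    show "periodic1 (\<lambda>x. max 0 (F x - c))" using F(2) by (simp add: periodic1_def)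
    obtain N where N: "\<And>n x. n \<ge> N \<Longrightarrow> \<bar>Q (\<rho> n x) - F x\<bar> < c - Q s" using unif[of "c - Q s"] s by auto
    have "0 \<le> ((-1) * (s - \<rho> n x)) * max 0 (F x - c)" if "n \<ge> N" for n x
    proof (cases "c < F x")
      case True
      then have "Q s < Q (\<rho> n x)" using N[OF that, of x] by linarith
      then have "s \<le> \<rho> n x" using Q_mono[OF nn(1)[of n x], of s] by linarith
      then show ?thesis by simp
    qed simp
    then show "\<forall>\<^sub>F n in sequentially. \<forall>x. 0 \<le> ((-1) * (s - \<rho> n x)) * max 0 (F x - c)"
      unfolding eventually_sequentially by blast
  qed
  have "AE x in lborel. \<forall>c\<in>\<rat>. \<forall>s\<in>\<rat>. 0 \<le> s \<longrightarrow> c < Q s \<longrightarrow> x \<in> {0..1} \<longrightarrow> 0 \<le> (1 * (s - \<rho>0 x)) * max 0 (c - F x)"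
    using upper by (intro AE_ball_countable' countable_rat AE_impI) auto
  moreover have "AE x in lborel. \<forall>c\<in>\<rat>. \<forall>s\<in>\<rat>. 0 \<le> s \<longrightarrow> Q s < c \<longrightarrow> x \<in> {0..1} \<longrightarrow> 0 \<le> ((-1) * (s - \<rho>0 x)) * max 0 (F x - c)"
    using lower by (intro AE_ball_countable' countable_rat AE_impI) auto
  ultimately show ?thesis
  proof eventually_elim
    case (elim x)
    show ?case
    proof
      assume x: "x \<in> {0..1}"
      show "Q (\<rho>0 x) = F x"
      proof (rule antisym; rule ccontr)
        assume "\<not> Q (\<rho>0 x) \<le> F x"
        then obtain c where c: "c \<in> \<rat>" "F x < c" "c < Q (\<rho>0 x)" using Rats_dense_in_real[of "F x" "Q (\<rho>0 x)"] by auto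
        \<comment> \<open>A rational level below \<open>\<rho>0 x\<close> has to be nonnegative,
          which leaves room only if \<open>\<rho>0 x\<close> is positive.\<close>
        have "\<rho>0 x \<noteq> 0" using c F0[of x] Q_0 by auto
        then obtain s where s: "s \<in> \<rat>" "0 \<le> s" "s < \<rho>0 x" "c < Q s"
          using Q_rational_near(1)[OF nn(2), of c x] c nn(2)[of x] by auto
        then have "0 \<le> (1 * (s - \<rho>0 x)) * max 0 (c - F x)" using elim(1) c x by blast
        moreover have "(1 * (s - \<rho>0 x)) * max 0 (c - F x) < 0" using c s by (simp add: mult_neg_pos)
        ultimately show False by simp
      next
        assume "\<not> F x \<le> Q (\<rho>0 x)"
        then obtain c where c: "c \<in> \<rat>" "Q (\<rho>0 x) < c" "c < F x" using Rats_dense_in_real[of "Q (\<rho>0 x)" "F x"] by auto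
        then obtain s where s: "s \<in> \<rat>" "0 \<le> s" "\<rho>0 x < s" "Q s < c"
          using Q_rational_near(2)[OF nn(2), of c x] by auto
        then have "0 \<le> ((-1) * (s - \<rho>0 x)) * max 0 (F x - c)" using elim(2) c x by blast
        moreover have "((-1) * (s - \<rho>0 x)) * max 0 (F x - c) < 0" using c s by (simp add: mult_neg_pos)
        ultimately show False by simp
      qed
    qed
  qed
qed

end

subsection \<open>The limit functional\<close>

lemma set_integral_sum_partition:
  fixes f :: "real \<Rightarrow> real"
  assumes f: "set_integrable lborel {0..1} f" and N: "0 < N"
  shows "(LINT x:{0..1}|lborel. f x) = (\<Sum>i<N. LINT x:{real i / real N..real (Suc i) / real N}|lborel. f x)"
proof -
  have "(LINT x:{0..real j / real N}|lborel. f x) = (\<Sum>i<j. LINT x:{real i / real N..real (Suc i) / real N}|lborel. f x)"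
    if "j \<le> N" for j
    using that
  proof (induction j)
    case 0
    have "AE t in lborel. indicator {0..0} t *\<^sub>R f t = 0"
      using AE_lborel_singleton[of "0::real"] by eventually_elim auto
    then show ?case unfolding set_lebesgue_integral_def by (simp add: integral_eq_zero_AE)
  next
    case (Suc j)
    have le: "real j / real N \<le> real (Suc j) / real N" by (intro divide_right_mono) auto
    have "{0..real (Suc j) / real N} \<subseteq> {0..1}" using Suc.prems N by (auto simp: field_simps)
    then have "set_integrable lborel {0..real (Suc j) / real N} f" by (intro set_integrable_subset[OF f]) auto
    from set_integral_combine[OF this _ le] show ?case using Suc by simp
  qed
  from this[of N] show ?thesis using N by simp
qed

text \<open>The integral becomes a Riemann sum with increments of \<open>\<phi>\<close>, and
  summation by parts moves them to \<open>F\<close>. There they are increments of \<open>G0\<close>,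
  close to those of \<open>G n\<close> and so bounded by increments of \<open>H n\<close>, which are
  integrals of \<open>sqrt \<rho> * \<bar>g\<bar>\<close>. Cauchy-Schwarz splits off the norm of
  \<open>g\<close>, and weak convergence handles the weight.\<close>

lemma limit_functional_bound_step:
  assumes \<phi>: "test_fun \<phi>" "\<And>x. \<bar>\<phi> x\<bar> \<le> B" "\<And>x. \<bar>deriv \<phi> x\<bar> \<le> B"
    and F: "continuous_on UNIV F" "periodic1 F"
    and osc: "\<And>x y. x \<le> y \<Longrightarrow> \<exists>p q. x \<le> p \<and> p \<le> q \<and> q \<le> y \<and> F y - F x = G0 q - G0 p"
    and G: "\<And>e. 0 < e \<Longrightarrow> \<exists>N. \<forall>n\<ge>N. \<forall>x. \<bar>G n x - G0 x\<bar> < e"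
    and GH: "\<And>n x y. x \<le> y \<Longrightarrow> \<bar>G n y - G n x\<bar> \<le> H n y - H n x"
    and H: "\<And>n x y. x \<le> y \<Longrightarrow> 0 \<le> x \<Longrightarrow> y \<le> 1 \<Longrightarrow> H n y - H n x = (LINT t:{x..y}|lborel. sqrt (\<rho> n t) * \<bar>g n t\<bar>)"
    and \<rho>: "\<And>n. prob_density (\<rho> n)" "\<And>n. continuous_on UNIV (\<rho> n)"
    and g: "\<And>n. g n \<in> borel_measurable borel" "\<And>n. set_integrable lborel {0..1} (\<lambda>x. (g n x)\<^sup>2)"
      "\<And>n. sqrt (LINT x:{0..1}|lborel. (g n x)\<^sup>2) \<le> l n" "l \<longlonglongrightarrow> L"
    and weak: "\<And>f. continuous_on UNIV f \<Longrightarrow> periodic1 f \<Longrightarrow>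
      (\<lambda>n. LINT x:{0..1}|lborel. \<rho> n x * f x) \<longlonglongrightarrow> (LINT x:{0..1}|lborel. \<rho>0 x * f x)"
    and \<eta>: "0 < \<eta>"
  shows "\<bar>LINT x:{0..1}|lborel. F x * deriv \<phi> x\<bar> \<le> \<eta> * B + L * sqrt (LINT x:{0..1}|lborel. \<rho>0 x * (\<bar>\<phi> x\<bar> + \<eta>)\<^sup>2)"
proof -
  have B: "0 \<le> B" using \<phi>(2)[of 0] by linarith
  have \<phi>c: "continuous_on A \<phi>" and \<phi>'c: "continuous_on A (deriv \<phi>)" for A
    using \<phi>(1) test_fun_continuous test_fun_deriv by auto
  have Fc: "continuous_on A F" for A using F(1) continuous_on_subset by blast
  have "uniformly_continuous_on {0..1} \<phi>" "uniformly_continuous_on {0..1} F"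
    by (auto intro!: compact_uniformly_continuous \<phi>c Fc)
  then obtain d1 d2 where d: "d1 > 0" "d2 > 0"
    "\<And>s t. s \<in> {0..1} \<Longrightarrow> t \<in> {0..1} \<Longrightarrow> dist s t < d1 \<Longrightarrow> dist (\<phi> s) (\<phi> t) < \<eta>"
    "\<And>s t. s \<in> {0..1} \<Longrightarrow> t \<in> {0..1} \<Longrightarrow> dist s t < d2 \<Longrightarrow> dist (F s) (F t) < \<eta>"
    using \<eta> unfolding uniformly_continuous_on_def by metis
  obtain N where N: "0 < N" "inverse (real N) < min d1 d2"
    using real_arch_inverse[of "min d1 d2"] d(1,2) by auto
  define t where "t i = real i / real N" for i
  have t_step: "t (Suc i) - t i = inverse (real N)" for i using N by (simp add: t_def field_simps)
  have t_le: "t i \<le> t (Suc i)" for i using t_step[of i] by (smt (verit) inverse_nonnegative_iff_nonnegative of_nat_0_le_iff)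
  have t01: "0 \<le> t i" "t (Suc i) \<le> 1" if "i < N" for i using that N by (auto simp: t_def field_simps)
  have tN: "t 0 = 0" "t N = 1" using N by (auto simp: t_def)
  have close: "\<bar>\<phi> (t i) - \<phi> s\<bar> \<le> \<eta>" "\<bar>F s - F (t (Suc i))\<bar> \<le> \<eta>" if "i < N" "t i \<le> s" "s \<le> t (Suc i)" for i s
  proof -
    have "\<bar>t i - s\<bar> < min d1 d2" "\<bar>s - t (Suc i)\<bar> < min d1 d2" using that t_step[of i] N(2) by linarith+
    moreover have "t i \<in> {0..1}" "s \<in> {0..1}" "t (Suc i) \<in> {0..1}" using that t01[OF that(1)] t_le[of i] by auto
    ultimately show "\<bar>\<phi> (t i) - \<phi> s\<bar> \<le> \<eta>" "\<bar>F s - F (t (Suc i))\<bar> \<le> \<eta>"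
      using d(3)[of "t i" s] d(4)[of s "t (Suc i)"] by (auto simp: dist_real_def)
  qed
  have const_int: "(LINT x:{t i..t (Suc i)}|lborel. c) = c * inverse (real N)" for i and c :: real
    using t_step[of i] t_le[of i] by (simp add: set_lebesgue_integral_def)
  \<comment> \<open>Freezing \<open>F\<close> at the right end costs \<open>\<eta> * B\<close> per
    unit length, so \<open>\<eta> * B\<close> in total.\<close>
  have piece: "\<bar>(LINT x:{t i..t (Suc i)}|lborel. F x * deriv \<phi> x) - F (t (Suc i)) * (\<phi> (t (Suc i)) - \<phi> (t i))\<bar>
      \<le> \<eta> * B * inverse (real N)" if i: "i < N" for i
  proof -
    have "(deriv \<phi> has_integral (\<phi> (t (Suc i)) - \<phi> (t i))) {t i..t (Suc i)}"
      using t_le[of i] test_fun_differentiable[OF \<phi>(1)]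
      by (intro fundamental_theorem_of_calculus)
        (auto simp: has_real_derivative_iff_has_vector_derivative[symmetric] intro: has_field_derivative_at_within)
    then have FTC: "(LINT x:{t i..t (Suc i)}|lborel. deriv \<phi> x) = \<phi> (t (Suc i)) - \<phi> (t i)"
      using set_borel_integral_eq_integral(2)[OF set_integrable_continuous[OF \<phi>'c]] by (simp add: integral_unique)
    have "(LINT x:{t i..t (Suc i)}|lborel. F x * deriv \<phi> x) - F (t (Suc i)) * (\<phi> (t (Suc i)) - \<phi> (t i))
        = (LINT x:{t i..t (Suc i)}|lborel. F x * deriv \<phi> x - F (t (Suc i)) * deriv \<phi> x)"
      using set_integral_diff(2)[of lborel "{t i..t (Suc i)}" "\<lambda>x. F x * deriv \<phi> x" "\<lambda>x. F (t (Suc i)) * deriv \<phi> x"]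
      by (simp add: FTC[symmetric] set_integrable_continuous Fc \<phi>'c continuous_intros)
    also have "\<bar>\<dots>\<bar> \<le> (LINT x:{t i..t (Suc i)}|lborel. \<eta> * B)"
    proof (intro LINT_abs_bound set_integrable_continuous continuous_intros Fc \<phi>'c)
      fix x assume "x \<in> {t i..t (Suc i)}"
      then have "\<bar>F x - F (t (Suc i))\<bar> * \<bar>deriv \<phi> x\<bar> \<le> \<eta> * B"
        using close(2)[OF i, of x] \<phi>(3)[of x] \<eta> by (intro mult_mono) auto
      then show "\<bar>F x * deriv \<phi> x - F (t (Suc i)) * deriv \<phi> x\<bar> \<le> \<eta> * B"
        by (simp only: left_diff_distrib[symmetric] abs_mult)
    qed
    finally show ?thesis unfolding const_int .
  qed
  define S where "S = (\<Sum>i<N. \<phi> (t i) * (F (t (Suc i)) - F (t i)))"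
  \<comment> \<open>Pairing right end values of \<open>F\<close> with left end values of
    \<open>\<phi>\<close> makes the two sums telescope; the boundary term vanishes by
    periodicity.\<close>
  have Abel: "(\<Sum>i<N. F (t (Suc i)) * (\<phi> (t (Suc i)) - \<phi> (t i))) = - S"
  proof -
    have "(\<Sum>i<N. F (t (Suc i)) * (\<phi> (t (Suc i)) - \<phi> (t i))) + S = (\<Sum>i<N. F (t (Suc i)) * \<phi> (t (Suc i)) - F (t i) * \<phi> (t i))"
      unfolding S_def sum.distrib[symmetric] by (intro sum.cong) (auto simp: algebra_simps)
    also have "\<dots> = F (t N) * \<phi> (t N) - F (t 0) * \<phi> (t 0)" by (rule sum_lessThan_telescope)
    also have "\<dots> = 0"
      using F(2) test_fun_periodic[OF \<phi>(1)] unfolding tN periodic1_def by (metis add_0 diff_self)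
    finally show ?thesis by simp
  qed
  have I_S: "\<bar>(LINT x:{0..1}|lborel. F x * deriv \<phi> x) + S\<bar> \<le> \<eta> * B"
  proof -
    have "(LINT x:{0..1}|lborel. F x * deriv \<phi> x) = (\<Sum>i<N. LINT x:{t i..t (Suc i)}|lborel. F x * deriv \<phi> x)"
      unfolding t_def by (intro set_integral_sum_partition set_integrable_continuous continuous_intros Fc \<phi>'c N)
    then have "(LINT x:{0..1}|lborel. F x * deriv \<phi> x) + S
        = (\<Sum>i<N. (LINT x:{t i..t (Suc i)}|lborel. F x * deriv \<phi> x) - F (t (Suc i)) * (\<phi> (t (Suc i)) - \<phi> (t i)))"
      using Abel by (simp add: sum_subtractf)
    also have "\<bar>\<dots>\<bar> \<le> (\<Sum>i<N. \<eta> * B * inverse (real N))"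
      by (intro order_trans[OF sum_abs] sum_mono piece) auto
    also have "\<dots> = \<eta> * B" using N by simp
    finally show ?thesis .
  qed
  \<comment> \<open>Dominates \<open>\<bar>\<phi> (t i)\<bar>\<close> on the whole
    \<open>i\<close>-th piece, so the sampled value can be brought under the integral.\<close>
  define w where "w x = \<bar>\<phi> x\<bar> + \<eta>" for x
  have wc: "continuous_on A w" for A unfolding w_def by (intro continuous_intros \<phi>c)
  have w0: "0 \<le> w x" for x using \<eta> by (simp add: w_def)
  have wp: "periodic1 (\<lambda>x. (w x)\<^sup>2)" using test_fun_periodic[OF \<phi>(1)] by (simp add: w_def periodic1_def)
  have w2c: "continuous_on UNIV (\<lambda>x. (w x)\<^sup>2)" by (intro continuous_intros wc)
  have \<rho>nn: "0 \<le> \<rho> n x" for n x using \<rho>(1) by (simp add: prob_density_def)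
  have H_sum: "(\<Sum>i<N. \<bar>\<phi> (t i)\<bar> * (H n (t (Suc i)) - H n (t i))) \<le> l n * sqrt (LINT x:{0..1}|lborel. \<rho> n x * (w x)\<^sup>2)" for n
  proof -
    have rc: "continuous_on A (\<lambda>x. sqrt (\<rho> n x))" for A
      using continuous_on_subset[OF \<rho>(2)] by (intro continuous_intros) auto
    have gam: "(\<lambda>x. \<bar>g n x\<bar>) \<in> borel_measurable borel" using g(1) by measurable
    have wrm: "(\<lambda>x. w x * sqrt (\<rho> n x)) \<in> borel_measurable borel"
      by (intro borel_measurable_continuous_onI continuous_intros wc rc)
    have wr2: "(w x * sqrt (\<rho> n x))\<^sup>2 = \<rho> n x * (w x)\<^sup>2" for x using \<rho>nn by (simp add: power_mult_distrib)
    have i2: "set_integrable lborel {0..1} (\<lambda>x. (w x * sqrt (\<rho> n x))\<^sup>2)"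
      unfolding wr2 by (rule prob_density_integrable[OF \<rho>(1) w2c])
    have ga2: "set_integrable lborel {0..1} (\<lambda>x. \<bar>g n x\<bar>\<^sup>2)" using g(2) by simp
    have g1: "set_integrable lborel {0..1} (\<lambda>x. \<bar>g n x\<bar>)"
      using set_integral_Cauchy_Schwarz(1)[OF _ gam _ ga2, of "\<lambda>_. 1"] by (simp add: set_integrable_continuous)
    have ri: "set_integrable lborel {0..1} (\<lambda>x. sqrt (\<rho> n x) * \<bar>g n x\<bar>)"
      using set_integrable_cont_mult[OF g1 rc] by (simp add: mult.commute)
    have wri: "set_integrable lborel {0..1} (\<lambda>x. w x * sqrt (\<rho> n x) * \<bar>g n x\<bar>)"
      using set_integrable_cont_mult[OF ri wc] by (simp add: mult_ac)
    have "(\<Sum>i<N. \<bar>\<phi> (t i)\<bar> * (H n (t (Suc i)) - H n (t i)))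
        \<le> (\<Sum>i<N. LINT x:{t i..t (Suc i)}|lborel. w x * sqrt (\<rho> n x) * \<bar>g n x\<bar>)"
    proof (rule sum_mono)
      fix i assume "i \<in> {..<N}"
      then have i: "i < N" by simp
      have sub: "{t i..t (Suc i)} \<subseteq> {0..1}" using t01[OF i] by auto
      have "\<bar>\<phi> (t i)\<bar> * (H n (t (Suc i)) - H n (t i)) = (LINT x:{t i..t (Suc i)}|lborel. \<bar>\<phi> (t i)\<bar> * (sqrt (\<rho> n x) * \<bar>g n x\<bar>))"
        using H[OF t_le t01[OF i]] by simp
      also have "\<dots> \<le> (LINT x:{t i..t (Suc i)}|lborel. w x * sqrt (\<rho> n x) * \<bar>g n x\<bar>)"
      proof (rule set_integral_mono)
        show "set_integrable lborel {t i..t (Suc i)} (\<lambda>x. \<bar>\<phi> (t i)\<bar> * (sqrt (\<rho> n x) * \<bar>g n x\<bar>))"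
          by (intro set_integrable_mult_right set_integrable_subset[OF ri _ sub]) auto
        show "set_integrable lborel {t i..t (Suc i)} (\<lambda>x. w x * sqrt (\<rho> n x) * \<bar>g n x\<bar>)"
          by (intro set_integrable_subset[OF wri _ sub]) auto
        fix x assume x: "x \<in> {t i..t (Suc i)}"
        have "\<bar>\<phi> (t i)\<bar> \<le> w x" using close(1)[OF i, of x] x by (simp add: w_def)
        then have "\<bar>\<phi> (t i)\<bar> * (sqrt (\<rho> n x) * \<bar>g n x\<bar>) \<le> w x * (sqrt (\<rho> n x) * \<bar>g n x\<bar>)"
          using \<rho>nn by (intro mult_right_mono) auto
        then show "\<bar>\<phi> (t i)\<bar> * (sqrt (\<rho> n x) * \<bar>g n x\<bar>) \<le> w x * sqrt (\<rho> n x) * \<bar>g n x\<bar>" by (simp add: mult.assoc)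
      qed
      finally show "\<bar>\<phi> (t i)\<bar> * (H n (t (Suc i)) - H n (t i)) \<le> (LINT x:{t i..t (Suc i)}|lborel. w x * sqrt (\<rho> n x) * \<bar>g n x\<bar>)" .
    qed
    also have "\<dots> = (LINT x:{0..1}|lborel. w x * sqrt (\<rho> n x) * \<bar>g n x\<bar>)"
      unfolding t_def by (rule set_integral_sum_partition[OF wri N(1), symmetric])
    also have "\<dots> \<le> sqrt (LINT x:{0..1}|lborel. (w x * sqrt (\<rho> n x))\<^sup>2) * sqrt (LINT x:{0..1}|lborel. \<bar>g n x\<bar>\<^sup>2)"
      using set_integral_Cauchy_Schwarz(2)[OF _ wrm gam i2 ga2] by simp
    also have "\<dots> \<le> sqrt (LINT x:{0..1}|lborel. \<rho> n x * (w x)\<^sup>2) * l n"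
      unfolding wr2 power2_abs using g(3) \<rho>nn
      by (intro mult_left_mono) (auto simp: set_lebesgue_integral_def intro!: integral_nonneg_AE)
    finally show ?thesis by (simp add: mult.commute)
  qed
  have S_le: "\<bar>S\<bar> \<le> L * sqrt (LINT x:{0..1}|lborel. \<rho>0 x * (w x)\<^sup>2) + e" if e: "0 < e" for e
  proof -
    \<comment> \<open>The \<open>N\<close> pieces contribute at most \<open>N * B * 2 e'\<close>
      when \<open>G0\<close> is replaced by \<open>G n\<close>; \<open>B + 1\<close> excludes
      division by zero.\<close>
    define e' where "e' = e / (2 * (B + 1) * real N)"
    have e': "0 < e'" using e B N by (simp add: e'_def)
    obtain n0 where n0: "\<And>n x. n \<ge> n0 \<Longrightarrow> \<bar>G n x - G0 x\<bar> < e'" using G[OF e'] by blast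
    have "\<bar>S\<bar> \<le> l n * sqrt (LINT x:{0..1}|lborel. \<rho> n x * (w x)\<^sup>2) + e" if n: "n \<ge> n0" for n
    proof -
      have Fd: "\<bar>F (t (Suc i)) - F (t i)\<bar> \<le> 2 * e' + (H n (t (Suc i)) - H n (t i))" for i
      proof -
        obtain p q where pq: "t i \<le> p" "p \<le> q" "q \<le> t (Suc i)" "F (t (Suc i)) - F (t i) = G0 q - G0 p"
          using osc[OF t_le] by blast
        have "\<bar>G n q - G n p\<bar> \<le> H n q - H n p" "H n (t i) \<le> H n p" "H n q \<le> H n (t (Suc i))"
          using GH[OF pq(2)] GH[OF pq(1), of n] GH[OF pq(3), of n] by auto
        then show ?thesis using n0[OF n, of p] n0[OF n, of q] pq(4) by linarith
      qed
      have "\<bar>S\<bar> \<le> (\<Sum>i<N. \<bar>\<phi> (t i)\<bar> * \<bar>F (t (Suc i)) - F (t i)\<bar>)"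
        unfolding S_def by (intro order_trans[OF sum_abs]) (simp add: abs_mult)
      also have "\<dots> \<le> (\<Sum>i<N. B * (2 * e') + \<bar>\<phi> (t i)\<bar> * (H n (t (Suc i)) - H n (t i)))"
      proof (rule sum_mono)
        fix i
        have "\<bar>\<phi> (t i)\<bar> * \<bar>F (t (Suc i)) - F (t i)\<bar> \<le> \<bar>\<phi> (t i)\<bar> * (2 * e' + (H n (t (Suc i)) - H n (t i)))"
          by (intro mult_left_mono Fd) auto
        moreover have "\<bar>\<phi> (t i)\<bar> * (2 * e') \<le> B * (2 * e')" using \<phi>(2) e' by (intro mult_right_mono) auto
        ultimately show "\<bar>\<phi> (t i)\<bar> * \<bar>F (t (Suc i)) - F (t i)\<bar> \<le> B * (2 * e') + \<bar>\<phi> (t i)\<bar> * (H n (t (Suc i)) - H n (t i))"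
          by (simp add: distrib_left)
      qed
      also have "\<dots> = real N * (B * (2 * e')) + (\<Sum>i<N. \<bar>\<phi> (t i)\<bar> * (H n (t (Suc i)) - H n (t i)))"
        by (simp add: sum.distrib)
      also have "real N * (B * (2 * e')) \<le> e"
      proof -
        have "real N * (B * (2 * e')) \<le> real N * ((B + 1) * (2 * e'))"
          using e' by (intro mult_left_mono mult_right_mono) auto
        also have "\<dots> = e"
        proof -
          have "2 * (B + 1) * real N \<noteq> 0" using N B by simp
          then have "2 * (B + 1) * real N * e' = e" by (simp add: e'_def)
          then show ?thesis by (simp add: mult_ac)
        qed
        finally show ?thesis .
      qed
      finally show ?thesis using H_sum[of n] by linarith
    qed
    moreover have "(\<lambda>n. l n * sqrt (LINT x:{0..1}|lborel. \<rho> n x * (w x)\<^sup>2) + e)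
        \<longlonglongrightarrow> L * sqrt (LINT x:{0..1}|lborel. \<rho>0 x * (w x)\<^sup>2) + e"
      by (intro tendsto_intros g(4) weak w2c wp)
    ultimately show ?thesis using LIMSEQ_le_const by blast
  qed
  have "\<bar>S\<bar> \<le> L * sqrt (LINT x:{0..1}|lborel. \<rho>0 x * (w x)\<^sup>2)" by (rule field_le_epsilon[OF S_le])
  then show ?thesis using I_S unfolding w_def by linarith
qed

text \<open>The mesh parameter \<open>\<eta>\<close> tends to 0: for \<open>\<eta> < 1\<close> the
  shifted square exceeds \<open>\<phi>^2\<close> by at most \<open>\<eta> (2 B + 1)\<close>, and
  \<open>\<rho>0\<close> has mass 1.\<close>

lemma limit_functional_bound:
  assumes \<phi>: "test_fun \<phi>" and \<rho>0: "prob_density \<rho>0" and L: "0 \<le> L"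
    and step: "\<And>\<eta> B. 0 < \<eta> \<Longrightarrow> (\<And>x. \<bar>\<phi> x\<bar> \<le> B) \<Longrightarrow> (\<And>x. \<bar>deriv \<phi> x\<bar> \<le> B) \<Longrightarrow>
      \<bar>LINT x:{0..1}|lborel. F x * deriv \<phi> x\<bar> \<le> \<eta> * B + L * sqrt (LINT x:{0..1}|lborel. \<rho>0 x * (\<bar>\<phi> x\<bar> + \<eta>)\<^sup>2)"
  shows "\<bar>LINT x:{0..1}|lborel. F x * deriv \<phi> x\<bar> \<le> L * sqrt (LINT x:{0..1}|lborel. \<rho>0 x * (\<phi> x)\<^sup>2)"
proof -
  have bd: "\<exists>B. \<forall>x. \<bar>f x\<bar> \<le> B" if f: "test_fun f" for f
  proof -
    have "bounded (f ` {0..1})"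
      by (intro compact_imp_bounded compact_continuous_image test_fun_continuous[OF f]) auto
    then obtain B where B: "\<forall>y\<in>f ` {0..1}. norm y \<le> B" unfolding bounded_iff by blast
    have "\<bar>f x\<bar> \<le> B" for x
    proof -
      have "frac x \<in> {0..1}" using frac_lt_1[of x] by auto
      then have "norm (f (frac x)) \<le> B" using B by blast
      then show ?thesis using periodic1_frac[OF test_fun_periodic[OF f], of x] by simp
    qed
    then show ?thesis by blast
  qed
  obtain B1 B2 where B12: "\<And>x. \<bar>\<phi> x\<bar> \<le> B1" "\<And>x. \<bar>deriv \<phi> x\<bar> \<le> B2"
    using bd[OF \<phi>] bd[OF test_fun_deriv[OF \<phi>]] by blast
  define B where "B = max B1 B2"
  have B: "\<bar>\<phi> x\<bar> \<le> B" "\<bar>deriv \<phi> x\<bar> \<le> B" for x using B12[of x] by (auto simp: B_def max_def)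
  have \<phi>c: "continuous_on UNIV \<phi>" by (rule test_fun_continuous[OF \<phi>])
  define a where "a = (LINT x:{0..1}|lborel. \<rho>0 x * (\<phi> x)\<^sup>2)"
  have "\<bar>LINT x:{0..1}|lborel. F x * deriv \<phi> x\<bar> \<le> \<eta> * B + L * sqrt (a + \<eta> * (2 * B + 1))" if \<eta>: "0 < \<eta>" "\<eta> < 1" for \<eta>
  proof -
    have c2: "continuous_on UNIV (\<lambda>x. (\<bar>\<phi> x\<bar> + \<eta>)\<^sup>2)" "continuous_on UNIV (\<lambda>x. (\<phi> x)\<^sup>2)"
      by (intro continuous_intros \<phi>c)+
    have i: "set_integrable lborel {0..1} (\<lambda>x. \<rho>0 x * (\<phi> x)\<^sup>2)" "set_integrable lborel {0..1} (\<lambda>x. \<eta> * (2 * B + 1) * \<rho>0 x)"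
      using prob_density_integrable[OF \<rho>0 c2(2)] \<rho>0 by (auto simp: prob_density_def)
    have "(LINT x:{0..1}|lborel. \<rho>0 x * (\<bar>\<phi> x\<bar> + \<eta>)\<^sup>2) \<le> (LINT x:{0..1}|lborel. \<rho>0 x * (\<phi> x)\<^sup>2 + \<eta> * (2 * B + 1) * \<rho>0 x)"
    proof (rule set_integral_mono[OF prob_density_integrable[OF \<rho>0 c2(1)] set_integral_add(1)[OF i]])
      fix x
      have "\<eta> * \<bar>\<phi> x\<bar> \<le> \<eta> * B" using B(1) \<eta> by (intro mult_left_mono) auto
      moreover have "\<eta> * \<eta> \<le> \<eta> * 1" using \<eta> by (intro mult_left_mono) auto
      ultimately have "(\<bar>\<phi> x\<bar> + \<eta>)\<^sup>2 \<le> (\<phi> x)\<^sup>2 + \<eta> * (2 * B + 1)"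
        by (simp add: power2_eq_square algebra_simps)
      then have "\<rho>0 x * (\<bar>\<phi> x\<bar> + \<eta>)\<^sup>2 \<le> \<rho>0 x * ((\<phi> x)\<^sup>2 + \<eta> * (2 * B + 1))"
        using \<rho>0 by (intro mult_left_mono) (auto simp: prob_density_def)
      then show "\<rho>0 x * (\<bar>\<phi> x\<bar> + \<eta>)\<^sup>2 \<le> \<rho>0 x * (\<phi> x)\<^sup>2 + \<eta> * (2 * B + 1) * \<rho>0 x" by (simp add: algebra_simps)
    qed
    also have "\<dots> = a + \<eta> * (2 * B + 1)"
      using set_integral_add(2)[OF i] \<rho>0 by (simp add: a_def prob_density_def)
    finally have "L * sqrt (LINT x:{0..1}|lborel. \<rho>0 x * (\<bar>\<phi> x\<bar> + \<eta>)\<^sup>2) \<le> L * sqrt (a + \<eta> * (2 * B + 1))"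
      using L by (intro mult_left_mono) auto
    then show ?thesis using step[OF \<eta>(1) B] by linarith
  qed
  then have ev: "\<forall>\<^sub>F \<eta> in at_right 0. \<bar>LINT x:{0..1}|lborel. F x * deriv \<phi> x\<bar> \<le> \<eta> * B + L * sqrt (a + \<eta> * (2 * B + 1))"
    by (intro eventually_at_rightI[of 0 1]) auto
  have "((\<lambda>\<eta>. \<eta> * B + L * sqrt (a + \<eta> * (2 * B + 1))) \<longlongrightarrow> 0 * B + L * sqrt (a + 0 * (2 * B + 1))) (at_right 0)"
    by (intro tendsto_intros)
  then have "\<bar>LINT x:{0..1}|lborel. F x * deriv \<phi> x\<bar> \<le> 0 * B + L * sqrt (a + 0 * (2 * B + 1))"
    by (rule tendsto_lowerbound[OF _ ev]) simp
  then show ?thesis by (simp add: a_def)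
qed

subsection \<open>The lower semicontinuity estimate\<close>

text \<open>The Riesz representative is measurable only on the half-open period, so the indicator of
  \<open>{0..<1}\<close> is part of the integrand.\<close>

lemma integral_Tmeas_measurable:
  assumes \<mu>: "prob_density \<mu>" and f: "f \<in> borel_measurable Tspace" and i: "integrable (Tmeas \<mu>) f"
  shows "set_integrable lborel {0..1} (\<lambda>x. indicator {0..<1} x * (\<mu> x * f x))"
    "(LINT x:{0..1}|lborel. indicator {0..<1} x * (\<mu> x * f x)) = (LINT x|Tmeas \<mu>. f x)"
proof -
  have m: "\<mu> \<in> borel_measurable Tspace" and nn: "\<And>x. 0 \<le> \<mu> x"
    using \<mu> by (auto simp: prob_density_def intro: measurable_Tspace)
  have eq: "indicator {0..1} x *\<^sub>R (indicator {0..<1} x * (\<mu> x * f x)) = indicator {0..<1} x *\<^sub>R (\<mu> x * f x)" for x :: real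
    by (auto simp: indicator_def)
  have "integrable Tspace (\<lambda>x. \<mu> x *\<^sub>R f x)"
    using i m f nn unfolding Tmeas_def by (subst (asm) integrable_density) auto
  then have "integrable lborel (\<lambda>x. indicator {0..<1} x *\<^sub>R (\<mu> x * f x))"
    by (simp add: Tspace_def integrable_restrict_space)
  then show "set_integrable lborel {0..1} (\<lambda>x. indicator {0..<1} x * (\<mu> x * f x))"
    unfolding set_integrable_def eq .
  have "(LINT x|Tmeas \<mu>. f x) = (LINT x|Tspace. \<mu> x *\<^sub>R f x)"
    unfolding Tmeas_def using m f nn by (subst integral_density) auto
  also have "\<dots> = (LINT x|lborel. indicator {0..<1} x *\<^sub>R (\<mu> x * f x))"
    unfolding Tspace_def by (subst integral_restrict_space) auto
  finally show "(LINT x:{0..1}|lborel. indicator {0..<1} x * (\<mu> x * f x)) = (LINT x|Tmeas \<mu>. f x)"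
    unfolding set_lebesgue_integral_def eq ..
qed

lemma nn_integral_Tmeas:
  assumes \<mu>: "prob_density \<mu>" and f: "f \<in> borel_measurable Tspace"
  shows "(\<integral>\<^sup>+ x. ennreal (f x) \<partial>Tmeas \<mu>) = (\<integral>\<^sup>+ x. ennreal (indicator {0..<1} x * (\<mu> x * f x)) \<partial>lborel)"
proof -
  have m: "\<mu> \<in> borel_measurable Tspace" and nn: "\<And>x. 0 \<le> \<mu> x"
    using \<mu> by (auto simp: prob_density_def intro: measurable_Tspace)
  have "(\<integral>\<^sup>+ x. ennreal (f x) \<partial>Tmeas \<mu>) = (\<integral>\<^sup>+ x. ennreal (\<mu> x) * ennreal (f x) \<partial>Tspace)"
    unfolding Tmeas_def using m f by (intro nn_integral_density) auto
  also have "\<dots> = (\<integral>\<^sup>+ x. ennreal (\<mu> x) * ennreal (f x) * indicator {0..<1} x \<partial>lborel)"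
    unfolding Tspace_def by (subst nn_integral_restrict_space) auto
  also have "\<dots> = (\<integral>\<^sup>+ x. ennreal (indicator {0..<1} x * (\<mu> x * f x)) \<partial>lborel)"
    by (intro nn_integral_cong) (auto simp: indicator_def ennreal_mult'[OF nn])
  finally show ?thesis .
qed

context potential
begin

text \<open>The functional sending \<open>\<phi>\<close> to minus the integral of
  \<open>F \<phi>'\<close> is bounded in \<open>L^2(\<rho>0)\<close> and has a representative
  \<open>v\<close>. Then \<open>\<rho>0 v\<close> is a weak derivative of
  \<open>Q (\<rho>0)\<close>, and its square divided by \<open>\<rho>0\<close> is
  \<open>\<rho>0 v^2\<close>, so the slope is the norm of \<open>v\<close>.\<close>

lemma slope_le_of_functional_bound:
  assumes \<rho>0: "prob_density \<rho>0" and L: "0 \<le> L" and F: "continuous_on UNIV F"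
    and QF: "AE x in lborel. x \<in> {0..1} \<longrightarrow> Q (\<rho>0 x) = F x"
    and F_bound: "\<And>\<phi>. test_fun \<phi> \<Longrightarrow> \<bar>LINT x:{0..1}|lborel. F x * deriv \<phi> x\<bar> \<le> L * sqrt (LINT x:{0..1}|lborel. \<rho>0 x * (\<phi> x)\<^sup>2)"
  shows "slope_Ess W \<rho>0 \<le> ennreal L"
proof -
  have nn: "\<And>x. 0 \<le> \<rho>0 x" and \<rho>m: "\<rho>0 \<in> borel_measurable borel" and \<rho>p: "periodic1 \<rho>0"
    using \<rho>0 by (auto simp: prob_density_def)
  interpret T: prob_space "Tmeas \<rho>0" by (rule prob_space_Tmeas[OF \<rho>0])
  have Tm: "borel_measurable (Tmeas \<rho>0) = borel_measurable Tspace"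
    by (rule measurable_cong_sets) (simp_all add: sets_Tmeas)
  have Fc: "continuous_on A F" for A using F continuous_on_subset by blast
  define l where "l \<phi> = - (LINT x:{0..1}|lborel. F x * deriv \<phi> x)" for \<phi>
  have sq: "(LINT x|Tmeas \<rho>0. (\<phi> x)\<^sup>2) = (LINT x:{0..1}|lborel. \<rho>0 x * (\<phi> x)\<^sup>2)"
    "square_integrable (Tmeas \<rho>0) \<phi>" if \<phi>: "test_fun \<phi>" for \<phi>
  proof -
    have c: "continuous_on UNIV \<phi>" "continuous_on UNIV (\<lambda>x. (\<phi> x)\<^sup>2)"
      using test_fun_continuous[OF \<phi>] by (auto intro: continuous_intros)
    show "(LINT x|Tmeas \<rho>0. (\<phi> x)\<^sup>2) = (LINT x:{0..1}|lborel. \<rho>0 x * (\<phi> x)\<^sup>2)" by (rule integral_Tmeas(2)[OF \<rho>0 c(2)])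
    show "square_integrable (Tmeas \<rho>0) \<phi>"
      using integral_Tmeas(1)[OF \<rho>0 c(2)] measurable_Tspace[OF borel_measurable_continuous_onI[OF c(1)]]
      by (simp add: square_integrable_def Tm)
  qed
  have l_lin: "l (\<lambda>x. c * \<phi> x + d * \<psi> x) = c * l \<phi> + d * l \<psi>" if \<phi>: "test_fun \<phi>" and \<psi>: "test_fun \<psi>" for \<phi> \<psi> c d
  proof -
    have der: "deriv (\<lambda>x. c * \<phi> x + d * \<psi> x) = (\<lambda>x. c * deriv \<phi> x + d * deriv \<psi> x)"
      by (rule deriv_eqI) (auto intro!: derivative_eq_intros test_fun_differentiable \<phi> \<psi>)
    have i: "set_integrable lborel {0..1} (\<lambda>x. F x * deriv \<phi> x)" "set_integrable lborel {0..1} (\<lambda>x. F x * deriv \<psi> x)"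
      by (intro set_integrable_continuous continuous_intros Fc test_fun_continuous test_fun_deriv \<phi> \<psi>)+
    have "(LINT x:{0..1}|lborel. F x * (c * deriv \<phi> x + d * deriv \<psi> x))
        = (LINT x:{0..1}|lborel. c * (F x * deriv \<phi> x) + d * (F x * deriv \<psi> x))" by (simp add: algebra_simps)
    also have "\<dots> = (LINT x:{0..1}|lborel. c * (F x * deriv \<phi> x)) + (LINT x:{0..1}|lborel. d * (F x * deriv \<psi> x))"
      by (intro set_integral_add set_integrable_mult_right i)
    finally show ?thesis by (simp add: l_def der)
  qed
  obtain v where v: "square_integrable (Tmeas \<rho>0) v" "(LINT x|Tmeas \<rho>0. (v x)\<^sup>2) \<le> L\<^sup>2"
    "\<And>\<phi>. \<phi> \<in> Collect test_fun \<Longrightarrow> l \<phi> = (LINT x|Tmeas \<rho>0. v x * \<phi> x)"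
  proof (rule Riesz_representation[of "Tmeas \<rho>0" "Collect test_fun" "\<lambda>_. 0" l L])
    show "finite_measure (Tmeas \<rho>0)" by unfold_locales
    show "l \<phi> \<le> L * sqrt (LINT x|Tmeas \<rho>0. (\<phi> x)\<^sup>2)" if "\<phi> \<in> Collect test_fun" for \<phi>
      using F_bound[of \<phi>] that by (simp add: sq(1) l_def)
  qed (use sq(2) test_fun_lincomb l_lin test_fun_const L in auto)
  have vm: "v \<in> borel_measurable Tspace" and v2: "integrable (Tmeas \<rho>0) (\<lambda>x. (v x)\<^sup>2)"
    using v(1) by (auto simp: square_integrable_def Tm)
  define h where "h x = indicator {0..<1} x * (\<rho>0 x * v x)" for x :: real
  have hi: "set_integrable lborel {0..1} h"
    unfolding h_def by (rule integral_Tmeas_measurable(1)[OF \<rho>0 vm square_integrable_integrable[OF _ v(1)]]) unfold_locales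
  have h_rep: "(LINT x:{0..1}|lborel. h x * \<phi> x) = l \<phi>" if \<phi>: "test_fun \<phi>" for \<phi>
  proof -
    have \<phi>m: "\<phi> \<in> borel_measurable Tspace"
      by (intro measurable_Tspace borel_measurable_continuous_onI test_fun_continuous \<phi>)
    have "(LINT x:{0..1}|lborel. indicator {0..<1} x * (\<rho>0 x * (v x * \<phi> x))) = (LINT x|Tmeas \<rho>0. v x * \<phi> x)"
      using vm \<phi>m by (intro integral_Tmeas_measurable(2)[OF \<rho>0] square_integrable_mult v(1) sq(2) \<phi>) auto
    then show ?thesis using v(3)[of \<phi>] \<phi> by (simp add: h_def mult_ac)
  qed
  have Qm: "(\<lambda>x. Q (\<rho>0 x)) \<in> borel_measurable borel"
  proof -
    \<comment> \<open>\<open>Q\<close> is known to be continuous only on the nonnegative axis;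
      truncation extends it without changing it along \<open>\<rho>0\<close>.\<close>
    have "continuous_on UNIV (\<lambda>y. Q (max 0 y))"
      by (rule continuous_on_compose2[OF Q_cont]) (auto intro!: continuous_intros)
    then have "(\<lambda>x. Q (max 0 (\<rho>0 x))) \<in> borel_measurable borel"
      using measurable_compose[OF \<rho>m borel_measurable_continuous_onI] by blast
    then show ?thesis using nn by (simp add: max_def)
  qed
  have Fm: "F \<in> borel_measurable borel" by (rule borel_measurable_continuous_onI[OF F])
  have Qi: "set_integrable lborel {0..1} (\<lambda>x. Q (\<rho>0 x))"
    using set_integrable_continuous[OF Fc[of "{0..1}"]] unfolding set_integrable_def
    by (rule integrable_cong_AE_imp) (use Qm QF in \<open>auto elim!: eventually_mono simp: indicator_def\<close>)
  have wderiv: "weak_deriv (\<lambda>x. Q (\<rho>0 x)) h"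
    unfolding weak_deriv_def
  proof (intro conjI allI impI Qi hi)
    fix \<phi> assume \<phi>: "test_fun \<phi>"
    have dm: "deriv \<phi> \<in> borel_measurable borel"
      by (intro borel_measurable_continuous_onI test_fun_continuous test_fun_deriv \<phi>)
    have "(LINT x:{0..1}|lborel. Q (\<rho>0 x) * deriv \<phi> x) = (LINT x:{0..1}|lborel. F x * deriv \<phi> x)"
      unfolding set_lebesgue_integral_def
      by (intro integral_cong_AE) (use Qm Fm dm QF in \<open>auto elim!: eventually_mono simp: indicator_def\<close>)
    then show "(LINT x:{0..1}|lborel. Q (\<rho>0 x) * deriv \<phi> x) = - (LINT x:{0..1}|lborel. h x * \<phi> x)"
      using h_rep[OF \<phi>] by (simp add: l_def)
  qed
  have W11: "W11 (\<lambda>x. Q (\<rho>0 x))" using wderiv \<rho>p by (auto simp: W11_def periodic1_def)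
  define I where "I = (\<integral>\<^sup>+ x\<in>{0..1}. ennreal (if \<rho>0 x > 0 then (wd (\<lambda>y. Q (\<rho>0 y)) x)\<^sup>2 / \<rho>0 x else 0) \<partial>lborel)"
  have "I = (\<integral>\<^sup>+ x. ennreal (indicator {0..<1} x * (\<rho>0 x * (v x)\<^sup>2)) \<partial>lborel)"
    unfolding I_def
  proof (rule nn_integral_cong_AE)
    show "AE x in lborel. ennreal (if \<rho>0 x > 0 then (wd (\<lambda>y. Q (\<rho>0 y)) x)\<^sup>2 / \<rho>0 x else 0) * indicator {0..1} x
        = ennreal (indicator {0..<1} x * (\<rho>0 x * (v x)\<^sup>2))"
      using wd_AE[OF wderiv] AE_lborel_singleton[of "1::real"]
    proof eventually_elim
      case (elim x)
      show ?case
      proof (cases "x \<in> {0..<1}")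
        case True
        then have "wd (\<lambda>y. Q (\<rho>0 y)) x = \<rho>0 x * v x" using elim by (simp add: h_def)
        then show ?thesis using True nn[of x] by (auto simp: power2_eq_square mult_ac)
      next
        case False
        then have "x \<notin> {0..1}" using elim(2) by auto
        then have "indicator {0..1} x = (0::ennreal)" "indicator {0..<1} x = (0::real)"
          using False by (simp_all only: indicator_simps not_False_eq_True)
        then show ?thesis by (simp only: mult_zero_left mult_zero_right ennreal_0)
      qed
    qed
  qed
  also have "\<dots> = (\<integral>\<^sup>+ x. ennreal ((v x)\<^sup>2) \<partial>Tmeas \<rho>0)"
    using vm by (intro nn_integral_Tmeas[OF \<rho>0, symmetric]) auto
  also have "\<dots> = ennreal (LINT x|Tmeas \<rho>0. (v x)\<^sup>2)" using v2 by (intro nn_integral_eq_integral) auto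
  finally have I_eq: "I = ennreal (LINT x|Tmeas \<rho>0. (v x)\<^sup>2)" .
  then have "slope_Ess W \<rho>0 = ennreal (sqrt (LINT x|Tmeas \<rho>0. (v x)\<^sup>2))"
    unfolding slope_Ess_def using W11 by (simp add: Let_def I_def[symmetric])
  also have "\<dots> \<le> ennreal L"
    using v(2) L by (intro ennreal_leI real_le_lsqrt) auto
  finally show ?thesis .
qed

lemma slope_le_of_sequence:
  assumes H1: "0 < C1" "\<And>y. 0 \<le> y \<Longrightarrow> \<bar>y * W' y - W y\<bar> \<le> C1 * (1 + W y)"
    and H2: "filterlim (\<lambda>y. y * W' y - W y) at_top at_top"
    and \<epsilon>: "\<And>n. 0 < \<epsilon> n" "\<epsilon> \<longlonglongrightarrow> 0"
    and \<rho>: "\<And>n. prob_density (\<rho> n)" "\<And>n. Ck_on 1 UNIV (\<rho> n)" and \<rho>0: "prob_density \<rho>0"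
    and conv: "(\<lambda>n. d2 (\<rho> n) \<rho>0) \<longlonglongrightarrow> 0"
    and bdd: "\<And>n. Eeps W (\<epsilon> n) (\<rho> n) \<le> ennreal C" and C: "0 \<le> C"
    and g: "\<And>n. g n \<in> Tset W W' (\<epsilon> n) (\<rho> n)" "\<And>n. sqrt (LINT x:{0..1}|lborel. (g n x)\<^sup>2) \<le> l n"
    and l: "l \<longlonglongrightarrow> L" "\<And>n. l n \<le> Lb" and L: "0 \<le> L"
  shows "slope_Ess W \<rho>0 \<le> ennreal L"
proof -
  have l0: "0 \<le> l n" for n
    using g(2)[of n] by (rule order_trans[rotated]) (simp add: set_lebesgue_integral_def)
  have Lb: "0 \<le> Lb" using l0[of 0] l(2)[of 0] by linarith
  define R where "R = C1 * (1 + C) + 3 * C + Lb"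
  \<comment> \<open>Superlinearity of \<open>W\<close> in the form \<open>H2\<close> turns the flux
    bound \<open>R\<close> into a bound on all densities.\<close>
  obtain M where M: "\<And>y. M \<le> y \<Longrightarrow> R < y * W' y - W y"
    using H2 unfolding filterlim_at_top_dense eventually_at_top_linorder by blast
  have M': "y \<le> M" if "y * W' y - W y \<le> R" for y using M[of y] that by force
  have g2: "(LINT x:{0..1}|lborel. (g n x)\<^sup>2) \<le> Lb\<^sup>2" for n
  proof -
    have "sqrt (LINT x:{0..1}|lborel. (g n x)\<^sup>2) \<le> Lb" using g(2)[of n] l(2)[of n] by linarith
    then show ?thesis by (rule sqrt_le_D)
  qed
  have "\<forall>n. \<exists>G H. profile W W' (\<epsilon> n) (sqrt M * Lb) M (\<rho> n) (deriv (\<rho> n)) G H \<and>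
    (\<forall>x. \<bar>G x\<bar> \<le> R) \<and> periodic1 G \<and>
    (\<forall>x y. x \<le> y \<longrightarrow> 0 \<le> x \<longrightarrow> y \<le> 1 \<longrightarrow> H y - H x = (LINT t:{x..y}|lborel. sqrt (\<rho> n t) * \<bar>g n t\<bar>))"
    unfolding R_def
    by (intro allI, rule profile_exists[OF \<rho> \<epsilon>(1) g(1) g2 Lb bdd C less_imp_le[OF H1(1)] H1(2) M'[unfolded R_def]])
  then obtain G H where GH: "\<forall>n. profile W W' (\<epsilon> n) (sqrt M * Lb) M (\<rho> n) (deriv (\<rho> n)) (G n) (H n) \<and>
    (\<forall>x. \<bar>G n x\<bar> \<le> R) \<and> periodic1 (G n) \<and>
    (\<forall>x y. x \<le> y \<longrightarrow> 0 \<le> x \<longrightarrow> y \<le> 1 \<longrightarrow> H n y - H n x = (LINT t:{x..y}|lborel. sqrt (\<rho> n t) * \<bar>g n t\<bar>))"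
    unfolding choice_iff by (elim exE)
  have prof: "profile W W' (\<epsilon> n) (sqrt M * Lb) M (\<rho> n) (deriv (\<rho> n)) (G n) (H n)"
    and GR: "\<bar>G n x\<bar> \<le> R" and Gp: "periodic1 (G n)"
    and Hd: "x \<le> y \<Longrightarrow> 0 \<le> x \<Longrightarrow> y \<le> 1 \<Longrightarrow> H n y - H n x = (LINT t:{x..y}|lborel. sqrt (\<rho> n t) * \<bar>g n t\<bar>)" for n x y
    using spec[OF GH, of n] by simp_all
  have \<rho>p: "periodic1 (\<rho> n)" for n using \<rho>(1) by (simp add: prob_density_def)
  obtain G0 F k where GF: "continuous_on UNIV G0" "continuous_on UNIV F" "periodic1 F" "strict_mono (k :: nat \<Rightarrow> nat)"
    and Glim: "\<And>e. 0 < e \<Longrightarrow> \<exists>N. \<forall>n\<ge>N. \<forall>x. \<bar>G (k n) x - G0 x\<bar> < e"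
    and Flim: "\<And>e. 0 < e \<Longrightarrow> \<exists>N. \<forall>n\<ge>N. \<forall>x. \<bar>Q (\<rho> (k n) x) - F x\<bar> < e"
    and FG: "\<And>x. F x = G0 x \<or> F x \<in> Q ` \<rat>"
    by (rule profile_compactness[OF prof \<epsilon>(2) Gp GR \<rho>p]) (rule that)
  have k: "filterlim k at_top sequentially" by (rule filterlim_subseq[OF GF(4)])
  have weak: "(\<lambda>n. LINT x:{0..1}|lborel. \<rho> (k n) x * f x) \<longlonglongrightarrow> (LINT x:{0..1}|lborel. \<rho>0 x * f x)"
    if "continuous_on UNIV f" "periodic1 f" for f
    using filterlim_compose[OF d2_imp_weak_convergence[OF \<rho>(1) \<rho>0 conv that] k] .
  have QF: "AE x in lborel. x \<in> {0..1} \<longrightarrow> Q (\<rho>0 x) = F x"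
    by (rule Q_limit_AE[OF \<rho>(1) \<rho>0 weak GF(2,3) Flim])
  have osc: "\<exists>p q. x \<le> p \<and> p \<le> q \<and> q \<le> y \<and> F y - F x = G0 q - G0 p" if "x \<le> y" for x y
    by (rule oscillation_le_of_countable[OF GF(2,1) countable_Q_Rats FG that]) blast
  have gm: "g n \<in> borel_measurable borel" "set_integrable lborel {0..1} (\<lambda>x. (g n x)\<^sup>2)" for n
    using g(1)[of n] by (auto simp: Tset_def)
  have \<rho>c: "continuous_on UNIV (\<rho> n)" for n by (rule profile.u_cont[OF prof])
  have F_bound: "\<bar>LINT x:{0..1}|lborel. F x * deriv \<phi> x\<bar> \<le> L * sqrt (LINT x:{0..1}|lborel. \<rho>0 x * (\<phi> x)\<^sup>2)"
    if \<phi>: "test_fun \<phi>" for \<phi>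
  proof (rule limit_functional_bound[OF \<phi> \<rho>0 L])
    fix \<eta> B :: real assume \<eta>: "0 < \<eta>" and B: "\<And>x. \<bar>\<phi> x\<bar> \<le> B" "\<And>x. \<bar>deriv \<phi> x\<bar> \<le> B"
    show "\<bar>LINT x:{0..1}|lborel. F x * deriv \<phi> x\<bar> \<le> \<eta> * B + L * sqrt (LINT x:{0..1}|lborel. \<rho>0 x * (\<bar>\<phi> x\<bar> + \<eta>)\<^sup>2)"
      by (rule limit_functional_bound_step[OF \<phi> B GF(2,3) osc Glim profile.G_H[OF prof] Hd \<rho>(1) \<rho>c
            gm g(2) filterlim_compose[OF l(1) k] weak \<eta>])
  qed
  show ?thesis by (rule slope_le_of_functional_bound[OF \<rho>0 L GF(2) QF F_bound])
qed

end

text \<open>By contradiction: a value \<open>y\<close> below the slope that \<open>Gcal\<close>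
  fails to exceed eventually yields parameters tending to 0 and almost optimal \<open>g\<close> with
  norms tending to at most \<open>y\<close>. The sequential estimate then bounds the slope by
  \<open>y\<close>.\<close>

theorem theorem3p2:
  fixes W W' W'' :: "real \<Rightarrow> real" and p :: nat and a b :: "nat \<Rightarrow> real"
    and \<rho> :: "real \<Rightarrow> real \<Rightarrow> real" and \<rho>0 :: "real \<Rightarrow> real"
  assumes W_deriv: "\<forall>y\<ge>0. (W has_real_derivative W' y) (at y within {0..})"
    and W'_deriv: "\<forall>y\<ge>0. (W' has_real_derivative W'' y) (at y within {0..})"
    and W''_cont: "continuous_on {0..} W''"
    and W_nonneg: "\<forall>y\<ge>0. 0 \<le> W y"
    and W0: "W 0 = 0" and W'0: "W' 0 = 0"
    and H1: "\<exists>C>0. \<forall>y\<ge>0. \<bar>y * W' y - W y\<bar> \<le> C * (1 + W y) \<and> \<bar>W' y\<bar> \<le> C * (1 + W y)"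
    and H2: "filterlim (\<lambda>y. y * W' y - W y) at_top at_top"
    and H3: "closure ({y. 0 \<le> y \<and> W y > convex_env W y} \<union> {0}) = (\<Union>i<p. {a i..b i})"
    and H3_ord: "\<forall>i<p. a i \<le> b i" and H3_sep: "\<forall>i. Suc i < p \<longrightarrow> b i < a (Suc i)"
    and H4: "\<forall>y. 0 \<le> y \<and> y \<notin> (\<Union>i<p. {a i..b i}) \<longrightarrow> W'' y > 0"
    and H4_cpt: "\<forall>K. compact K \<and> K \<subseteq> {0..} - (\<Union>i<p. {a i..b i}) \<longrightarrow>
                   (\<exists>c>0. \<forall>y\<in>K. c \<le> W'' y)"
    and rho_P: "\<forall>\<epsilon>>0. prob_density (\<rho> \<epsilon>)"
    and rho_C1: "\<forall>\<epsilon>>0. Ck_on 1 UNIV (\<rho> \<epsilon>)"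
    and rho_C4: "\<forall>\<epsilon>>0. Ck_on 4 {x. \<rho> \<epsilon> x > 0} (\<rho> \<epsilon>)"
    and rho0_P: "prob_density \<rho>0"
    and conv: "((\<lambda>\<epsilon>. d2 (\<rho> \<epsilon>) \<rho>0) \<longlongrightarrow> 0) (at_right 0)"
    and bdd: "\<exists>C::real. \<forall>\<epsilon>>0. Eeps W \<epsilon> (\<rho> \<epsilon>) \<le> ennreal C"
  shows "Liminf (at_right 0) (\<lambda>\<epsilon>. Gcal W W' \<epsilon> (\<rho> \<epsilon>)) \<ge> slope_Ess W \<rho>0"
proof -
  interpret potential W W'
  proof
    show "continuous_on {0..} W'" using W'_deriv by (metis DERIV_continuous_on atLeast_iff)
  qed (use W_deriv W_nonneg W0 in auto)
  obtain C1 where C1: "0 < C1" "\<And>y. 0 \<le> y \<Longrightarrow> \<bar>y * W' y - W y\<bar> \<le> C1 * (1 + W y)" using H1 by blast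
  obtain C0 :: real where C0: "\<And>\<epsilon>. 0 < \<epsilon> \<Longrightarrow> Eeps W \<epsilon> (\<rho> \<epsilon>) \<le> ennreal C0" using bdd by blast
  \<comment> \<open>\<open>ennreal\<close> truncates negative numbers to 0, so the bound may be
    taken nonnegative.\<close>
  define C where "C = max C0 0"
  have C: "0 \<le> C" "\<And>\<epsilon>. 0 < \<epsilon> \<Longrightarrow> Eeps W \<epsilon> (\<rho> \<epsilon>) \<le> ennreal C"
    using C0 by (auto simp: C_def intro: order_trans ennreal_leI)
  show ?thesis
    unfolding le_Liminf_iff
  proof (intro allI impI; rule ccontr)
    fix y assume y: "y < slope_Ess W \<rho>0" and neg: "\<not> (\<forall>\<^sub>F \<epsilon> in at_right 0. y < Gcal W W' \<epsilon> (\<rho> \<epsilon>))"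
    obtain L where L: "y = ennreal L" "0 \<le> L" using y by (cases y) auto
    \<comment> \<open>The infimum in \<open>Gcal\<close> need not be attained; the slack
      \<open>inverse (real (Suc n))\<close> selects an admissible \<open>g\<close> and disappears in
      the limit.\<close>
    have "\<exists>\<epsilon> g. 0 < \<epsilon> \<and> \<epsilon> < inverse (real (Suc n)) \<and> g \<in> Tset W W' \<epsilon> (\<rho> \<epsilon>) \<and>
        sqrt (LINT x:{0..1}|lborel. (g x)\<^sup>2) \<le> L + inverse (real (Suc n))" for n
    proof -
      have "\<exists>\<epsilon>. 0 < \<epsilon> \<and> \<epsilon> < inverse (real (Suc n)) \<and> \<not> y < Gcal W W' \<epsilon> (\<rho> \<epsilon>)"
      proof (rule ccontr)
        assume "\<not> ?thesis"
        then have "\<forall>\<^sub>F \<epsilon> in at_right 0. y < Gcal W W' \<epsilon> (\<rho> \<epsilon>)"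
          by (intro eventually_at_rightI[of 0 "inverse (real (Suc n))"]) auto
        then show False using neg by contradiction
      qed
      then obtain \<epsilon> where \<epsilon>: "0 < \<epsilon>" "\<epsilon> < inverse (real (Suc n))" "Gcal W W' \<epsilon> (\<rho> \<epsilon>) \<le> ennreal L"
        using L(1) by (auto simp: not_less)
      have "ennreal L < ennreal (L + inverse (real (Suc n)))" using L(2) by (simp add: ennreal_less_iff)
      then have lt: "Gcal W W' \<epsilon> (\<rho> \<epsilon>) < ennreal (L + inverse (real (Suc n)))" using \<epsilon>(3) by (rule le_less_trans[rotated])
      then have "Gcal W W' \<epsilon> (\<rho> \<epsilon>) = (INF g \<in> Tset W W' \<epsilon> (\<rho> \<epsilon>). ennreal (sqrt (LINT x:{0..1}|lborel. (g x)\<^sup>2)))"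
        unfolding Gcal_def by (auto split: if_splits)
      then have "(INF g \<in> Tset W W' \<epsilon> (\<rho> \<epsilon>). ennreal (sqrt (LINT x:{0..1}|lborel. (g x)\<^sup>2))) < ennreal (L + inverse (real (Suc n)))"
        using lt by (simp only:)
      then obtain g where g: "g \<in> Tset W W' \<epsilon> (\<rho> \<epsilon>)" "ennreal (sqrt (LINT x:{0..1}|lborel. (g x)\<^sup>2)) < ennreal (L + inverse (real (Suc n)))"
        unfolding INF_less_iff by (elim bexE)
      have "0 \<le> L + inverse (real (Suc n))" using L(2) by simp
      then have "sqrt (LINT x:{0..1}|lborel. (g x)\<^sup>2) \<le> L + inverse (real (Suc n))"
        using order_less_imp_le[OF g(2)] by (simp only: ennreal_le_iff)
      then show ?thesis using \<epsilon> g(1) by blast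
    qed
    then obtain \<epsilon> g where \<epsilon>: "\<And>n. 0 < \<epsilon> n" "\<And>n. \<epsilon> n < inverse (real (Suc n))"
      and g: "\<And>n. g n \<in> Tset W W' (\<epsilon> n) (\<rho> (\<epsilon> n))"
        "\<And>n. sqrt (LINT x:{0..1}|lborel. (g n x)\<^sup>2) \<le> L + inverse (real (Suc n))"
      by metis
    have \<epsilon>0: "\<epsilon> \<longlonglongrightarrow> 0"
      by (rule tendsto_sandwich[OF _ _ tendsto_const LIMSEQ_inverse_real_of_nat])
        (use \<epsilon> in \<open>auto intro!: always_eventually less_imp_le\<close>)
    have "filterlim \<epsilon> (at_right 0) sequentially"
    proof -
      have "\<epsilon> n \<noteq> 0" for n using \<epsilon>(1)[of n] by simp
      then show ?thesis using \<epsilon>0 \<epsilon>(1) by (simp add: filterlim_at)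
    qed
    from filterlim_compose[OF conv this] have conv': "(\<lambda>n. d2 (\<rho> (\<epsilon> n)) \<rho>0) \<longlonglongrightarrow> 0" .
    have l_lim: "(\<lambda>n. L + inverse (real (Suc n))) \<longlonglongrightarrow> L"
      using tendsto_add[OF tendsto_const LIMSEQ_inverse_real_of_nat, of L] by simp
    have l_le: "L + inverse (real (Suc n)) \<le> L + 1" for n
      by (simp add: inverse_le_1_iff)
    have "slope_Ess W \<rho>0 \<le> ennreal L"
      by (rule slope_le_of_sequence[OF C1 H2 \<epsilon>(1) \<epsilon>0 _ _ rho0_P conv' C(2)[OF \<epsilon>(1)] C(1) g l_lim l_le L(2)])
        (use rho_P rho_C1 \<epsilon>(1) in auto)
    then show False using y L(1) by simp
  qed
qed

end
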